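(* Let $N,n\ge1$ be integers and $1\le p\le\infty$. There is a constant $C$, independent of $f$ and $\delta$, such that for every $f\in H(\mathbb B_N)$ $$\omega_n^+(\delta,f_{1-\delta})_p\le C\delta^nM_p(1-\delta,\mathcal R^nf),\quad 0<\delta<1.$$
   Context: $\mathbb B_N$ is the unit ball of $\mathbb C^N$, $\mathbb S_N=\partial\mathbb B_N$, $\sigma$ is the normalized Lebesgue measure on $\mathbb S_N$, and $H(\mathbb B_N)$ is the space of holomorphic functions on $\mathbb B_N$. For $0<r<1$, $M_p(r,g)=\left(\int_{\mathbb S_N}|g(r\zeta)|^p\,d\sigma(\zeta)\right)^{1/p}$ for $p<\infty$ and $M_\infty(r,g)=\operatorname{ess\,sup}_{\zeta\in\mathbb S_N}|g(r\zeta)|$; $\|g\|_p=\sup_{0<r<1}M_p(r,g)$. For $0<\rho<1$, $f_\rho(z)=f(\rho z)$. If $f=\sum_{k\ge0}f_k$ is the homogeneous expansion of $f$, then $\mathcal R^nf=\sum_{k\ge1}k^nf_k$. Let $\mathcal L$ be the semigroup of all linear operators from $\mathbb B_N$ to $\mathbb B_N$ and $I$ the identity. For $U\in\mathcal L$, $\Delta^1_Ug(z)=g(Uz)-g(z)$ and $\Delta^n_Ug=\Delta^1_U(\Delta^{n-1}_Ug)$ for $n\ge2$; $\omega_n^+(\delta,g)_p=\sup_{\|U-I\|<\delta,\,U\in\mathcal L}\|\Delta^n_Ug\|_p$. *)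

theory Defs
  imports "HOL-Probability.Essential_Supremum"
begin

text \<open>Complex $N$-space is \<open>complex ^ 'n\<close> with \<open>N = CARD('n)\<close>; its \<open>norm\<close> is the Euclidean
  one, so the open unit ball is \<open>ball 0 1\<close> and the unit sphere is \<open>sphere 0 1\<close>. Complex scalars act
  by \<open>*s\<close>. Only the values of functions on the unit ball matter below.\<close>

definition holomorphic_ball :: "(complex ^ 'n \<Rightarrow> complex) \<Rightarrow> bool" where
  "holomorphic_ball f \<longleftrightarrow>
     (\<forall>z\<in>ball 0 1. \<exists>L. (f has_derivative L) (at z) \<and> (\<forall>c v. L (c *s v) = c * L v))"

text \<open>Normalized surface measure on the unit sphere, in polar coordinates: the \<open>\<sigma>\<close>-measure of a set
  \<open>A\<close> is the proportion of the volume of the unit ball taken up by the cone over \<open>A\<close>. Note that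
  \<open>sgn z = z /\<^sub>R norm z\<close>.\<close>

definition sphere_measure :: "(complex ^ 'n) measure" where
  "sphere_measure =
     restrict_space (distr (uniform_measure lborel (ball 0 1)) borel sgn) (sphere 0 1)"

text \<open>Means and norms are taken in \<open>ennreal\<close>, as the suprema involved may a priori be infinite.
  The power is only used with a positive exponent, so the power of \<open>\<infinity>\<close> is \<open>\<infinity>\<close>.\<close>

definition ennreal_power :: "ennreal \<Rightarrow> real \<Rightarrow> ennreal" where
  "ennreal_power x a = (if x = \<infinity> then \<infinity> else ennreal (enn2real x powr a))"

definition integral_mean :: "ennreal \<Rightarrow> real \<Rightarrow> (complex ^ 'n \<Rightarrow> complex) \<Rightarrow> ennreal" where
  "integral_mean p r g =
     (if p = \<infinity> then esssup sphere_measure (\<lambda>\<zeta>. ennreal (norm (g (r *\<^sub>R \<zeta>))))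
      else ennreal_power
        (\<integral>\<^sup>+ \<zeta>. ennreal (norm (g (r *\<^sub>R \<zeta>)) powr enn2real p) \<partial>sphere_measure)
        (1 / enn2real p))"

definition hardy_norm :: "ennreal \<Rightarrow> (complex ^ 'n \<Rightarrow> complex) \<Rightarrow> ennreal" where
  "hardy_norm p g = (SUP r\<in>{0<..<1}. integral_mean p r g)"

definition dilate :: "real \<Rightarrow> (complex ^ 'n \<Rightarrow> complex) \<Rightarrow> complex ^ 'n \<Rightarrow> complex" where
  "dilate \<rho> f z = f (\<rho> *\<^sub>R z)"

definition homogeneous_polynomial :: "nat \<Rightarrow> (complex ^ 'n \<Rightarrow> complex) \<Rightarrow> bool" where
  "homogeneous_polynomial k q \<longleftrightarrow>
     (\<exists>c :: ('n \<Rightarrow> nat) \<Rightarrow> complex. \<forall>z.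
        q z = (\<Sum>\<alpha> | (\<Sum>i\<in>UNIV. \<alpha> i) = k. c \<alpha> * (\<Prod>i\<in>UNIV. z $ i ^ \<alpha> i)))"

definition is_homogeneous_expansion ::
    "(complex ^ 'n \<Rightarrow> complex) \<Rightarrow> (nat \<Rightarrow> complex ^ 'n \<Rightarrow> complex) \<Rightarrow> bool" where
  "is_homogeneous_expansion f F \<longleftrightarrow>
     (\<forall>k. homogeneous_polynomial k (F k)) \<and> (\<forall>z\<in>ball 0 1. (\<lambda>k. F k z) sums f z)"

text \<open>The choice below is harmless: a function holomorphic on the ball has a homogeneous expansion,
  and it has only one, since its restriction to each complex line through the origin is a power
  series in one variable.\<close>

definition homogeneous_part ::
    "(complex ^ 'n \<Rightarrow> complex) \<Rightarrow> nat \<Rightarrow> complex ^ 'n \<Rightarrow> complex" where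
  "homogeneous_part f = (SOME F. is_homogeneous_expansion f F)"

text \<open>The series starts at degree \<open>1\<close>; hence the index shift.\<close>

definition radial_derivative ::
    "nat \<Rightarrow> (complex ^ 'n \<Rightarrow> complex) \<Rightarrow> complex ^ 'n \<Rightarrow> complex" where
  "radial_derivative n f z = (\<Sum>k. of_nat (Suc k) ^ n * homogeneous_part f (Suc k) z)"

definition ball_operators :: "(complex ^ 'n \<Rightarrow> complex ^ 'n) set" where
  "ball_operators = {U. Vector_Spaces.linear (*s) (*s) U \<and> U ` ball 0 1 \<subseteq> ball 0 1}"

definition difference ::
    "(complex ^ 'n \<Rightarrow> complex ^ 'n) \<Rightarrow> (complex ^ 'n \<Rightarrow> complex) \<Rightarrow> complex ^ 'n \<Rightarrow> complex" where
  "difference U g z = g (U z) - g z"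

definition modulus_plus :: "nat \<Rightarrow> real \<Rightarrow> (complex ^ 'n \<Rightarrow> complex) \<Rightarrow> ennreal \<Rightarrow> ennreal" where
  "modulus_plus n \<delta> g p =
     (SUP U\<in>{U \<in> ball_operators. onorm (\<lambda>z. U z - z) < \<delta>}. hardy_norm p ((difference U ^^ n) g))"

end

theory Submission
  imports Defs "HOL-Complex_Analysis.Complex_Analysis" "HOL-Probability.Probability_Measure"
begin

text \<open>Write \<open>N\<close> for the \<open>L\<^sup>p\<close> norm over the unit sphere, \<open>R\<close> for the radial derivative and \<open>g\<close> for
  the dilated function, which is holomorphic on a neighbourhood of the closed ball. If \<open>U\<close> is a
  linear contraction with \<open>norm (U z - z) \<le> \<delta> * norm z\<close>, the claim reads
  \<open>N (\<Delta>\<^sub>U\<^sup>n g \<circ> V) \<le> C \<delta>\<^sup>n N (R\<^sup>n g)\<close> for the homotheties \<open>V\<close> by factors below \<open>1\<close>. It is proved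
  for every linear contraction \<open>V\<close> that commutes with \<open>U\<close>, because this is the form that survives
  an induction on \<open>n\<close>. Two facts carry the proof.

  First, composition with a linear contraction \<open>V\<close> does not increase \<open>N\<close>
  (\<open>sphere_norm_contraction\<close>). If \<open>V\<close> is not unitary, it is an interior point of an analytic disc
  of contractions whose boundary consists of contractions that are isometric on a larger subspace.
  The mean value property of a holomorphic function on this disc and the Minkowski inequality
  bound the norm at \<open>V\<close> by the norms at the boundary. After finitely many steps only unitary maps
  are left, and these preserve the surface measure.

  Second, every partial derivative of \<open>g\<close> is bounded in \<open>N\<close> by \<open>R g\<close>
  (\<open>sphere_norm_partial_derivative\<close>). On the sphere, a partial derivative is a combination, with
  coefficients of modulus at most \<open>1\<close>, of \<open>R g\<close> and of the derivatives along the conjugate linear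
  fields \<open>A z = cnj z\<^sub>j e\<^sub>i - cnj z\<^sub>i e\<^sub>j\<close>. Integrating \<open>R g\<close> along a radius gives
  \<open>Dg(z)[A z] = \<integral>\<^sub>0\<^sup>1 D(R g)(s z)[A z] ds\<close>. Now \<open>A z\<close> is orthogonal to \<open>z\<close> in the complex sense
  and not longer than \<open>z\<close>, so with \<open>c = sqrt (1 - s\<^sup>2)\<close> the disc of all \<open>s z + l c A z\<close>,
  \<open>norm l \<le> 1\<close>, stays in the closed ball, and Cauchy's estimate on it costs only the factor
  \<open>1 / c\<close>, whose integral over \<open>s\<close> is \<open>\<pi> / 2\<close>. For \<open>norm l = 1\<close> the map \<open>z \<mapsto> s z + l c A z\<close> is a
  real isometry (quaternion multiplication in the coordinates \<open>i\<close> and \<open>j\<close>) followed by a diagonal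
  contraction, hence harmless for \<open>N\<close>. Orthogonality is essential: for a nonzero complex linear
  field in place of \<open>A\<close> the disc would have radius of order \<open>1 - s\<close> only, and the integral would
  diverge.

  The differences are then treated by induction. With \<open>W\<^sub>t = (1 - t) I + t U\<close> one has
  \<open>\<Delta>\<^sub>U g (z) = \<integral>\<^sub>0\<^sup>1 (\<Sum>j. \<partial>\<^sub>j g (W\<^sub>t z) (U z - z)\<^sub>j) dt\<close>. Taking \<open>n - 1\<close> further differences and
  using the product rule, the linear factor always contributes as many powers of \<open>\<delta>\<close> as the
  differences that fell on it and one more, while the other factor is a lower difference of
  \<open>\<partial>\<^sub>j g\<close>. The commutation rule \<open>R \<partial>\<^sub>j = \<partial>\<^sub>j (R - 1)\<close> turns the resulting bounds \<open>N (R\<^sup>k \<partial>\<^sub>j g)\<close>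
  into bounds by \<open>N (R\<^sup>k\<^sup>+\<^sup>1 g)\<close>.

  It remains to see that the radial derivative, which is given by homogeneous expansions, is
  obtained by iterating \<open>R g (z) = Dg(z)[z]\<close>. Expansions exist since the Taylor coefficients of
  \<open>g\<close> along the complex lines through the origin are homogeneous polynomials in the direction of
  the line, and on each line the series may be differentiated termwise.\<close>

section \<open>Complex differentiable functions of several variables\<close>

lemma norm_smult: "norm (c *s v) = norm c * norm (v :: complex ^ 'n)"
  by (simp add: norm_vec_def norm_mult L2_set_right_distrib)

lemma scaleR_eq_smult: "r *\<^sub>R v = complex_of_real r *s (v :: complex ^ 'n)"
  by (simp add: vec_eq_iff scaleR_conv_of_real[where 'a=complex])

lemma bounded_linear_smult_left: "bounded_linear (\<lambda>c. c *s (v :: complex ^ 'n))"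
  by (rule bounded_linear_intro[where K="norm v"])
     (auto simp: norm_smult vector_sadd_rdistrib vec_eq_iff scaleR_conv_of_real[where 'a=complex])

lemma bounded_linear_smult_right: "bounded_linear (\<lambda>v. c *s (v :: complex ^ 'n))"
  by (rule bounded_linear_intro[where K="norm c"])
     (auto simp: norm_smult vector_add_ldistrib vec_eq_iff scaleR_conv_of_real[where 'a=complex])

lemma continuous_on_smult [continuous_intros]:
  fixes f :: "'a::topological_space \<Rightarrow> complex" and g :: "'a \<Rightarrow> complex ^ 'n"
  assumes "continuous_on S f" "continuous_on S g"
  shows "continuous_on S (\<lambda>x. f x *s g x)"
  unfolding vector_scalar_mult_def
  by (intro continuous_intros assms)

text \<open>Only the pointwise derivative is required to exist and to be complex linear. That its
  directional derivatives are again of this kind is \<open>holo_cderiv\<close> below.\<close>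

definition holo :: "(complex ^ 'n \<Rightarrow> complex) \<Rightarrow> (complex ^ 'n) set \<Rightarrow> bool" where
  "holo f S \<longleftrightarrow> (\<forall>z\<in>S. \<exists>L. (f has_derivative L) (at z) \<and> (\<forall>c v. L (c *s v) = c * L v))"

text \<open>The derivative of \<open>f\<close> at \<open>z\<close> in the direction \<open>v\<close>, computed on the complex line through \<open>z\<close>
  so that Cauchy's formula in one variable applies to it.\<close>

definition cderiv :: "(complex ^ 'n \<Rightarrow> complex) \<Rightarrow> complex ^ 'n \<Rightarrow> complex ^ 'n \<Rightarrow> complex" where
  "cderiv f z v = deriv (\<lambda>t. f (z + t *s v)) 0"

lemma DERIV_along_line:
  fixes f :: "complex ^ 'n \<Rightarrow> complex"
  assumes "(f has_derivative L) (at (a + t *s v))" "\<And>c v. L (c *s v) = c * L v"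
  shows "((\<lambda>t. f (a + t *s v)) has_field_derivative L v) (at t)"
proof -
  have "((\<lambda>t. a + t *s v) has_derivative (\<lambda>t. 0 + t *s v)) (at t)"
    by (intro has_derivative_add has_derivative_const
        bounded_linear_imp_has_derivative bounded_linear_smult_left)
  from has_derivative_compose[OF this assms(1)] show ?thesis
    by (simp add: has_field_derivative_def assms(2) mult_commute_abs)
qed

lemma cderiv_eqI:
  assumes "(f has_derivative L) (at z)" "\<And>c v. L (c *s v) = c * L v"
  shows "cderiv f z = L"
proof
  fix v
  have "((\<lambda>t. f (z + t *s v)) has_field_derivative L v) (at 0)"
    by (rule DERIV_along_line) (use assms in auto)
  then show "cderiv f z v = L v"
    unfolding cderiv_def by (rule DERIV_imp_deriv)
qed

lemma holo_has_derivative: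
  assumes "holo f S" "z \<in> S"
  shows "(f has_derivative cderiv f z) (at z)"
  using assms cderiv_eqI unfolding holo_def by metis

lemma cderiv_smult:
  assumes "holo f S" "z \<in> S"
  shows "cderiv f z (c *s v) = c * cderiv f z v"
  using assms cderiv_eqI unfolding holo_def by metis

lemma holoI:
  assumes "\<And>z. z \<in> S \<Longrightarrow> (f has_derivative D z) (at z)" "\<And>z c v. z \<in> S \<Longrightarrow> D z (c *s v) = c * D z v"
  shows "holo f S"
  using assms unfolding holo_def by blast

lemma cderiv_linear: "holo f S \<Longrightarrow> z \<in> S \<Longrightarrow> linear (cderiv f z)"
  using holo_has_derivative has_derivative_linear by blast

lemma cderiv_expand:
  assumes "holo f S" "z \<in> S"
  shows "cderiv f z v = (\<Sum>j\<in>UNIV. v $ j * cderiv f z (axis j 1))"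
proof -
  have "cderiv f z v = cderiv f z (\<Sum>j\<in>UNIV. v $ j *s axis j 1)"
    by (simp add: basis_expansion)
  also have "\<dots> = (\<Sum>j\<in>UNIV. v $ j * cderiv f z (axis j 1))"
    by (simp add: linear_sum[OF cderiv_linear[OF assms]] cderiv_smult[OF assms])
  finally show ?thesis .
qed

lemma holo_continuous_on: "holo f S \<Longrightarrow> continuous_on S f"
  by (intro continuous_at_imp_continuous_on ballI has_derivative_continuous[OF holo_has_derivative])

lemma holo_DERIV_line:
  assumes "holo f S" "a + t *s v \<in> S"
  shows "((\<lambda>t. f (a + t *s v)) has_field_derivative cderiv f (a + t *s v) v) (at t)"
  by (rule DERIV_along_line) (use assms holo_has_derivative cderiv_smult in auto)

lemma holo_holomorphic_on_line:
  assumes "holo f S" "\<And>t. t \<in> A \<Longrightarrow> a + t *s v \<in> S"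
  shows "(\<lambda>t. f (a + t *s v)) holomorphic_on A"
  unfolding holomorphic_on_def field_differentiable_def
  using holo_DERIV_line[OF assms(1) assms(2)] has_field_derivative_at_within by meson

lemma has_derivative_cong_open:
  assumes "(f has_derivative L) (at z)" "open S" "z \<in> S" "\<And>w. w \<in> S \<Longrightarrow> f w = g w"
  shows "(g has_derivative L) (at z)"
  by (rule has_derivative_transform_within_open[OF assms])

lemma cderiv_cong:
  assumes "open S" "z \<in> S" "holo f S" "\<And>w. w \<in> S \<Longrightarrow> f w = g w"
  shows "cderiv g z = cderiv f z"
  by (intro cderiv_eqI has_derivative_cong_open[OF holo_has_derivative] cderiv_smult) (fact assms)+

lemma holo_cong:
  assumes "open S" "holo f S" "\<And>w. w \<in> S \<Longrightarrow> f w = g w"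
  shows "holo g S"
proof (rule holoI)
  fix z assume z: "z \<in> S"
  show "(g has_derivative cderiv f z) (at z)"
    using holo_has_derivative[OF assms(2) z] assms(1) z assms(3) by (rule has_derivative_cong_open)
  show "cderiv f z (c *s v) = c * cderiv f z v" for c v
    using assms(2) z by (rule cderiv_smult)
qed

text \<open>The circle is parametrized over the unit interval, so that integrals over it are averages.\<close>

definition unit_circle :: "real \<Rightarrow> complex" where
  "unit_circle t = cis (2 * pi * t)"

lemma norm_unit_circle [simp]: "norm (unit_circle t) = 1"
  by (simp add: unit_circle_def)

lemma unit_circle_nonzero [simp]: "unit_circle t \<noteq> 0"
  by (simp add: unit_circle_def)

lemma continuous_on_unit_circle [continuous_intros]:
  "continuous_on S g \<Longrightarrow> continuous_on S (\<lambda>x. unit_circle (g x))"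
  unfolding unit_circle_def by (intro continuous_intros)

text \<open>Cauchy's formula for the Taylor coefficients at the centre of the unit disc. For \<open>k = 0\<close> it
  is the mean value property, for \<open>k = 1\<close> it yields Cauchy's estimate for the derivative with no
  loss in the constant.\<close>

lemma has_integral_unit_circle:
  assumes "continuous_on (cball 0 1) \<phi>" "\<phi> holomorphic_on ball 0 1"
  shows "((\<lambda>t. \<phi> (unit_circle t) / unit_circle t ^ k) has_integral (deriv ^^ k) \<phi> 0 / fact k)
    {0..1}"
proof -
  have "((\<lambda>u. \<phi> u / (u - 0) ^ Suc k) has_contour_integral
          (2 * pi) * \<i> / fact k * (deriv ^^ k) \<phi> 0) (circlepath 0 1)"
    by (rule Cauchy_has_contour_integral_higher_derivative_circlepath) (use assms in auto)
  then have "((\<lambda>t. \<phi> (circlepath 0 1 t) / circlepath 0 1 t ^ Suc k *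
      vector_derivative (circlepath 0 1) (at t within {0..1})) has_integral
      (2 * pi) * \<i> / fact k * (deriv ^^ k) \<phi> 0) {0..1}"
    by (simp only: has_contour_integral_def diff_zero)
  then have "((\<lambda>t. (2 * pi * \<i>) * (\<phi> (unit_circle t) / unit_circle t ^ k)) has_integral
      (2 * pi * \<i>) * ((deriv ^^ k) \<phi> 0 / fact k)) {0..1}"
  proof (rule has_integral_eq_rhs[OF has_integral_eq, rotated])
    fix t :: real assume "t \<in> {0..1}"
    then have "vector_derivative (circlepath 0 1) (at t within {0..1}) = 2 * pi * \<i> * unit_circle t"
      by (simp add: vector_derivative_circlepath01 unit_circle_def cis_conv_exp mult_ac)
    moreover have "circlepath 0 1 t = unit_circle t"
      by (simp add: circlepath unit_circle_def cis_conv_exp mult_ac)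
    ultimately show "\<phi> (circlepath 0 1 t) / circlepath 0 1 t ^ Suc k *
        vector_derivative (circlepath 0 1) (at t within {0..1}) =
      2 * pi * \<i> * (\<phi> (unit_circle t) / unit_circle t ^ k)"
      by simp
  qed simp
  from has_integral_mult_right[OF this, of "1 / (2 * pi * \<i>)"] show ?thesis
    by simp
qed

lemma cderiv_eq_integral:
  assumes "holo f S" "c > 0" "\<And>t. norm t \<le> c \<Longrightarrow> z + t *s v \<in> S"
  shows "((\<lambda>t. f (z + (c * unit_circle t) *s v) / (c * unit_circle t)) has_integral cderiv f z v)
    {0..1}"
proof -
  define \<phi> where "\<phi> = (\<lambda>t. f (z + t *s (of_real c *s v)))"
  have S: "z + t *s (of_real c *s v) \<in> S" if "norm t \<le> 1" for t
    using assms(3)[of "t * c"] that assms(2) by (simp add: norm_mult vector_smult_assoc)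
  have "\<phi> holomorphic_on cball 0 1" unfolding \<phi>_def
    by (rule holo_holomorphic_on_line[OF assms(1)]) (use S in auto)
  then have *: "((\<lambda>t. \<phi> (unit_circle t) / unit_circle t ^ 1) has_integral (deriv ^^ 1) \<phi> 0 / fact 1)
    {0..1}"
    by (intro has_integral_unit_circle holomorphic_on_imp_continuous_on)
       (auto elim: holomorphic_on_subset)
  have z: "z \<in> S" using assms(3)[of 0] assms(2) by simp
  have "(deriv ^^ 1) \<phi> 0 = c * cderiv f z v"
    using cderiv_smult[OF assms(1) z, of "of_real c"] by (simp add: \<phi>_def cderiv_def)
  with has_integral_mult_right[OF *, of "1 / c"] assms(2) show ?thesis
    by (simp add: \<phi>_def vector_smult_assoc mult.commute)
qed

text \<open>Near a point of an open set the discs in direction \<open>v\<close> can be given a common radius, so that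
  Cauchy's formula represents the derivative by one and the same integral throughout a
  neighbourhood.\<close>

lemma small_discs:
  fixes S :: "(complex ^ 'n) set"
  assumes "open S" "z0 \<in> S"
  obtains r c :: real where "r > 0" "c > 0"
    "\<And>z t. z \<in> ball z0 r \<Longrightarrow> norm t \<le> c \<Longrightarrow> z + t *s v \<in> S"
proof -
  obtain r where r: "r > 0" "cball z0 (2 * r) \<subseteq> S"
  proof -
    obtain e where "e > 0" "cball z0 e \<subseteq> S"
      using assms open_contains_cball by blast
    then show ?thesis using that[of "e/2"] by simp
  qed
  define c where "c = r / (1 + norm v)"
  have c: "c > 0" "c * norm v \<le> r"
    using r by (auto simp: c_def field_simps add_pos_nonneg)
  have "z + t *s v \<in> S" if "z \<in> ball z0 r" "norm t \<le> c" for z t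
  proof -
    have "norm (t *s v) \<le> r"
      using c that by (simp add: norm_smult) (meson mult_right_mono norm_ge_zero order_trans)
    then have "dist z0 (z + t *s v) \<le> 2 * r"
      using that norm_triangle_ineq[of "z - z0" "t *s v"]
      by (simp add: dist_norm norm_minus_commute algebra_simps)
    then show ?thesis using r by auto
  qed
  with r(1) c(1) show thesis using that by blast
qed

text \<open>Cauchy's formula writes the derivative in direction \<open>v\<close> locally as an integral over a fixed
  circle, whose integrand depends continuously on the point.\<close>

lemma continuous_on_cderiv_direction:
  fixes f :: "complex ^ 'n \<Rightarrow> complex"
  assumes f: "holo f S" and "open S"
  shows "continuous_on S (\<lambda>z. cderiv f z v)"
proof -
  have "\<exists>r>0. continuous_on (ball z0 r) (\<lambda>z. cderiv f z v)" if "z0 \<in> S" for z0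
  proof -
    obtain r c :: real where r: "r > 0" and c: "c > 0"
      and S: "\<And>z t. z \<in> ball z0 r \<Longrightarrow> norm t \<le> c \<Longrightarrow> z + t *s v \<in> S"
      using small_discs[OF \<open>open S\<close> \<open>z0 \<in> S\<close>, of v] by blast
    have eq: "integral (cbox 0 1) (\<lambda>t. f (z + (c * unit_circle t) *s v) / (c * unit_circle t))
      = cderiv f z v"
      if "z \<in> ball z0 r" for z
      using cderiv_eq_integral[OF f c S[OF that]] by (auto simp: cbox_interval intro:
        integral_unique)
    have "continuous_on (ball z0 r) (\<lambda>z. integral (cbox 0 1) (\<lambda>t. f (z + (c * unit_circle t) *s v) /
      (c * unit_circle t)))"
    proof (rule integral_continuous_on_param)
      show "continuous_on (ball z0 r \<times> cbox 0 1)
        (\<lambda>(z, t). f (z + (c * unit_circle t) *s v) / (c * unit_circle t))"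
        unfolding split_beta
        using c S
        by (intro continuous_intros continuous_on_compose2[OF holo_continuous_on[OF f]])
           (auto simp: norm_mult)
    qed
    then have "continuous_on (ball z0 r) (\<lambda>z. cderiv f z v)"
      by (rule continuous_on_eq) (rule eq)
    then show ?thesis using r by blast
  qed
  then have "continuous (at z) (\<lambda>z. cderiv f z v)" if "z \<in> S" for z
    using that centre_in_ball continuous_on_eq_continuous_at open_ball by metis
  then show ?thesis by (simp add: continuous_at_imp_continuous_on)
qed

text \<open>Osgood's lemma in quantitative form: the Cauchy integral for the derivative in direction \<open>v\<close>
  may be differentiated under the integral sign. The formula for the derivative is kept in the
  statement, since it yields both complex linearity and the symmetry of second derivatives.\<close>

lemma cderiv_has_derivative:
  fixes f :: "complex ^ 'n \<Rightarrow> complex"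
  assumes f: "holo f S" and "open S" "z0 \<in> S"
  shows "\<exists>L c. ((\<lambda>z. cderiv f z v) has_derivative L) (at z0) \<and> c > (0::real) \<and> (\<forall>t. norm t \<le> c \<longrightarrow>
    z0 + t *s v \<in> S) \<and>
    (\<forall>w. L w = integral {0..1} (\<lambda>t. cderiv f (z0 + (c * unit_circle t) *s v) w /
      (c * unit_circle t)))"
proof -
  obtain r c :: real where r: "r > 0" and c: "c > 0"
    and S: "\<And>z t. z \<in> ball z0 r \<Longrightarrow> norm t \<le> c \<Longrightarrow> z + t *s v \<in> S"
    using small_discs[OF \<open>open S\<close> \<open>z0 \<in> S\<close>, of v] by blast
  have eq: "integral (cbox 0 1) (\<lambda>t. f (z + (c * unit_circle t) *s v) / (c * unit_circle t))
    = cderiv f z v"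
    if "z \<in> ball z0 r" for z
    using cderiv_eq_integral[OF f c S[OF that]] by (auto simp: cbox_interval intro: integral_unique)
  define fx where "fx = (\<lambda>z t. Blinfun (\<lambda>w. cderiv f (z + (c * unit_circle t) *s v) w /
    (c * unit_circle t)))"
  have bl: "bounded_linear (\<lambda>w. cderiv f (z + (c * unit_circle t) *s v) w / (c * unit_circle t))"
    if "z \<in> ball z0 r" for z t
    using S[OF that, of "c * unit_circle t"] c
    by (intro bounded_linear_const_mult bounded_linear_divide[THEN bounded_linear_compose]
      has_derivative_bounded_linear[OF holo_has_derivative[OF f]])
       (auto simp: norm_mult)
  have fx: "blinfun_apply (fx z t) w = cderiv f (z + (c * unit_circle t) *s v) w /
    (c * unit_circle t)"
    if "z \<in> ball z0 r" for z t w
    unfolding fx_def using bounded_linear_Blinfun_apply[OF bl[OF that]] by metis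
  have cont: "continuous_on (ball z0 r \<times> cbox 0 1) (\<lambda>(z, t). fx z t)"
  proof (rule continuous_on_blinfun_componentwise)
    fix w :: "complex ^ 'n"
    have "continuous_on (ball z0 r \<times> cbox 0 1) 
      (\<lambda>x. cderiv f (fst x + (c * unit_circle (snd x)) *s v) w / (c * unit_circle (snd x)))"
      using c S
      by (intro continuous_intros continuous_on_compose2[OF continuous_on_cderiv_direction[OF
        f \<open>open S\<close>]])
         (auto simp: norm_mult)
    then show "continuous_on (ball z0 r \<times> cbox 0 1) (\<lambda>x. blinfun_apply (case x of (z, t) \<Rightarrow> fx z t)
      w)"
      by (rule continuous_on_eq) (auto simp: fx)
  qed
  have D: "((\<lambda>z. integral (cbox 0 1) (\<lambda>t. f (z + (c * unit_circle t) *s v) / (c * unit_circle t)))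
      has_derivative blinfun_apply (integral (cbox 0 1) (fx z0))) (at z0 within ball z0 r)"
  proof (rule leibniz_rule[OF _ _ cont])
    fix z and t :: real assume z: "z \<in> ball z0 r" 
    have zS: "z + (c * unit_circle t) *s v \<in> S"
      using S[OF z] c by (simp add: norm_mult)
    have 1: "((\<lambda>z. z + (c * unit_circle t) *s v) has_derivative (\<lambda>w. w + 0)) (at z within ball z0
      r)"
      by (intro derivative_intros)
    have "((\<lambda>z. f (z + (c * unit_circle t) *s v)) has_derivative cderiv f (z + (c * unit_circle t)
      *s v)) (at z within ball z0 r)"
      using has_derivative_compose[OF 1 holo_has_derivative[OF f zS]] by simp
    from bounded_linear.has_derivative[OF bounded_linear_divide this, of "c * unit_circle t"]
    show "((\<lambda>z. f (z + (c * unit_circle t) *s v) / (c * unit_circle t))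
      has_derivative blinfun_apply (fx z t)) (at z within ball z0 r)"
      unfolding fx[OF z, abs_def] .
  next
    fix z assume "z \<in> ball z0 r"
    then show "(\<lambda>t. f (z + (c * unit_circle t) *s v) / (c * unit_circle t)) integrable_on cbox 0 1"
      using cderiv_eq_integral[OF f c S] by (auto simp: cbox_interval)
  qed (use r in auto)
  then have "((\<lambda>z. integral (cbox 0 1) (\<lambda>t. f (z + (c * unit_circle t) *s v) / (c * unit_circle t)))
      has_derivative blinfun_apply (integral (cbox 0 1) (fx z0))) (at z0)"
    using at_within_open[of z0 "ball z0 r"] r by simp
  then have "((\<lambda>z. cderiv f z v) has_derivative blinfun_apply (integral (cbox 0 1) (fx z0)))
    (at z0)"
    by (rule has_derivative_cong_open[where S="ball z0 r"]) (use r eq in auto)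
  moreover have "blinfun_apply (integral (cbox 0 1) (fx z0)) w = integral {0..1} (\<lambda>t. cderiv f (z0
    + (c * unit_circle t) *s v) w / (c * unit_circle t))" for w
  proof -
    have "continuous_on (cbox 0 1) (fx z0)"
    proof -
      have "continuous_on (cbox 0 1) (\<lambda>t. (\<lambda>(z, t). fx z t) (z0, t))"
        by (rule continuous_on_compose2[OF cont]) (use r in \<open>auto intro!: continuous_intros\<close>)
      then show ?thesis by simp
    qed
    then show ?thesis
      using r by (subst blinfun_apply_integral[OF integrable_continuous]) (simp_all add: fx)
  qed
  moreover have "\<forall>t. norm t \<le> c \<longrightarrow> z0 + t *s v \<in> S"
    using S[of z0] r by simp
  ultimately show ?thesis using c by blast
qed

lemma holo_cderiv:
  assumes f: "holo f S" and "open S"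
  shows "holo (\<lambda>z. cderiv f z v) S"
  unfolding holo_def
proof
  fix z0 assume "z0 \<in> S"
  from cderiv_has_derivative[OF assms this, of v]
  obtain L and c :: real where L: "((\<lambda>z. cderiv f z v) has_derivative L) (at z0)" "c > 0" 
    "\<And>t. norm t \<le> c \<Longrightarrow> z0 + t *s v \<in> S"
    "\<And>w. L w = integral {0..1} (\<lambda>t. cderiv f (z0 + (c * unit_circle t) *s v) w /
      (c * unit_circle t))" by blast
  have "L (a *s w) = a * L w" for a w
    using cderiv_smult[OF f L(3)] \<open>c > 0\<close> unfolding L(4)
    by (simp add: norm_mult flip: integral_mult_right)
  with L show "\<exists>L. ((\<lambda>z. cderiv f z v) has_derivative L) (at z0) \<and> (\<forall>c v. L (c *s v) = c * L v)"
    by blast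
qed

text \<open>The derivative in direction \<open>w\<close> of the Cauchy integral for the direction \<open>v\<close> is the Cauchy
  integral, in direction \<open>v\<close>, of the derivative in direction \<open>w\<close>.\<close>

lemma cderiv_commute:
  assumes f: "holo f S" and "open S" "z \<in> S"
  shows "cderiv (\<lambda>z. cderiv f z v) z w = cderiv (\<lambda>z. cderiv f z w) z v"
proof -
  from cderiv_has_derivative[OF assms, of v]
  obtain L and c :: real where L: "((\<lambda>z. cderiv f z v) has_derivative L) (at z)" "c > 0" 
    "\<And>t. norm t \<le> c \<Longrightarrow> z + t *s v \<in> S"
    "\<And>w. L w = integral {0..1} (\<lambda>t. cderiv f (z + (c * unit_circle t) *s v) w /
      (c * unit_circle t))" by blast
  have "L = cderiv (\<lambda>z. cderiv f z v) z"
    using L(1) holo_has_derivative[OF holo_cderiv[OF f \<open>open S\<close>] \<open>z \<in> S\<close>] has_derivative_unique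
      by blast
  moreover have "L w = cderiv (\<lambda>z. cderiv f z w) z v"
    using cderiv_eq_integral[OF holo_cderiv[OF f \<open>open S\<close>] L(2,3)] L(4)
      by (simp add: integral_unique)
  ultimately show ?thesis by simp
qed

lemma holo_add: "holo f S \<Longrightarrow> holo g S \<Longrightarrow> holo (\<lambda>z. f z + g z) S"
  by (rule holoI[where D="\<lambda>z v. cderiv f z v + cderiv g z v"])
     (auto intro!: derivative_intros holo_has_derivative simp: cderiv_smult algebra_simps)

lemma holo_diff: "holo f S \<Longrightarrow> holo g S \<Longrightarrow> holo (\<lambda>z. f z - g z) S"
  by (rule holoI[where D="\<lambda>z v. cderiv f z v - cderiv g z v"])
     (auto intro!: derivative_intros holo_has_derivative simp: cderiv_smult algebra_simps)

lemma holo_mult: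
  assumes f: "holo f S" and g: "holo g S"
  shows "holo (\<lambda>z. f z * g z) S"
proof (rule holoI)
  fix z assume z: "z \<in> S"
  show "((\<lambda>z. f z * g z) has_derivative (\<lambda>v. f z * cderiv g z v + cderiv f z v * g z)) (at z)"
    by (rule has_derivative_mult[OF holo_has_derivative[OF f z] holo_has_derivative[OF g z]])
  show "f z * cderiv g z (c *s v) + cderiv f z (c *s v) * g z = c * (f z * cderiv g z v
    + cderiv f z v * g z)" for c v
    by (simp add: cderiv_smult[OF f z] cderiv_smult[OF g z] algebra_simps)
qed

lemma holo_const: "holo (\<lambda>z. c) S"
  by (rule holoI[where D="\<lambda>z v. 0"]) auto

lemma holo_sum: "(\<And>i. i \<in> I \<Longrightarrow> holo (f i) S) \<Longrightarrow> holo (\<lambda>z. \<Sum>i\<in>I. f i z) S"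
  by (induction I rule: infinite_finite_induct) (auto intro: holo_add holo_const)

lemma has_derivative_component: "((\<lambda>z. (z :: complex ^ 'n) $ i) has_derivative (\<lambda>v. v $ i)) F"
  by (rule bounded_linear_imp_has_derivative[OF bounded_linear_vec_nth])

lemma holo_component: "holo (\<lambda>z. z $ i) S"
  by (rule holoI[where D="\<lambda>z v. v $ i"]) (auto intro: has_derivative_component)

lemma cderiv_diff:
  assumes "holo f S" "holo g S" "z \<in> S"
  shows "cderiv (\<lambda>z. f z - g z) z v = cderiv f z v - cderiv g z v"
  by (subst cderiv_eqI[where L="\<lambda>v. cderiv f z v - cderiv g z v"])
     (use assms in \<open>auto intro!: derivative_intros holo_has_derivative simp:
       cderiv_smult algebra_simps\<close>)

lemma cderiv_component_mult:
  assumes g: "holo g S" and z: "z \<in> S"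
  shows "cderiv (\<lambda>z. z $ i * g z) z v = v $ i * g z + z $ i * cderiv g z v"
proof -
  have "cderiv (\<lambda>z. z $ i * g z) z = (\<lambda>v. z $ i * cderiv g z v + v $ i * g z)"
    by (rule cderiv_eqI[OF has_derivative_mult[OF has_derivative_component holo_has_derivative[OF
      g z]]])
       (simp add: cderiv_smult[OF g z] algebra_simps)
  then show ?thesis by simp
qed

lemma cderiv_sum:
  assumes f: "\<And>i. i \<in> I \<Longrightarrow> holo (f i) S" and z: "z \<in> S"
  shows "cderiv (\<lambda>z. \<Sum>i\<in>I. f i z) z v = (\<Sum>i\<in>I. cderiv (f i) z v)"
proof -
  have "cderiv (\<lambda>z. \<Sum>i\<in>I. f i z) z = (\<lambda>v. \<Sum>i\<in>I. cderiv (f i) z v)"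
    by (rule cderiv_eqI[OF has_derivative_sum[OF holo_has_derivative[OF f z]]])
       (simp_all add: cderiv_smult[OF f z] sum_distrib_left)
  then show ?thesis by simp
qed

text \<open>The Euler vector field multiplies a homogeneous polynomial by its degree; its powers are the
  radial derivatives.\<close>

definition euler :: "(complex ^ 'n \<Rightarrow> complex) \<Rightarrow> complex ^ 'n \<Rightarrow> complex" where
  "euler f z = cderiv f z z"

lemma holo_euler:
  assumes "holo f S" "open S"
  shows "holo (euler f) S"
proof (rule holo_cong)
  show "holo (\<lambda>z. \<Sum>j\<in>UNIV. z $ j * cderiv f z (axis j 1)) S"
    by (intro holo_sum holo_mult holo_component holo_cderiv assms)
qed (use assms in \<open>auto simp: euler_def cderiv_expand[of f S, symmetric]\<close>)

text \<open>Writing the Euler field in coordinates, the product rule and the symmetry of second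
  derivatives give the commutation rule between the Euler field and a constant vector field.\<close>

lemma cderiv_euler:
  assumes f: "holo f S" and S: "open S" "z \<in> S"
  shows "cderiv (euler f) z v = cderiv f z v + euler (\<lambda>z. cderiv f z v) z"
proof -
  have "cderiv (euler f) z v = cderiv (\<lambda>z. \<Sum>j\<in>UNIV. z $ j * cderiv f z (axis j 1)) z v"
    by (subst cderiv_cong[OF S])
       (auto intro!: holo_sum holo_mult holo_component holo_cderiv f S simp:
         euler_def cderiv_expand[OF f, symmetric])
  also have "\<dots> = (\<Sum>j\<in>UNIV. v $ j * cderiv f z (axis j 1) + z $ j * cderiv (\<lambda>z. cderiv f z (axis
    j 1)) z v)"
    using S by (subst cderiv_sum[where S=S])
       (auto intro!: holo_sum holo_mult holo_component holo_cderiv f simp: cderiv_component_mult[OF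
         holo_cderiv[OF f]])
  also have "\<dots> = cderiv f z v + (\<Sum>j\<in>UNIV. z $ j * cderiv (\<lambda>z. cderiv f z v) z (axis j 1))"
    by (simp add: sum.distrib cderiv_commute[OF f S, of _ v] flip: cderiv_expand[OF f S(2)])
  also have "\<dots> = cderiv f z v + euler (\<lambda>z. cderiv f z v) z"
    by (simp add: euler_def flip: cderiv_expand[OF holo_cderiv[OF f S(1)] S(2)])
  finally show ?thesis .
qed

lemma continuous_on_cderiv:
  fixes f :: "complex ^ 'n \<Rightarrow> complex"
  assumes f: "holo f S" and "open S" and a: "continuous_on A a" and b: "continuous_on A b"
    and "a ` A \<subseteq> S"
  shows "continuous_on A (\<lambda>x. cderiv f (a x) (b x))"
proof -
  have "continuous_on A (\<lambda>x. \<Sum>j\<in>UNIV. b x $ j * cderiv f (a x) (axis j 1))"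
    by (intro continuous_intros b continuous_on_compose2[OF continuous_on_cderiv_direction[OF
      f \<open>open S\<close>] a]) (use assms in auto)
  then show ?thesis
    by (rule continuous_on_eq) (use assms in \<open>auto simp: cderiv_expand[OF f, symmetric]\<close>)
qed

lemma euler_at_0 [simp]: "euler f 0 = 0"
  by (simp add: euler_def cderiv_def)

lemma holo_euler_power: "holo f S \<Longrightarrow> open S \<Longrightarrow> holo ((euler ^^ k) f) S"
  by (induction k) (auto intro: holo_euler)

lemma euler_power_Suc: "(euler ^^ Suc k) f z = cderiv ((euler ^^ k) f) z z"
  by (simp only: funpow.simps o_apply) (rule euler_def)

lemma euler_power_cong:
  assumes "holo f S" "open S" "\<And>z. z \<in> S \<Longrightarrow> g z = f z" "z \<in> S"
  shows "(euler ^^ k) g z = (euler ^^ k) f z"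
  using \<open>z \<in> S\<close>
proof (induction k arbitrary: z)
  case (Suc k)
  have "cderiv ((euler ^^ k) g) z = cderiv ((euler ^^ k) f) z"
    by (rule cderiv_cong[OF \<open>open S\<close> Suc.prems holo_euler_power[OF assms(1,2)]]) (simp add: Suc.IH)
  then show ?case by (simp only: euler_power_Suc)
qed (use assms in simp)

lemma euler_power_diff:
  assumes f: "holo f S" and g: "holo g S" and S: "open S" "z \<in> S"
  shows "(euler ^^ k) (\<lambda>z. f z - g z) z = (euler ^^ k) f z - (euler ^^ k) g z"
  using \<open>z \<in> S\<close>
proof (induction k arbitrary: z)
  case (Suc k)
  have "cderiv ((euler ^^ k) (\<lambda>z. f z - g z)) z = cderiv (\<lambda>z. (euler ^^ k) f z - (euler ^^ k) g z)
    z"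
    by (rule cderiv_cong[OF S(1) Suc.prems]) (auto intro!: holo_diff holo_euler_power f g S(1) simp:
      Suc.IH)
  then show ?case
    using cderiv_diff[OF holo_euler_power[OF f S(1)] holo_euler_power[OF g S(1)] Suc.prems,
      of k k z]
    by (simp only: euler_power_Suc)
qed simp

section \<open>Rotation invariance of the surface measure\<close>

lemma emeasure_unit_ball:
  "emeasure lborel (ball (0 :: 'a::euclidean_space) 1) \<noteq> 0"
  "emeasure lborel (ball (0 :: 'a::euclidean_space) 1) \<noteq> \<infinity>"
proof -
  have "unit_ball_vol (real DIM('a)) > 0"
    by (rule unit_ball_vol_pos) simp
  then show "emeasure lborel (ball (0 :: 'a) 1) \<noteq> 0"
    by (simp add: emeasure_ball del: unit_ball_vol_pos)
  show "emeasure lborel (ball (0 :: 'a) 1) \<noteq> \<infinity>"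
    using emeasure_lborel_ball_finite[of "0::'a" 1] by simp
qed

lemma nn_integral_lborel_reflect:
  fixes f :: "'a::euclidean_space \<Rightarrow> ennreal"
  assumes "f \<in> borel_measurable borel"
  shows "(\<integral>\<^sup>+x. f (a - x) \<partial>lborel) = (\<integral>\<^sup>+x. f x \<partial>lborel)"
proof -
  have "lborel = distr lborel borel (\<lambda>x::'a. a + (-1) *\<^sub>R x)"
    using lborel_affine[of "-1" a] by (simp add: density_1)
  then have "(\<integral>\<^sup>+x. f x \<partial>lborel) = (\<integral>\<^sup>+x. f x \<partial>distr lborel borel (\<lambda>x. a + (-1) *\<^sub>R x))"
    by metis
  also have "\<dots> = (\<integral>\<^sup>+x. f (a - x) \<partial>lborel)"
    by (subst nn_integral_distr) (use assms in auto)
  finally show ?thesis by simp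
qed

lemma nn_integral_lborel_shift:
  fixes f :: "'a::euclidean_space \<Rightarrow> ennreal"
  assumes "f \<in> borel_measurable borel"
  shows "(\<integral>\<^sup>+x. f (x - a) \<partial>lborel) = (\<integral>\<^sup>+x. f x \<partial>lborel)"
proof -
  have "(\<integral>\<^sup>+x. f (x - a) \<partial>lborel) = (\<integral>\<^sup>+x. f (- (a - x)) \<partial>lborel)" by simp
  also have "\<dots> = (\<integral>\<^sup>+x. f (0 - x) \<partial>lborel)"
    using assms by (subst nn_integral_lborel_reflect[of "\<lambda>x. f (- x)"]) auto
  also have "\<dots> = (\<integral>\<^sup>+x. f x \<partial>lborel)"
    by (rule nn_integral_lborel_reflect) fact
  finally show ?thesis .
qed

text \<open>Uniqueness of Haar measure, specialized: the image measure \<open>\<nu>\<close> of \<open>lborel\<close> under \<open>T\<close> is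
  again invariant under translations and reflections. Fubini then gives
  \<open>\<nu> A * lborel B = \<nu> B * lborel A\<close> for all Borel sets, and for the unit ball \<open>B\<close> the two measures
  agree because \<open>T\<close> preserves the ball.\<close>

lemma lborel_linear_isometry:
  fixes T :: "'a::euclidean_space \<Rightarrow> 'a"
  assumes T: "linear T" and iso: "\<And>x. norm (T x) = norm x"
  shows "distr lborel borel T = lborel"
proof (rule measure_eqI)
  have [measurable]: "T \<in> borel_measurable borel"
    using T by (intro borel_measurable_continuous_onI linear_continuous_on) (simp add:
      linear_conv_bounded_linear)
  have "inj T"
    using T iso by (metis linear_injective_0 norm_eq_zero)
  then have "surj T" using T linear_injective_imp_surjective by blast
  fix A :: "'a set" assume "A \<in> sets (distr lborel borel T)"
  then have [measurable]: "A \<in> sets borel" by simp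
  define B :: "'a set" where "B = ball 0 1"
  have [measurable]: "B \<in> sets borel" by (simp add: B_def)
  have em: "emeasure (distr lborel borel T) C = (\<integral>\<^sup>+x. indicator C (T x) \<partial>lborel)" 
    if [measurable]: "C \<in> sets borel" for C
  proof -
    have "emeasure (distr lborel borel T) C = (\<integral>\<^sup>+x. indicator C x \<partial>distr lborel borel T)"
      by simp
    also have "\<dots> = (\<integral>\<^sup>+x. indicator C (T x) \<partial>lborel)"
      by (rule nn_integral_distr) measurable
    finally show ?thesis .
  qed
  have key: "(\<integral>\<^sup>+x. indicator C (T x) \<partial>lborel) * emeasure lborel D
      = (\<integral>\<^sup>+x. \<integral>\<^sup>+y. indicator C (T x) * indicator D (y - T x) \<partial>lborel \<partial>lborel)"
    if [measurable]: "C \<in> sets borel" "D \<in> sets borel" for C D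
  proof -
    have "(\<integral>\<^sup>+y. indicator D (y - T x) \<partial>lborel) = emeasure lborel D" for x
      by (subst nn_integral_lborel_shift[of "indicator D"]) auto
    then show ?thesis by (simp add: nn_integral_cmult nn_integral_multc)
  qed
  have "emeasure (distr lborel borel T) A * emeasure lborel B
      = (\<integral>\<^sup>+x. \<integral>\<^sup>+y. indicator A (T x) * indicator B (y - T x) \<partial>lborel \<partial>lborel)"
    by (simp add: em key)
  also have "\<dots> = (\<integral>\<^sup>+y. \<integral>\<^sup>+x. indicator A (T x) * indicator B (y - T x) \<partial>lborel \<partial>lborel)"
    by (rule lborel_pair.Fubini'[symmetric]) measurable
  also have "\<dots> = (\<integral>\<^sup>+y. \<integral>\<^sup>+x. indicator B (T x) * indicator A (y - T x) \<partial>lborel \<partial>lborel)"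
  proof (rule nn_integral_cong)
    fix y
    obtain a where a: "y = T a" using \<open>surj T\<close> by (metis surjD)
    \<comment> \<open>Reflecting \<open>x\<close> at \<open>a / 2\<close> exchanges \<open>T x\<close> and \<open>y - T x\<close>, hence the roles of \<open>A\<close> and \<open>B\<close>.\<close>
    have "(\<integral>\<^sup>+x. indicator A (T x) * indicator B (y - T x) \<partial>lborel)
       = (\<integral>\<^sup>+x. indicator A (T (a - x)) * indicator B (y - T (a - x)) \<partial>lborel :: ennreal)"
      by (subst nn_integral_lborel_reflect) auto
    then show "(\<integral>\<^sup>+x. indicator A (T x) * indicator B (y - T x) \<partial>lborel)
       = (\<integral>\<^sup>+x. indicator B (T x) * indicator A (y - T x) \<partial>lborel :: ennreal)"
      by (simp add: a linear_diff[OF T] mult.commute)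
  qed
  also have "\<dots> = (\<integral>\<^sup>+x. \<integral>\<^sup>+y. indicator B (T x) * indicator A (y - T x) \<partial>lborel \<partial>lborel)"
    by (rule lborel_pair.Fubini') measurable
  also have "\<dots> = emeasure (distr lborel borel T) B * emeasure lborel A"
    by (simp add: em key)
  also have "emeasure (distr lborel borel T) B = emeasure lborel B"
  proof -
    have "indicator B (T x) = (indicator B x :: ennreal)" for x
      by (simp add: B_def iso indicator_def)
    then show ?thesis
      by (simp add: em)
  qed
  finally have "emeasure lborel B * emeasure (distr lborel borel T) A = emeasure lborel B *
    emeasure lborel A"
    by (simp add: mult.commute)
  moreover have "emeasure lborel B \<noteq> 0" "emeasure lborel B \<noteq> \<infinity>"
    unfolding B_def by (rule emeasure_unit_ball)+
  ultimately show "emeasure (distr lborel borel T) A = emeasure lborel A"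
    by (simp add: ennreal_mult_cancel_left)
qed simp

lemma space_sphere_measure [simp]: "space (sphere_measure :: (complex ^ 'n) measure) = sphere 0 1"
  by (simp add: sphere_measure_def space_restrict_space)

lemma sets_sphere_measure: "sets (sphere_measure :: (complex ^ 'n) measure) = sets (restrict_space
  borel (sphere 0 1))"
  unfolding sphere_measure_def by (rule sets_restrict_space_cong) simp

lemma borel_measurable_sphere_measure:
  fixes F :: "complex ^ 'n \<Rightarrow> 'b::topological_space"
  assumes "continuous_on (sphere 0 1) F"
  shows "F \<in> borel_measurable sphere_measure"
  using borel_measurable_continuous_on_restrict[OF assms]
  by (subst measurable_cong_sets[OF sets_sphere_measure refl])

lemma borel_measurable_sgn_vec [measurable]: "(sgn :: complex ^ 'n \<Rightarrow> _) \<in> borel_measurable borel"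
  unfolding sgn_div_norm[abs_def] by measurable

lemma sphere_in_borel [measurable]: "sphere (a :: 'a::euclidean_space) r \<in> sets borel"
  by (intro borel_closed closed_sphere)

lemma ball_in_borel [measurable]: "ball (a :: 'a::metric_space) r \<in> sets borel"
  by (rule borel_open[OF open_ball])

text \<open>Polar coordinates, as they are built into the definition of the surface measure. The second
  factor removes the origin, whose image under \<open>sgn\<close> does not lie on the sphere.\<close>

lemma nn_integral_sphere_measure:
  fixes f :: "complex ^ 'n \<Rightarrow> ennreal"
  assumes [measurable]: "f \<in> borel_measurable borel"
  shows "(\<integral>\<^sup>+\<zeta>. f \<zeta> \<partial>sphere_measure) =
    (\<integral>\<^sup>+x. f (sgn x) * indicator (sphere 0 1) (sgn x) * indicator (ball 0 1) x \<partial>lborel) /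
      emeasure lborel (ball 0 1 :: (complex ^ 'n) set)"
proof -
  let ?S = "sphere 0 1 :: (complex ^ 'n) set" and ?U = "uniform_measure lborel (ball 0 1 :: (complex
    ^ 'n) set)"
  have "(\<integral>\<^sup>+\<zeta>. f \<zeta> \<partial>sphere_measure) = (\<integral>\<^sup>+x. f x * indicator ?S x \<partial>distr ?U borel sgn)"
    unfolding sphere_measure_def by (rule nn_integral_restrict_space) simp
  also have "\<dots> = (\<integral>\<^sup>+x. f (sgn x) * indicator ?S (sgn x) \<partial>?U)"
    by (rule nn_integral_distr) measurable
  also have "\<dots> = (\<integral>\<^sup>+x. f (sgn x) * indicator ?S (sgn x) * indicator (ball 0 1) x \<partial>lborel) /
      emeasure lborel (ball 0 1 :: (complex ^ 'n) set)"
    by (rule nn_integral_uniform_measure) measurable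
  finally show ?thesis .
qed

lemma prob_space_sphere_measure: "prob_space (sphere_measure :: (complex ^ 'n) measure)"
proof (rule prob_spaceI)
  let ?B = "ball 0 1 :: (complex ^ 'n) set"
  have B: "emeasure lborel ?B \<noteq> 0" "emeasure lborel ?B \<noteq> \<infinity>"
    by (rule emeasure_unit_ball)+
  have "emeasure sphere_measure (space (sphere_measure :: (complex ^ 'n) measure))
    = (\<integral>\<^sup>+\<zeta>. 1 \<partial>(sphere_measure :: (complex ^ 'n) measure))"
    by simp
  also have "\<dots> = (\<integral>\<^sup>+x. indicator (sphere 0 1) (sgn x) * indicator ?B x \<partial>lborel) /
    emeasure lborel ?B"
    using nn_integral_sphere_measure[of "\<lambda>_ :: complex ^ 'n. 1"] by simp
  also have "(\<integral>\<^sup>+x. indicator (sphere 0 1) (sgn x) * indicator ?B x \<partial>lborel) = (\<integral>\<^sup>+x. indicator ?B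
    x \<partial>lborel)"
    by (intro nn_integral_cong_AE AE_I[where N="{0}"]) (auto simp: norm_sgn indicator_def split:
      if_splits)
  also have "\<dots> / emeasure lborel ?B = 1"
    using B by (simp add: ennreal_divide_self top.not_eq_extremum)
  finally show "emeasure sphere_measure (space (sphere_measure :: (complex ^ 'n) measure)) = 1" .
qed

text \<open>An isometry commutes with \<open>sgn\<close>, so it permutes the cones that define the surface measure,
  and it preserves their volumes.\<close>

lemma distr_sphere_measure_isometry:
  fixes T :: "complex ^ 'n \<Rightarrow> complex ^ 'n"
  assumes T: "linear T" and iso: "\<And>x. norm (T x) = norm x"
  shows "T \<in> sphere_measure \<rightarrow>\<^sub>M sphere_measure" "distr sphere_measure sphere_measure T
    = sphere_measure"
proof -
  have [measurable]: "T \<in> borel_measurable borel"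
    using T by (intro borel_measurable_continuous_onI linear_continuous_on) (simp add:
      linear_conv_bounded_linear)
  have "T \<in> restrict_space borel (sphere 0 1) \<rightarrow>\<^sub>M restrict_space borel (sphere 0 1)"
    by (rule measurable_restrict_space3) (auto simp: iso)
  then show meas: "T \<in> sphere_measure \<rightarrow>\<^sub>M sphere_measure"
    using measurable_cong_sets[OF sets_sphere_measure sets_sphere_measure] by blast
  show "distr sphere_measure sphere_measure T = sphere_measure"
  proof (rule measure_eqI)
    fix A :: "(complex ^ 'n) set" assume A: "A \<in> sets (distr sphere_measure sphere_measure T)"
    then have A': "A \<in> sets sphere_measure" by simp
    then obtain A0 where "A0 \<in> sets borel" "A = sphere 0 1 \<inter> A0"
      by (auto simp: sets_sphere_measure sets_restrict_space)
    then have [measurable]: "A \<in> sets borel" by auto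
    have lin: "T (r *\<^sub>R x) = r *\<^sub>R T x" for r x using T by (rule linear_scale)
    have "emeasure (distr sphere_measure sphere_measure T) A = (\<integral>\<^sup>+\<zeta>. indicator A \<zeta> \<partial>distr
      sphere_measure sphere_measure T)"
      using A by simp
    also have "\<dots> = (\<integral>\<^sup>+\<zeta>. indicator A (T \<zeta>) \<partial>sphere_measure)"
      using A meas by (subst nn_integral_distr) auto
    also have "\<dots> = (\<integral>\<^sup>+x. indicator A (T (sgn x)) * indicator (sphere 0 1) (sgn x) * indicator (ball
      0 1) x \<partial>lborel) / emeasure lborel (ball 0 1 :: (complex ^ 'n) set)"
      by (rule nn_integral_sphere_measure) measurable
    also have "(\<integral>\<^sup>+x. indicator A (T (sgn x)) * indicator (sphere 0 1) (sgn x) * indicator (ball 0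
      1) x \<partial>lborel)
      = (\<integral>\<^sup>+x. indicator A (sgn (T x)) * indicator (sphere 0 1) (sgn (T x)) * indicator (ball 0 1)
        (T x) \<partial>lborel)"
      by (intro nn_integral_cong) (auto simp: sgn_div_norm lin iso indicator_def)
    also have "\<dots> = (\<integral>\<^sup>+x. indicator A (sgn x) * indicator (sphere 0 1) (sgn x) * indicator (ball 0
      1) x \<partial>distr lborel borel T)"
      by (rule nn_integral_distr[symmetric]) measurable
    also have "\<dots> = (\<integral>\<^sup>+x. indicator A (sgn x) * indicator (sphere 0 1) (sgn x) * indicator (ball 0
      1) x \<partial>lborel)"
      by (simp add: lborel_linear_isometry[OF T iso])
    also have "\<dots> / emeasure lborel (ball 0 1 :: (complex ^ 'n) set) = (\<integral>\<^sup>+\<zeta>. indicator A \<zeta>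
      \<partial>sphere_measure)"
      by (rule nn_integral_sphere_measure[symmetric]) measurable
    also have "\<dots> = emeasure sphere_measure A"
      using A' by simp
    finally show "emeasure (distr sphere_measure sphere_measure T) A = emeasure sphere_measure A" .
  qed simp
qed

section \<open>Mean values over the sphere\<close>

lemma continuous_on_section:
  assumes "continuous_on (A \<times> B) (\<lambda>(x, y). f x y)"
  shows "x \<in> A \<Longrightarrow> continuous_on B (\<lambda>y. f x y)" "y \<in> B \<Longrightarrow> continuous_on A (\<lambda>x. f x y)"
proof -
  assume "x \<in> A"
  then have "continuous_on B (\<lambda>y. (\<lambda>(x, y). f x y) (x, y))"
    by (intro continuous_on_compose2[OF assms] continuous_intros) auto
  then show "continuous_on B (\<lambda>y. f x y)" by simp
next
  assume "y \<in> B"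
  then have "continuous_on A (\<lambda>x. (\<lambda>(x, y). f x y) (x, y))"
    by (intro continuous_on_compose2[OF assms] continuous_intros) auto
  then show "continuous_on A (\<lambda>x. f x y)" by simp
qed

lemma powr_mult_le_Young:
  fixes x m q :: real
  assumes "q \<ge> 1" "x \<ge> 0" "m > 0"
  shows "m powr (q - 1) * x \<le> x powr q / q + (1 - 1 / q) * m powr q"
proof (cases "q = 1")
  case True
  then show ?thesis using assms by simp
next
  case False
  with assms have q: "q > 1" by simp
  have "x * m powr (q - 1) \<le> x powr q / q + (m powr (q - 1)) powr (q / (q - 1)) / (q / (q - 1))"
    by (rule Youngs_inequality) (use q assms in \<open>auto simp: field_simps\<close>)
  also have "(m powr (q - 1)) powr (q / (q - 1)) / (q / (q - 1)) = (1 - 1 / q) * m powr q"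
  proof -
    have "(q - 1) * (q / (q - 1)) = q" using q by simp
    then show ?thesis using q by (simp only: powr_powr) (simp add: field_simps)
  qed
  finally show ?thesis by (simp add: mult.commute)
qed

text \<open>Jensen's inequality for the power \<open>q\<close>. Young's inequality supplies the supporting line of
  the power function at the mean \<open>m\<close>, which avoids integrability questions: if the right side is
  infinite, there is nothing to prove.\<close>

lemma (in prob_space) powr_mean_le:
  assumes q: "q \<ge> 1" and X [measurable]: "X \<in> borel_measurable M" and nonneg: "\<And>t. X t \<ge> 0"
    and m: "m \<ge> 0" "ennreal m \<le> (\<integral>\<^sup>+t. ennreal (X t) \<partial>M)"
  shows "ennreal (m powr q) \<le> (\<integral>\<^sup>+t. ennreal (X t powr q) \<partial>M)"
proof (cases "m = 0 \<or> (\<integral>\<^sup>+t. ennreal (X t powr q) \<partial>M) = \<infinity>")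
  case True
  then show ?thesis by auto
next
  case False
  then have "m > 0" using m by simp
  obtain J where J: "J \<ge> 0" "(\<integral>\<^sup>+t. ennreal (X t powr q) \<partial>M) = ennreal J"
    using False by (cases "(\<integral>\<^sup>+t. ennreal (X t powr q) \<partial>M)") auto
  have "ennreal (m powr q) = ennreal (m powr (q - 1)) * ennreal m"
    using \<open>m > 0\<close> by (simp add: powr_diff flip: ennreal_mult)
  also have "\<dots> \<le> ennreal (m powr (q - 1)) * (\<integral>\<^sup>+t. ennreal (X t) \<partial>M)"
    by (intro mult_left_mono m) simp
  also have "\<dots> = (\<integral>\<^sup>+t. ennreal (m powr (q - 1) * X t) \<partial>M)"
    by (simp add: nn_integral_cmult ennreal_mult' flip: nn_integral_cmult)
  also have "\<dots> \<le> (\<integral>\<^sup>+t. ennreal (1 / q) * ennreal (X t powr q) + ennreal ((1 - 1 / q) * m powr q)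
    \<partial>M)"
    using powr_mult_le_Young[OF q nonneg \<open>m > 0\<close>] q
    by (intro nn_integral_mono) (simp flip: ennreal_mult' ennreal_plus)
  also have "\<dots> = ennreal (1 / q) * ennreal J + ennreal ((1 - 1 / q) * m powr q)"
    using J by (simp add: nn_integral_add nn_integral_cmult emeasure_space_1)
  also have "\<dots> = ennreal (J / q + (1 - 1 / q) * m powr q)"
    using q J by (simp flip: ennreal_mult' ennreal_plus)
  finally have "m powr q \<le> J / q + (1 - 1 / q) * m powr q"
    using q J by (subst (asm) ennreal_le_iff) auto
  then have "m powr q / q \<le> J / q" by (simp add: algebra_simps)
  then show ?thesis using q J by (simp add: divide_le_cancel)
qed

lemma ennreal_power_le_iff:
  assumes "q \<ge> 1" "A \<ge> 0"
  shows "ennreal_power x (1 / q) \<le> ennreal A \<longleftrightarrow> x \<le> ennreal (A powr q)"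
proof (cases x)
  case (real r)
  have "r powr (1 / q) \<le> A \<longleftrightarrow> r \<le> A powr q"
  proof
    assume "r powr (1 / q) \<le> A"
    then have "(r powr (1 / q)) powr q \<le> A powr q"
      using assms by (intro powr_mono2) auto
    then show "r \<le> A powr q" using assms real by (simp add: powr_powr)
  next
    assume "r \<le> A powr q"
    then have "r powr (1 / q) \<le> (A powr q) powr (1 / q)"
      using assms real by (intro powr_mono2) auto
    then show "r powr (1 / q) \<le> A" using assms real by (simp add: powr_powr)
  qed
  then show ?thesis using real assms by (simp add: ennreal_power_def)
qed (simp add: ennreal_power_def top_unique)

lemma enn2real_ge_1: "1 \<le> p \<Longrightarrow> p \<noteq> \<infinity> \<Longrightarrow> 1 \<le> enn2real p"
  by (cases p) auto

text \<open>Upper bounds need neither the essential supremum nor the exponent \<open>1 / p\<close>: they are bounds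
  almost everywhere, respectively bounds for the integral of a power.\<close>

lemma integral_mean_le_iff:
  fixes F :: "complex ^ 'n \<Rightarrow> complex"
  assumes p: "1 \<le> p" and F [measurable]: "F \<in> borel_measurable sphere_measure" and A: "A \<ge> 0"
  shows "integral_mean p 1 F \<le> ennreal A \<longleftrightarrow>
    (if p = \<infinity> then AE \<zeta> in sphere_measure. norm (F \<zeta>) \<le> A
     else (\<integral>\<^sup>+\<zeta>. ennreal (norm (F \<zeta>) powr enn2real p) \<partial>sphere_measure) \<le> ennreal (A powr enn2real
       p))"
proof (cases "p = \<infinity>")
  case True
  have "esssup sphere_measure (\<lambda>\<zeta>. ennreal (norm (F \<zeta>))) \<le> ennreal A \<longleftrightarrow>
      (AE \<zeta> in sphere_measure. norm (F \<zeta>) \<le> A)"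
  proof
    assume "esssup sphere_measure (\<lambda>\<zeta>. ennreal (norm (F \<zeta>))) \<le> ennreal A"
    with esssup_AE[of "\<lambda>\<zeta>. ennreal (norm (F \<zeta>))" sphere_measure]
    have "AE \<zeta> in sphere_measure. ennreal (norm (F \<zeta>)) \<le> ennreal A"
      by (auto elim!: eventually_mono intro: order_trans)
    then show "AE \<zeta> in sphere_measure. norm (F \<zeta>) \<le> A" using A by simp
  next
    assume "AE \<zeta> in sphere_measure. norm (F \<zeta>) \<le> A"
    then show "esssup sphere_measure (\<lambda>\<zeta>. ennreal (norm (F \<zeta>))) \<le> ennreal A"
      using A by (intro esssup_I) auto
  qed
  then show ?thesis using True by (simp add: integral_mean_def)
next
  case False
  then show ?thesis
    using ennreal_power_le_iff[OF enn2real_ge_1[OF p] A] by (simp add: integral_mean_def)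
qed

lemma integral_mean_mono:
  fixes F G :: "complex ^ 'n \<Rightarrow> complex"
  assumes p: "1 \<le> p" and [measurable]: "F \<in> borel_measurable sphere_measure" "G
    \<in> borel_measurable sphere_measure"
    and le: "\<And>\<zeta>. norm \<zeta> = 1 \<Longrightarrow> norm (F \<zeta>) \<le> c * norm (G \<zeta>)" and "c \<ge> 0"
    and A: "A \<ge> 0" "integral_mean p 1 G \<le> ennreal A"
  shows "integral_mean p 1 F \<le> ennreal (c * A)"
proof (cases "p = \<infinity>")
  case True
  have "AE \<zeta> in sphere_measure. norm (G \<zeta>) \<le> A"
    using A p True by (subst (asm) integral_mean_le_iff) auto
  moreover have "AE \<zeta> in sphere_measure. norm (F \<zeta>) \<le> c * norm (G \<zeta>)"
    using le by (intro AE_I2) auto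
  ultimately have "AE \<zeta> in sphere_measure. norm (F \<zeta>) \<le> c * A"
    by eventually_elim (use \<open>c \<ge> 0\<close> in \<open>meson mult_left_mono order_trans\<close>)
  then show ?thesis using A p True \<open>c \<ge> 0\<close> by (subst integral_mean_le_iff) auto
next
  case False
  define q where "q = enn2real p"
  have q: "q \<ge> 1" using enn2real_ge_1[OF p False] by (simp add: q_def)
  have "(\<integral>\<^sup>+\<zeta>. ennreal (norm (F \<zeta>) powr q) \<partial>sphere_measure)
    \<le> (\<integral>\<^sup>+\<zeta>. ennreal (c powr q) * ennreal (norm (G \<zeta>) powr q) \<partial>sphere_measure)"
  proof (rule nn_integral_mono)
    fix \<zeta> :: "complex ^ 'n" assume "\<zeta> \<in> space sphere_measure"
    then have "norm (F \<zeta>) powr q \<le> (c * norm (G \<zeta>)) powr q"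
      using q le by (intro powr_mono2) auto
    then show "ennreal (norm (F \<zeta>) powr q) \<le> ennreal (c powr q) * ennreal (norm (G \<zeta>) powr q)"
      using \<open>c \<ge> 0\<close> by (simp add: powr_mult flip: ennreal_mult')
  qed
  also have "\<dots> = ennreal (c powr q) * (\<integral>\<^sup>+\<zeta>. ennreal (norm (G \<zeta>) powr q) \<partial>sphere_measure)"
    by (rule nn_integral_cmult) measurable
  also have "\<dots> \<le> ennreal (c powr q) * ennreal (A powr q)"
    using A p False by (intro mult_left_mono) (subst (asm) integral_mean_le_iff, auto simp: q_def)
  also have "\<dots> = ennreal ((c * A) powr q)"
    using \<open>c \<ge> 0\<close> A by (simp add: powr_mult flip: ennreal_mult')
  finally show ?thesis using A p False \<open>c \<ge> 0\<close> by (subst integral_mean_le_iff) (auto simp: q_def)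
qed

text \<open>Minkowski's integral inequality for averages: a function dominated by an average of
  functions of mean at most \<open>A\<close> has mean at most \<open>A\<close>. For finite \<open>p\<close> this is Jensen's inequality
  followed by Tonelli, for \<open>p = \<infinity>\<close> it is Fubini for null sets.\<close>

lemma integral_mean_average:
  fixes F :: "complex ^ 'n \<Rightarrow> complex" and G :: "'t \<Rightarrow> complex ^ 'n \<Rightarrow> complex"
  assumes p: "1 \<le> p" and \<mu>: "prob_space \<mu>"
    and F [measurable]: "F \<in> borel_measurable sphere_measure"
    and G [measurable]: "(\<lambda>(t, \<zeta>). G t \<zeta>) \<in> borel_measurable (\<mu> \<Otimes>\<^sub>M sphere_measure)"
    and A: "A \<ge> 0" "\<And>t. t \<in> space \<mu> \<Longrightarrow> integral_mean p 1 (G t) \<le> ennreal A"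
    and le: "\<And>\<zeta>. norm \<zeta> = 1 \<Longrightarrow> ennreal (norm (F \<zeta>)) \<le> (\<integral>\<^sup>+t. ennreal (norm (G t \<zeta>)) \<partial>\<mu>)"
  shows "integral_mean p 1 F \<le> ennreal A"
proof -
  interpret \<mu>: prob_space \<mu> by fact
  interpret \<sigma>: prob_space "sphere_measure :: (complex ^ 'n) measure"
    by (rule prob_space_sphere_measure)
  interpret pair_prob_space \<mu> "sphere_measure :: (complex ^ 'n) measure" ..
  have Gt [measurable]: "G t \<in> borel_measurable sphere_measure" if "t \<in> space \<mu>" for t
    using measurable_compose[OF measurable_Pair1'[OF that] G] by simp
  have G\<zeta> [measurable]: "(\<lambda>t. G t \<zeta>) \<in> borel_measurable \<mu>" if "norm \<zeta> = 1" for \<zeta>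
    using measurable_compose[OF measurable_Pair2'[of \<zeta> "sphere_measure" \<mu>] G] that by simp
  show ?thesis
  proof (cases "p = \<infinity>")
    case True
    have *: "AE \<zeta> in sphere_measure. norm (G t \<zeta>) \<le> A" if "t \<in> space \<mu>" for t
      using A(2)[OF that] integral_mean_le_iff[OF p Gt[OF that] A(1)] True by simp
    have "AE t in \<mu>. AE \<zeta> in sphere_measure. norm (G t \<zeta>) \<le> A"
      by (rule AE_I2) (rule *)
    then have "AE \<zeta> in sphere_measure. AE t in \<mu>. norm (G t \<zeta>) \<le> A"
      by (subst (asm) AE_commute) measurable
    moreover have "AE \<zeta> in sphere_measure. norm (\<zeta> :: complex ^ 'n) = 1"
      by (intro AE_I2) simp
    ultimately have "AE \<zeta> in sphere_measure. norm (F \<zeta>) \<le> A"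
    proof eventually_elim
      case (elim \<zeta>)
      have "ennreal (norm (F \<zeta>)) \<le> (\<integral>\<^sup>+t. ennreal (norm (G t \<zeta>)) \<partial>\<mu>)"
        by (rule le) (rule elim(2))
      also have "\<dots> \<le> (\<integral>\<^sup>+t. ennreal A \<partial>\<mu>)"
        using elim(1) by (intro nn_integral_mono_AE) (auto elim!: eventually_mono intro:
          ennreal_leI)
      also have "\<dots> = ennreal A" by (simp add: \<mu>.emeasure_space_1)
      finally show ?case using A by simp
    qed
    then show ?thesis using integral_mean_le_iff[OF p F A(1)] True by simp
  next
    case False
    define q where "q = enn2real p"
    have q: "q \<ge> 1" using enn2real_ge_1[OF p False] by (simp add: q_def)
    have "(\<integral>\<^sup>+\<zeta>. ennreal (norm (F \<zeta>) powr q) \<partial>sphere_measure)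
      \<le> (\<integral>\<^sup>+\<zeta>. \<integral>\<^sup>+t. ennreal (norm (G t \<zeta>) powr q) \<partial>\<mu> \<partial>sphere_measure)"
    proof (rule nn_integral_mono)
      fix \<zeta> :: "complex ^ 'n" assume "\<zeta> \<in> space sphere_measure"
      then have [simp]: "norm \<zeta> = 1" by simp
      show "ennreal (norm (F \<zeta>) powr q) \<le> (\<integral>\<^sup>+t. ennreal (norm (G t \<zeta>) powr q) \<partial>\<mu>)"
        by (rule \<mu>.powr_mean_le) (use q le G\<zeta> in auto)
    qed
    also have "\<dots> = (\<integral>\<^sup>+t. \<integral>\<^sup>+\<zeta>. ennreal (norm (G t \<zeta>) powr q) \<partial>sphere_measure \<partial>\<mu>)"
      by (rule Fubini') measurable
    also have "\<dots> \<le> (\<integral>\<^sup>+t. ennreal (A powr q) \<partial>\<mu>)"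
    proof (rule nn_integral_mono)
      fix t assume t: "t \<in> space \<mu>"
      show "(\<integral>\<^sup>+\<zeta>. ennreal (norm (G t \<zeta>) powr q) \<partial>sphere_measure) \<le> ennreal (A powr q)"
        using A(2)[OF t] integral_mean_le_iff[OF p Gt[OF t] A(1)] False by (simp add: q_def)
    qed
    also have "\<dots> = ennreal (A powr q)" by (simp add: \<mu>.emeasure_space_1)
    finally show ?thesis using integral_mean_le_iff[OF p F A(1)] False by (simp add: q_def)
  qed
qed

definition unit_interval_measure :: "real measure" where
  "unit_interval_measure = restrict_space lborel {0..1}"

lemma space_unit_interval_measure [simp]: "space unit_interval_measure = {0..1}"
  by (simp add: unit_interval_measure_def space_restrict_space)

lemma prob_space_unit_interval_measure: "prob_space unit_interval_measure"
  by (rule prob_spaceI) (simp add: unit_interval_measure_def emeasure_restrict_space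
    space_restrict_space)

lemma nn_integral_unit_interval_measure:
  "(\<integral>\<^sup>+t. f t \<partial>unit_interval_measure) = (\<integral>\<^sup>+t. f t * indicator {0..1} t \<partial>lborel)"
  unfolding unit_interval_measure_def by (rule nn_integral_restrict_space) simp

lemma borel_measurable_pair_continuous:
  fixes G :: "real \<Rightarrow> complex ^ 'n \<Rightarrow> complex"
  assumes "continuous_on ({0..1} \<times> sphere 0 1) (\<lambda>(t, \<zeta>). G t \<zeta>)"
  shows "(\<lambda>(t, \<zeta>). G t \<zeta>) \<in> borel_measurable (unit_interval_measure \<Otimes>\<^sub>M sphere_measure)"
proof -
  let ?P = "unit_interval_measure \<Otimes>\<^sub>M (sphere_measure :: (complex ^ 'n) measure)"
  have "fst \<in> borel_measurable ?P"
    unfolding unit_interval_measure_def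
    by (rule measurable_compose[OF measurable_fst]) (simp add: measurable_restrict_space1)
  moreover have "snd \<in> borel_measurable ?P"
    by (rule measurable_compose[OF measurable_snd borel_measurable_sphere_measure]) (rule
      continuous_on_id)
  ultimately have "(\<lambda>x. (fst x, snd x)) \<in> ?P \<rightarrow>\<^sub>M (borel \<Otimes>\<^sub>M borel)"
    by (rule measurable_Pair)
  then have "(\<lambda>x. x) \<in> ?P \<rightarrow>\<^sub>M borel"
    by (simp add: borel_prod)
  then have "(\<lambda>x. x) \<in> ?P \<rightarrow>\<^sub>M restrict_space borel ({0..1} \<times> sphere 0 1)"
    by (rule measurable_restrict_space2[rotated]) (auto simp: space_pair_measure)
  from measurable_compose[OF this borel_measurable_continuous_on_restrict[OF assms]]
  show ?thesis .
qed

text \<open>The triangle inequality is a special case of averaging: \<open>F + H\<close> is the average of \<open>F / c\<close>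
  over \<open>[0, c)\<close> and of \<open>H / (1 - c)\<close> over \<open>[c, 1]\<close>. The choice of \<open>c\<close> gives both functions the
  same bound \<open>a + b\<close>.\<close>

lemma integral_mean_triangle:
  fixes F H :: "complex ^ 'n \<Rightarrow> complex"
  assumes p: "1 \<le> p"
    and F [measurable]: "F \<in> borel_measurable sphere_measure" and H [measurable]: "H
      \<in> borel_measurable sphere_measure"
    and a: "a > 0" "integral_mean p 1 F \<le> ennreal a" and b: "b > 0" "integral_mean p 1 H
      \<le> ennreal b"
  shows "integral_mean p 1 (\<lambda>\<zeta>. F \<zeta> + H \<zeta>) \<le> ennreal (a + b)"
proof -
  define c where "c = a / (a + b)"
  have c: "0 < c" "c < 1" using a b by (auto simp: c_def field_simps)
  have ac: "a / c = a + b" "b / (1 - c) = a + b"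
    using a b by (auto simp: c_def field_simps)
  define G where "G = (\<lambda>t \<zeta>. if t < c then (1 / c) *\<^sub>R F \<zeta> else (1 / (1 - c)) *\<^sub>R H \<zeta>)"
  have t [measurable]: "(\<lambda>t::real. t) \<in> borel_measurable unit_interval_measure"
    unfolding unit_interval_measure_def by (simp add: measurable_restrict_space1)
  show ?thesis
  proof (rule integral_mean_average[OF p prob_space_unit_interval_measure])
    show "(\<lambda>(t, \<zeta>). G t \<zeta>) \<in> borel_measurable (unit_interval_measure \<Otimes>\<^sub>M sphere_measure)"
      unfolding G_def by measurable
    show "integral_mean p 1 (G t) \<le> ennreal (a + b)" for t
    proof (cases "t < c")
      case True
      have "integral_mean p 1 (\<lambda>\<zeta>. (1 / c) *\<^sub>R F \<zeta>) \<le> ennreal (1 / c * a)"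
        by (rule integral_mean_mono[OF p _ F]) (use a c in \<open>auto simp: norm_mult norm_divide\<close>)
      then show ?thesis using True ac by (simp add: G_def)
    next
      case False
      have "integral_mean p 1 (\<lambda>\<zeta>. (1 / (1 - c)) *\<^sub>R H \<zeta>) \<le> ennreal (1 / (1 - c) * b)"
        by (rule integral_mean_mono[OF p _ H]) (use b c in \<open>auto simp: norm_mult norm_divide\<close>)
      then show ?thesis using False ac by (simp add: G_def)
    qed
    fix \<zeta> :: "complex ^ 'n"
    have "(\<integral>\<^sup>+t. ennreal (norm (G t \<zeta>)) \<partial>unit_interval_measure)
      = (\<integral>\<^sup>+t. ennreal (norm (F \<zeta>) / c) * indicator {0..<c} t + ennreal (norm (H \<zeta>) / (1 - c)) *
        indicator {c..1} t \<partial>lborel)"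
      unfolding nn_integral_unit_interval_measure
      using c by (intro nn_integral_cong) (auto simp: G_def indicator_def norm_mult norm_divide)
    also have "\<dots> = ennreal (norm (F \<zeta>) / c) * ennreal c + ennreal (norm (H \<zeta>) / (1 - c)) *
      ennreal (1 - c)"
      using c by (simp add: nn_integral_add nn_integral_cmult)
    also have "\<dots> = ennreal (norm (F \<zeta>) + norm (H \<zeta>))"
      using c by (simp flip: ennreal_mult' ennreal_plus)
    finally have eq: "(\<integral>\<^sup>+t. ennreal (norm (G t \<zeta>)) \<partial>unit_interval_measure) = ennreal (norm (F \<zeta>)
      + norm (H \<zeta>))" .
    show "ennreal (norm (F \<zeta> + H \<zeta>)) \<le> (\<integral>\<^sup>+t. ennreal (norm (G t \<zeta>)) \<partial>unit_interval_measure)"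
      unfolding eq by (intro ennreal_leI norm_triangle_ineq)
  qed (use a b in auto)
qed

text \<open>All functions that occur in the proof are continuous on the sphere, so their means are
  finite and can be handled as real numbers.\<close>

definition sphere_norm :: "ennreal \<Rightarrow> (complex ^ 'n \<Rightarrow> complex) \<Rightarrow> real" where
  "sphere_norm p F = enn2real (integral_mean p 1 F)"

lemma sphere_norm_nonneg [simp]: "sphere_norm p F \<ge> 0"
  by (simp add: sphere_norm_def)

lemma integral_mean_le_sup:
  fixes F :: "complex ^ 'n \<Rightarrow> complex"
  assumes p: "1 \<le> p" and F: "F \<in> borel_measurable sphere_measure" and "A \<ge> 0"
    and le: "\<And>\<zeta>. norm \<zeta> = 1 \<Longrightarrow> norm (F \<zeta>) \<le> A"
  shows "integral_mean p 1 F \<le> ennreal A"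
proof -
  interpret \<sigma>: prob_space "sphere_measure :: (complex ^ 'n) measure"
    by (rule prob_space_sphere_measure)
  have "(\<integral>\<^sup>+\<zeta>. ennreal (norm (F \<zeta>) powr q) \<partial>sphere_measure) \<le> ennreal (A powr q)" if "q \<ge> 1" for q
  proof -
    have "(\<integral>\<^sup>+\<zeta>. ennreal (norm (F \<zeta>) powr q) \<partial>sphere_measure) \<le> (\<integral>\<^sup>+\<zeta>. ennreal (A powr q)
      \<partial>(sphere_measure :: (complex ^ 'n) measure))"
      using that le by (intro nn_integral_mono ennreal_leI powr_mono2) auto
    also have "\<dots> = ennreal (A powr q)"
      using \<sigma>.emeasure_space_1 by simp
    finally show ?thesis .
  qed
  moreover have "AE \<zeta> in sphere_measure. norm (F \<zeta>) \<le> A"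
    using le by (intro AE_I2) auto
  ultimately show ?thesis
    using integral_mean_le_iff[OF p F \<open>A \<ge> 0\<close>] enn2real_ge_1[OF p] by auto
qed

lemma integral_mean_eq_sphere_norm:
  fixes F :: "complex ^ 'n \<Rightarrow> complex"
  assumes p: "1 \<le> p" and F: "continuous_on (sphere 0 1) F"
  shows "integral_mean p 1 F = ennreal (sphere_norm p F)"
proof -
  have "compact (F ` sphere 0 1)"
    by (rule compact_continuous_image[OF F compact_sphere])
  then obtain B where B: "\<forall>x\<in>F ` sphere 0 1. norm x \<le> B"
    using compact_imp_bounded bounded_iff by blast
  then have "norm (F \<zeta>) \<le> max B 0" if "norm \<zeta> = 1" for \<zeta>
    using that by (auto simp: le_max_iff_disj)
  then have "integral_mean p 1 F \<le> ennreal (max B 0)"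
    by (intro integral_mean_le_sup[OF p borel_measurable_sphere_measure[OF F]]) auto
  then show ?thesis unfolding sphere_norm_def
    by (cases "integral_mean p 1 F") (auto simp: top_unique)
qed

lemma sphere_norm_le_iff:
  fixes F :: "complex ^ 'n \<Rightarrow> complex"
  assumes "1 \<le> p" "continuous_on (sphere 0 1) F" "A \<ge> 0"
  shows "integral_mean p 1 F \<le> ennreal A \<longleftrightarrow> sphere_norm p F \<le> A"
  using assms by (simp add: integral_mean_eq_sphere_norm)

lemma sphere_norm_mono:
  fixes F G :: "complex ^ 'n \<Rightarrow> complex"
  assumes p: "1 \<le> p" and F: "continuous_on (sphere 0 1) F" and G: "continuous_on (sphere 0 1) G"
    and "\<And>\<zeta>. norm \<zeta> = 1 \<Longrightarrow> norm (F \<zeta>) \<le> c * norm (G \<zeta>)" "c \<ge> 0"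
  shows "sphere_norm p F \<le> c * sphere_norm p G"
proof -
  have "integral_mean p 1 F \<le> ennreal (c * sphere_norm p G)"
    by (rule integral_mean_mono[OF p borel_measurable_sphere_measure[OF F]
          borel_measurable_sphere_measure[OF G] assms(4,5) sphere_norm_nonneg])
       (simp_all add: integral_mean_eq_sphere_norm p G)
  then show ?thesis using p F assms(5) by (simp add: sphere_norm_le_iff)
qed

lemma integral_mean_cong:
  fixes F G :: "complex ^ 'n \<Rightarrow> complex"
  assumes "\<And>\<zeta>. norm \<zeta> = 1 \<Longrightarrow> F (r *\<^sub>R \<zeta>) = G (s *\<^sub>R \<zeta>)"
  shows "integral_mean p r F = integral_mean p s G"
proof -
  let ?F = "\<lambda>\<zeta>. ennreal (norm (F (r *\<^sub>R \<zeta>)))" and ?G = "\<lambda>\<zeta>. ennreal (norm (G (s *\<^sub>R \<zeta>)))"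
  have "?F \<in> borel_measurable sphere_measure \<longleftrightarrow> ?G \<in> borel_measurable sphere_measure"
    by (rule measurable_cong) (use assms in simp)
  moreover have "Limsup (ae_filter sphere_measure) ?F = Limsup (ae_filter sphere_measure) ?G"
    by (rule Limsup_eq, rule AE_I2) (use assms in simp)
  ultimately have "esssup sphere_measure ?F = esssup sphere_measure ?G"
    by (simp add: esssup_def)
  moreover have "(\<integral>\<^sup>+\<zeta>. ennreal (norm (F (r *\<^sub>R \<zeta>)) powr q) \<partial>sphere_measure)
      = (\<integral>\<^sup>+\<zeta>. ennreal (norm (G (s *\<^sub>R \<zeta>)) powr q) \<partial>sphere_measure)" for q
    by (rule nn_integral_cong) (use assms in simp)
  ultimately show ?thesis by (simp add: integral_mean_def)
qed

lemma sphere_norm_cong: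
  fixes F G :: "complex ^ 'n \<Rightarrow> complex"
  assumes "\<And>\<zeta>. norm \<zeta> = 1 \<Longrightarrow> F \<zeta> = G \<zeta>"
  shows "sphere_norm p F = sphere_norm p G"
  using integral_mean_cong[of F 1 G 1 p] assms by (simp add: sphere_norm_def)

lemma sphere_norm_triangle:
  fixes F G :: "complex ^ 'n \<Rightarrow> complex"
  assumes p: "1 \<le> p" and F: "continuous_on (sphere 0 1) F" and G: "continuous_on (sphere 0 1) G"
  shows "sphere_norm p (\<lambda>\<zeta>. F \<zeta> + G \<zeta>) \<le> sphere_norm p F + sphere_norm p G"
proof (rule field_le_epsilon)
  fix e :: real assume "e > 0"
  have "integral_mean p 1 (\<lambda>\<zeta>. F \<zeta> + G \<zeta>) \<le> ennreal ((sphere_norm p F + e / 2) + (sphere_norm p G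
    + e / 2))"
    using \<open>e > 0\<close>
    by (intro integral_mean_triangle p borel_measurable_sphere_measure F G)
       (auto simp: integral_mean_eq_sphere_norm p F G intro: add_nonneg_pos)
  then show "sphere_norm p (\<lambda>\<zeta>. F \<zeta> + G \<zeta>) \<le> sphere_norm p F + sphere_norm p G + e"
    using \<open>e > 0\<close> p F G by (subst (asm) sphere_norm_le_iff) (auto intro!:
      continuous_intros add_nonneg_nonneg)
qed

lemma sphere_norm_sum:
  fixes F :: "'i \<Rightarrow> complex ^ 'n \<Rightarrow> complex"
  assumes p: "1 \<le> p" and "finite I" and F: "\<And>i. i \<in> I \<Longrightarrow> continuous_on (sphere 0 1) (F i)"
  shows "sphere_norm p (\<lambda>\<zeta>. \<Sum>i\<in>I. F i \<zeta>) \<le> (\<Sum>i\<in>I. sphere_norm p (F i))"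
  using assms(2,3)
proof (induction I rule: finite_induct)
  case empty
  have "integral_mean p 1 (\<lambda>\<zeta> :: complex ^ 'n. 0) \<le> ennreal 0"
    by (rule integral_mean_le_sup[OF p]) auto
  then show ?case by (simp add: sphere_norm_def)
next
  case (insert i I)
  have "sphere_norm p (\<lambda>\<zeta>. F i \<zeta> + (\<Sum>i\<in>I. F i \<zeta>)) \<le> sphere_norm p (F i) + sphere_norm p (\<lambda>\<zeta>. \<Sum>i\<in>I.
    F i \<zeta>)"
    using insert by (intro sphere_norm_triangle p continuous_intros) auto
  then show ?case using insert by auto
qed

text \<open>The averaging principle in the form used below, where the average comes from the fundamental
  theorem of calculus or from Cauchy's formula.\<close>

lemma sphere_norm_average:
  fixes F :: "complex ^ 'n \<Rightarrow> complex" and G :: "real \<Rightarrow> complex ^ 'n \<Rightarrow> complex"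
  assumes p: "1 \<le> p" and F: "continuous_on (sphere 0 1) F"
    and G: "continuous_on ({0..1} \<times> sphere 0 1) (\<lambda>(t, \<zeta>). G t \<zeta>)"
    and int: "\<And>\<zeta>. norm \<zeta> = 1 \<Longrightarrow> ((\<lambda>t. G t \<zeta>) has_integral F \<zeta>) {0..1}"
    and le: "\<And>t. t \<in> {0..1} \<Longrightarrow> sphere_norm p (G t) \<le> A"
  shows "sphere_norm p F \<le> A"
proof -
  have A: "A \<ge> 0" using order_trans[OF sphere_norm_nonneg le[of 0]] by simp
  have Gt: "continuous_on (sphere 0 1) (G t)" if "t \<in> {0..1}" for t
    by (rule continuous_on_section(1)[OF G that])
  have "integral_mean p 1 F \<le> ennreal A"
  proof (rule integral_mean_average[OF p prob_space_unit_interval_measure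
    borel_measurable_sphere_measure[OF F] borel_measurable_pair_continuous[OF G] A])
    show "integral_mean p 1 (G t) \<le> ennreal A" if "t \<in> space unit_interval_measure" for t
      using that le Gt A p by (subst sphere_norm_le_iff) auto
    fix \<zeta> :: "complex ^ 'n" assume \<zeta>: "norm \<zeta> = 1"
    have cont: "continuous_on {0..1} (\<lambda>t. G t \<zeta>)"
      using continuous_on_section(2)[OF G] \<zeta> by simp
    have "ennreal (norm (F \<zeta>)) \<le> ennreal (integral {0..1} (\<lambda>t. norm (G t \<zeta>)))"
    proof (rule ennreal_leI)
      have "F \<zeta> = integral {0..1} (\<lambda>t. G t \<zeta>)" using int[OF \<zeta>] by (simp add: integral_unique)
      also have "norm \<dots> \<le> integral {0..1} (\<lambda>t. norm (G t \<zeta>))"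
        using cont by (intro integral_norm_bound_integral integrable_continuous_interval
          continuous_intros) auto
      finally show "norm (F \<zeta>) \<le> integral {0..1} (\<lambda>t. norm (G t \<zeta>))" .
    qed
    also have "\<dots> = (\<integral>\<^sup>+t. ennreal (norm (G t \<zeta>) * indicator {0..1} t) \<partial>lborel)"
    proof (rule nn_integral_has_integral_lborel[symmetric])
      show "((\<lambda>t. norm (G t \<zeta>) * indicator {0..1} t) has_integral integral {0..1} (\<lambda>t. norm (G
        t \<zeta>))) UNIV"
      proof -
        have "((\<lambda>t. norm (G t \<zeta>)) has_integral integral {0..1} (\<lambda>t. norm (G t \<zeta>))) {0..1}"
          using cont by (intro integrable_integral integrable_continuous_interval continuous_intros)
        then have "((\<lambda>t. if t \<in> {0..1} then norm (G t \<zeta>) else 0) has_integral integral {0..1}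
          (\<lambda>t. norm (G t \<zeta>))) UNIV"
          by (subst has_integral_restrict_UNIV)
        then show ?thesis by (rule has_integral_eq_rhs[OF has_integral_eq, rotated]) (auto simp:
          indicator_def)
      qed
      show "(\<lambda>t. norm (G t \<zeta>) * indicator {0..1} t) \<in> borel_measurable borel"
        using borel_measurable_continuous_on_indicator[of "{0..1::real}" "\<lambda>t. norm (G t \<zeta>)"] cont
        by (simp add: continuous_on_norm mult.commute)
    qed auto
    finally show "ennreal (norm (F \<zeta>)) \<le> (\<integral>\<^sup>+t. ennreal (norm (G t \<zeta>)) \<partial>unit_interval_measure)"
      unfolding nn_integral_unit_interval_measure
      by (simp add: ennreal_mult' ennreal_indicator)
  qed
  then show ?thesis using p F A by (simp add: sphere_norm_le_iff)
qed

lemma sphere_norm_isometry: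
  fixes F :: "complex ^ 'n \<Rightarrow> complex" and T :: "complex ^ 'n \<Rightarrow> complex ^ 'n"
  assumes p: "1 \<le> p" and F: "continuous_on (sphere 0 1) F"
    and T: "linear T" and iso: "\<And>x. norm (T x) = norm x"
  shows "sphere_norm p (\<lambda>\<zeta>. F (T \<zeta>)) \<le> sphere_norm p F"
proof -
  note [measurable] = borel_measurable_sphere_measure[OF F] distr_sphere_measure_isometry(1)[OF
    T iso]
  have *: "distr sphere_measure sphere_measure T = sphere_measure"
    by (rule distr_sphere_measure_isometry(2)[OF T iso])
  have TF: "continuous_on (sphere 0 1) (\<lambda>\<zeta>. F (T \<zeta>))"
    using T iso by (intro continuous_on_compose2[OF F] linear_continuous_on) (auto simp:
      linear_conv_bounded_linear)
  have int_eq: "(\<integral>\<^sup>+\<zeta>. ennreal (norm (F (T \<zeta>)) powr q) \<partial>sphere_measure) = (\<integral>\<^sup>+\<zeta>. ennreal (norm (F \<zeta>)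
    powr q) \<partial>sphere_measure)" for q
    by (subst (2) *[symmetric], rule nn_integral_distr[symmetric]) measurable
  have AE_eq: "(AE \<zeta> in sphere_measure. norm (F (T \<zeta>)) \<le> A) \<longleftrightarrow> (AE \<zeta> in sphere_measure. norm (F \<zeta>)
    \<le> A)" for A
    by (subst (2) *[symmetric], rule AE_distr_iff[symmetric]) measurable
  have "integral_mean p 1 (\<lambda>\<zeta>. F (T \<zeta>)) \<le> ennreal A" if "A \<ge> 0" "integral_mean p 1 F \<le> ennreal A"
    for A
    using that by (simp add: integral_mean_le_iff[OF p] borel_measurable_sphere_measure F TF int_eq
      AE_eq)
  from this[of "sphere_norm p F"] show ?thesis using p TF
    by (simp add: integral_mean_eq_sphere_norm[OF p F] sphere_norm_le_iff)
qed

lemma continuous_on_sphere_holo: "holo f (ball 0 \<rho>) \<Longrightarrow> \<rho> > 1 \<Longrightarrow> continuous_on (sphere 0 1) f"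
  by (rule continuous_on_subset[OF holo_continuous_on]) auto

section \<open>Composition with linear contractions\<close>

lemma clinear_iff:
  fixes V :: "complex ^ 'n \<Rightarrow> complex ^ 'n"
  shows "Vector_Spaces.linear (*s) (*s) V \<longleftrightarrow>
    (\<forall>x y. V (x + y) = V x + V y) \<and> (\<forall>c x. V (c *s x) = c *s V x)"
  by (simp add: Vector_Spaces.linear_iff vec.vector_space_axioms)

text \<open>By homogeneity these are the linear maps of the unit ball into itself, that is, the
  operators of the semigroup; see \<open>contraction_ball_operator\<close>.\<close>

definition contraction :: "(complex ^ 'n \<Rightarrow> complex ^ 'n) \<Rightarrow> bool" where
  "contraction V \<longleftrightarrow> Vector_Spaces.linear (*s) (*s) V \<and> (\<forall>x. norm (V x) \<le> norm x)"

lemma contraction_add: "contraction V \<Longrightarrow> V (x + y) = V x + V y"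
  and contraction_smult: "contraction V \<Longrightarrow> V (c *s x) = c *s V x"
  and contraction_norm_le: "contraction V \<Longrightarrow> norm (V x) \<le> norm x"
  by (simp_all add: contraction_def clinear_iff)

lemma contractionI:
  assumes "\<And>x y. V (x + y) = V x + V y" "\<And>c x. V (c *s x) = c *s V x" "\<And>x. norm (V x) \<le> norm x"
  shows "contraction V"
  using assms by (simp add: contraction_def clinear_iff)

lemma contraction_linear: "contraction V \<Longrightarrow> linear V"
  by (rule linearI) (simp_all add: contraction_add contraction_smult scaleR_eq_smult)

lemma contraction_diff: "contraction V \<Longrightarrow> V (x - y) = V x - V y"
  using linear_diff[OF contraction_linear] .

lemma contraction_comp: "contraction V \<Longrightarrow> contraction W \<Longrightarrow> contraction (\<lambda>x. V (W x))"
  by (rule contractionI) (auto simp: contraction_add contraction_smult intro: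
    order_trans contraction_norm_le)

lemma contraction_continuous_on:
  assumes "contraction V" "continuous_on S f"
  shows "continuous_on S (\<lambda>x. V (f x))"
  using assms(2) linear_continuous_on contraction_linear[OF assms(1)]
  by (intro continuous_on_compose2[OF linear_continuous_on[of V UNIV] assms(2)]) (auto simp:
    linear_conv_bounded_linear)

text \<open>The Hermitian inner product; the inner product of the library on this space is its real
  part.\<close>

definition cinner :: "complex ^ 'n \<Rightarrow> complex ^ 'n \<Rightarrow> complex" where
  "cinner x y = (\<Sum>i\<in>UNIV. x $ i * cnj (y $ i))"

lemma cinner_add: "cinner (x + y) z = cinner x z + cinner y z"
  and cinner_diff: "cinner (x - y) z = cinner x z - cinner y z"
  and cinner_smult: "cinner (c *s x) z = c * cinner x z"
  and cinner_smult_right: "cinner x (c *s z) = cnj c * cinner x z"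
  by (simp_all add: cinner_def algebra_simps sum.distrib sum_subtractf sum_distrib_left)

lemma Re_cinner: "Re (cinner x y) = x \<bullet> y"
  by (simp add: cinner_def inner_vec_def inner_complex_def)

lemma cinner_eq_0I:
  assumes "x \<bullet> y = 0" "(\<i> *s x) \<bullet> y = 0"
  shows "cinner x y = 0"
  using assms by (simp add: complex_eq_iff cinner_smult flip: Re_cinner)

lemma cinner_self: "cinner x x = of_real ((norm x)\<^sup>2)"
proof -
  have "Im (cinner x x) = 0" by (simp add: cinner_def mult.commute)
  then show ?thesis by (simp add: complex_eq_iff Re_cinner dot_square_norm)
qed

lemma continuous_on_cinner [continuous_intros]:
  "continuous_on S f \<Longrightarrow> continuous_on S (\<lambda>x. cinner (f x) y)"
  unfolding cinner_def by (intro continuous_intros)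

lemma norm_add_orthogonal:
  assumes "cinner x y = 0"
  shows "(norm (x + y))\<^sup>2 = (norm x)\<^sup>2 + (norm y)\<^sup>2"
proof -
  have "x \<bullet> y = 0" using assms by (simp flip: Re_cinner)
  then show ?thesis using dot_norm[of x y] by simp
qed

text \<open>For a contraction this is the space of right singular vectors for the largest possible
  singular value \<open>1\<close>. Its dimension measures how far the contraction is from being unitary.\<close>

definition isometric_part :: "('a::real_normed_vector \<Rightarrow> 'b::real_normed_vector) \<Rightarrow> 'a set" where
  "isometric_part V = {x. norm (V x) = norm x}"

text \<open>The parallelogram law for \<open>x\<close>, \<open>y\<close> and for their images forces equality in both contraction
  estimates, for \<open>x + y\<close> and for \<open>x - y\<close>.\<close>

lemma subspace_isometric_part:
  fixes V :: "complex ^ 'n \<Rightarrow> complex ^ 'n"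
  assumes V: "contraction V"
  shows "subspace (isometric_part V)"
proof (rule subspaceI)
  have lin: "linear V" using V by (rule contraction_linear)
  show "0 \<in> isometric_part V" by (simp add: isometric_part_def linear_0[OF lin])
  show "c *\<^sub>R x \<in> isometric_part V" if "x \<in> isometric_part V" for c x
    using that by (simp add: isometric_part_def linear_scale[OF lin])
  fix x y assume "x \<in> isometric_part V" "y \<in> isometric_part V"
  then have eq: "norm (V x) = norm x" "norm (V y) = norm y" by (auto simp: isometric_part_def)
  have par: "(norm (a + b))\<^sup>2 + (norm (a - b))\<^sup>2 = 2 * (norm a)\<^sup>2 + 2 * (norm b)\<^sup>2"
    for a b :: "complex ^ 'n"
    using dot_norm[of a b] dot_norm_neg[of a b] by (simp add: field_simps)
  have "(norm (V (x + y)))\<^sup>2 + (norm (V (x - y)))\<^sup>2 = (norm (x + y))\<^sup>2 + (norm (x - y))\<^sup>2"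
    using par[of "V x" "V y"] par[of x y] by (simp add: eq linear_add[OF lin] linear_diff[OF lin])
  moreover have "(norm (V (x - y)))\<^sup>2 \<le> (norm (x - y))\<^sup>2" "(norm (V (x + y)))\<^sup>2 \<le> (norm (x + y))\<^sup>2"
    using V by (auto intro!: power_mono contraction_norm_le)
  ultimately have "(norm (V (x + y)))\<^sup>2 = (norm (x + y))\<^sup>2" by linarith
  then show "x + y \<in> isometric_part V" by (simp add: isometric_part_def)
qed

text \<open>A right singular vector \<open>x\<close> for the smallest singular value \<open>s\<close> is found as a minimizer of
  \<open>norm (V x)\<close> on the sphere; the first order condition says that \<open>V\<close> maps the orthogonal
  complement of \<open>x\<close> into that of \<open>V x\<close>. The left singular vector \<open>e\<close> is \<open>V x / s\<close>. For \<open>s = 0\<close>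
  this makes no sense, but then \<open>V\<close> is not surjective and any unit vector orthogonal to its range
  can be taken.\<close>

lemma contraction_singular_vector:
  fixes V :: "complex ^ 'n \<Rightarrow> complex ^ 'n"
  assumes V: "contraction V" and "isometric_part V \<noteq> UNIV"
  obtains x e s where "norm x = 1" "norm e = 1" "0 \<le> s" "s < 1" "V x = of_real s *s e"
    "\<And>y. cinner y x = 0 \<Longrightarrow> cinner (V y) e = 0"
proof -
  have lin: "linear V" using V by (rule contraction_linear)
  have "continuous_on (sphere 0 1) (\<lambda>x. norm (V x))"
    by (intro continuous_intros contraction_continuous_on[OF V])
  moreover have "sphere (0 :: complex ^ 'n) 1 \<noteq> {}" by simp
  ultimately obtain x where x: "norm x = 1" "\<And>y. norm y = 1 \<Longrightarrow> norm (V x) \<le> norm (V y)"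
    using continuous_attains_inf[OF compact_sphere, of 0 1 "\<lambda>x. norm (V x)"] by auto
  define s where "s = norm (V x)"
  have s_le: "s * norm y \<le> norm (V y)" for y
  proof (cases "y = 0")
    case False
    then have "s \<le> norm (V ((1 / norm y) *\<^sub>R y))"
      unfolding s_def by (intro x) simp
    then show ?thesis using False by (simp add: linear_scale[OF lin] field_simps)
  qed (simp add: linear_0[OF lin])
  obtain y where "norm (V y) < norm y"
    using assms contraction_norm_le[OF V] by (force simp: isometric_part_def less_le)
  with s_le[of y] have "s < 1"
    by (metis mult_le_cancel_right1 norm_ge_zero not_less order_trans)
  have "0 \<le> s" by (simp add: s_def)
  have orth: "V y \<bullet> V x = 0" if "y \<bullet> x = 0" for y
  proof -
    define b c where "b = V y \<bullet> V x" and "c = (norm (V y))\<^sup>2 - s\<^sup>2 * (norm y)\<^sup>2"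
    \<comment> \<open>Minimality of \<open>x\<close> along the line \<open>x + t y\<close>.\<close>
    have ineq: "0 \<le> 2 * t * b + t\<^sup>2 * c" for t
    proof -
      have "(s * norm (x + t *\<^sub>R y))\<^sup>2 \<le> (norm (V (x + t *\<^sub>R y)))\<^sup>2"
        using s_le \<open>0 \<le> s\<close> by (intro power_mono) auto
      moreover have "(norm (x + t *\<^sub>R y))\<^sup>2 = 1 + t\<^sup>2 * (norm y)\<^sup>2"
        using dot_norm[of x "t *\<^sub>R y"] that x(1) by (simp add: inner_commute power_mult_distrib)
      moreover have "(norm (V (x + t *\<^sub>R y)))\<^sup>2 = s\<^sup>2 + 2 * t * b + t\<^sup>2 * (norm (V y))\<^sup>2"
        using dot_norm[of "V x" "t *\<^sub>R V y"]
        by (simp add: linear_add[OF lin] linear_scale[OF lin] s_def b_def inner_commute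
          power_mult_distrib field_simps)
      ultimately show ?thesis by (simp add: c_def power_mult_distrib algebra_simps)
    qed
    have "b = 0"
    proof (rule ccontr)
      assume "b \<noteq> 0"
      define d where "d = 1 + \<bar>c\<bar>"
      have "d > 0" "c < d" by (auto simp: d_def)
      \<comment> \<open>A small step against the sign of \<open>b\<close> makes the linear term win over the quadratic one.\<close>
      have "0 \<le> 2 * (- b / d) * b + (- b / d)\<^sup>2 * c" by (rule ineq)
      also have "\<dots> = b\<^sup>2 / d * (c / d - 2)"
        using \<open>d > 0\<close> by (simp add: field_simps power2_eq_square)
      also have "\<dots> < 0"
        using \<open>d > 0\<close> \<open>c < d\<close> \<open>b \<noteq> 0\<close> by (intro mult_pos_neg) (auto simp: field_simps)
      finally show False by simp
    qed
    then show ?thesis by (simp add: b_def)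
  qed
  have corth: "cinner (V y) (V x) = 0" if "cinner y x = 0" for y
  proof (rule cinner_eq_0I)
    show "V y \<bullet> V x = 0" by (rule orth) (simp add: that flip: Re_cinner)
    show "(\<i> *s V y) \<bullet> V x = 0"
      unfolding contraction_smult[OF V, symmetric]
      by (rule orth) (simp add: that cinner_smult flip: Re_cinner)
  qed
  show thesis
  proof (cases "s = 0")
    case False
    define e where "e = of_real (1 / s) *s V x"
    show thesis
    proof (rule that[OF x(1) _ \<open>0 \<le> s\<close> \<open>s < 1\<close>])
      show "norm e = 1" using False \<open>0 \<le> s\<close> by (simp add: e_def norm_smult norm_divide s_def)
      show "V x = of_real s *s e" using False by (simp add: e_def vector_smult_assoc)
      show "cinner (V y) e = 0" if "cinner y x = 0" for y
        using corth[OF that] by (simp add: e_def cinner_smult_right)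
    qed
  next
    case True
    then have Vx: "V x = 0" by (simp add: s_def)
    have "\<not> inj V"
      using Vx x(1) linear_injective_0[OF lin] by force
    then have "\<not> surj V" using lin linear_surjective_imp_injective by blast
    have "dim (range V) < DIM(complex ^ 'n)"
    proof (rule ccontr)
      assume "\<not> dim (range V) < DIM(complex ^ 'n)"
      then have "dim (range V) = DIM(complex ^ 'n)" using dim_subset_UNIV[of "range V"] by linarith
      then have "span (range V) = UNIV" by (simp only: dim_eq_full)
      moreover have "span (range V) = range V"
        using linear_subspace_image[OF lin subspace_UNIV] by (rule span_eq_iff[THEN iffD2])
      ultimately show False using \<open>\<not> surj V\<close> by simp
    qed
    then obtain e0 where e0: "e0 \<noteq> 0" "\<And>y. y \<in> span (range V) \<Longrightarrow> orthogonal e0 y"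
      using orthogonal_to_subspace_exists by blast
    define e where "e = (1 / norm e0) *\<^sub>R e0"
    have e: "V y \<bullet> e = 0" for y
      using e0(2)[of "V y"] by (simp add: e_def orthogonal_def inner_commute span_base)
    show thesis
    proof (rule that[OF x(1) _ \<open>0 \<le> s\<close> \<open>s < 1\<close>])
      show "norm e = 1" using e0 by (simp add: e_def)
      show "V x = of_real s *s e" using Vx True by simp
      show "cinner (V y) e = 0" for y
        using e e[of "\<i> *s y"] by (intro cinner_eq_0I) (auto simp: contraction_smult[OF V])
    qed
  qed
qed

text \<open>This Moebius transformation of the closed disc moves the centre to \<open>s\<close>. With it the mean
  value property at the centre becomes an averaging formula for the value at \<open>s\<close>.\<close>

lemma moebius_disc:
  fixes l :: complex and s :: real
  assumes "0 \<le> s" "s < 1" "norm l \<le> 1"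
  shows "1 + s * l \<noteq> 0" "norm ((l + s) / (1 + s * l)) \<le> 1" "norm l = 1 \<Longrightarrow>
    norm ((l + s) / (1 + s * l)) = 1"
proof -
  have "norm (s * l) < 1" using assms
    by (simp add: norm_mult) (meson mult_left_le norm_ge_zero order_le_less_trans)
  then show nz: "1 + s * l \<noteq> 0"
    by (metis add_eq_0_iff norm_minus_cancel norm_one order_less_irrefl)
  have eq: "(norm (1 + s * l))\<^sup>2 - (norm (l + s))\<^sup>2 = (1 - s\<^sup>2) * (1 - (norm l)\<^sup>2)"
    unfolding cmod_power2 by (simp add: power2_eq_square algebra_simps)
  have "s\<^sup>2 \<le> 1" "(norm l)\<^sup>2 \<le> 1" using assms by (auto simp: power_le_one)
  then have "(norm (l + s))\<^sup>2 \<le> (norm (1 + s * l))\<^sup>2"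
    using eq mult_nonneg_nonneg[of "1 - s\<^sup>2" "1 - (norm l)\<^sup>2"] by linarith
  then have "norm (l + s) \<le> norm (1 + s * l)" by (simp add: power2_le_iff_abs_le)
  then show "norm ((l + s) / (1 + s * l)) \<le> 1"
    using nz by (simp add: norm_divide divide_le_eq)
  assume "norm l = 1"
  with eq have "(norm (l + s))\<^sup>2 = (norm (1 + s * l))\<^sup>2" by simp
  then have "norm (l + s) = norm (1 + s * l)" by simp
  then show "norm ((l + s) / (1 + s * l)) = 1"
    using nz by (simp add: norm_divide)
qed

text \<open>Let \<open>s < 1\<close> be the smallest singular value of \<open>V\<close>. Replacing it by a complex number \<open>l\<close>
  gives an analytic family \<open>W l\<close> of contractions, \<open>norm l \<le> 1\<close>, with \<open>W s = V\<close>. For \<open>norm l = 1\<close>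
  the isometric part of \<open>W l\<close> contains that of \<open>V\<close> and also the singular vector \<open>x\<close>, so the
  induction hypothesis applies on the boundary of the disc, and the value at \<open>s\<close> is an average of
  boundary values.\<close>

lemma sphere_norm_contraction:
  fixes h :: "complex ^ 'n \<Rightarrow> complex"
  assumes p: "1 \<le> p" and h: "holo h (ball 0 \<rho>)" and \<rho>: "\<rho> > 1" and V: "contraction V"
  shows "sphere_norm p (\<lambda>\<zeta>. h (V \<zeta>)) \<le> sphere_norm p h"
  using V
proof (induction "DIM(complex ^ 'n) - dim (isometric_part V)" arbitrary: V rule: less_induct)
  case less
  note V = \<open>contraction V\<close>
  have lin: "linear V" using V by (rule contraction_linear)
  have hV: "continuous_on (sphere 0 1) (\<lambda>\<zeta>. h (W \<zeta>))" if "contraction W" for W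
    using \<rho> by (intro continuous_on_compose2[OF holo_continuous_on[OF h]]
      contraction_continuous_on[OF that] continuous_on_id)
      (auto intro!: order_le_less_trans[OF contraction_norm_le[OF that]])
  show ?case
  proof (cases "isometric_part V = UNIV")
    case True
    then have iso: "norm (V x) = norm x" for x by (auto simp: isometric_part_def)
    have "continuous_on (sphere 0 1) h"
      using \<rho> by (intro continuous_on_subset[OF holo_continuous_on[OF h]]) auto
    then show ?thesis by (intro sphere_norm_isometry p lin iso)
  next
    case False
    then obtain x e s where x: "norm x = 1" and e: "norm e = 1" and s: "0 \<le> s" "s < 1"
      and Vx: "V x = of_real s *s e" and orth: "\<And>y. cinner y x = 0 \<Longrightarrow> cinner (V y) e = 0"
      using contraction_singular_vector[OF V] by metis
    \<comment> \<open>The singular value \<open>s\<close> belonging to \<open>x\<close> is replaced by \<open>l\<close>.\<close>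
    define W where "W = (\<lambda>l z. V z + ((l - of_real s) * cinner z x) *s e)"
    \<comment> \<open>The component of a vector orthogonal to \<open>x\<close>, on which all \<open>W l\<close> agree with \<open>V\<close>.\<close>
    define y where "y = (\<lambda>z. z - cinner z x *s x)"
    have y: "cinner (y z) x = 0" for z
      using x by (simp add: y_def cinner_diff cinner_smult cinner_self)
    have z: "(norm z)\<^sup>2 = (norm (cinner z x))\<^sup>2 + (norm (y z))\<^sup>2" for z
    proof -
      have "z = y z + cinner z x *s x" by (simp add: y_def)
      then have "(norm z)\<^sup>2 = (norm (y z + cinner z x *s x))\<^sup>2" by simp
      also have "\<dots> = (norm (y z))\<^sup>2 + (norm (cinner z x *s x))\<^sup>2"
        by (rule norm_add_orthogonal) (simp add: cinner_smult_right y)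
      finally show ?thesis using x by (simp add: norm_smult)
    qed
    have Wz: "(norm (W l z))\<^sup>2 = (norm (l * cinner z x))\<^sup>2 + (norm (V (y z)))\<^sup>2" for l z
    proof -
      have "V z = V (y z + cinner z x *s x)" by (simp add: y_def)
      also have "\<dots> = V (y z) + (cinner z x * of_real s) *s e"
        by (simp add: contraction_add[OF V] contraction_smult[OF V] Vx vector_smult_assoc)
      finally have "W l z = V (y z) + (l * cinner z x) *s e"
        by (simp add: W_def vec_eq_iff algebra_simps)
      then have "(norm (W l z))\<^sup>2 = (norm (V (y z)))\<^sup>2 + (norm ((l * cinner z x) *s e))\<^sup>2"
        by (simp add: norm_add_orthogonal cinner_smult_right orth[OF y])
      then show ?thesis using e by (simp add: norm_smult)
    qed
    have Ws: "W (of_real s) = V" by (simp add: W_def)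
    have Vy: "(norm (V (y z)))\<^sup>2 \<le> (norm (y z))\<^sup>2" for z
      by (intro power_mono contraction_norm_le V) simp
    have Wc: "contraction (W l)" if "norm l \<le> 1" for l
    proof (rule contractionI)
      show "W l (z + w) = W l z + W l w" for z w
        by (simp add: W_def contraction_add[OF V] cinner_add vec_eq_iff algebra_simps)
      show "W l (c *s z) = c *s W l z" for c z
        by (simp add: W_def contraction_smult[OF V] cinner_smult vec_eq_iff algebra_simps)
      fix z
      have "(norm (l * cinner z x))\<^sup>2 \<le> (norm (cinner z x))\<^sup>2"
        using that by (intro power_mono) (auto simp: norm_mult intro: mult_left_le_one_le)
      then have "(norm (W l z))\<^sup>2 \<le> (norm z)\<^sup>2"
        using Wz[of l z] z[of z] Vy[of z] by linarith
      then show "norm (W l z) \<le> norm z" by (simp add: power2_le_iff_abs_le)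
    qed
    have IH: "sphere_norm p (\<lambda>\<zeta>. h (W l \<zeta>)) \<le> sphere_norm p h" if l: "norm l = 1" for l
    proof (rule less.hyps)
      show W: "contraction (W l)" using l by (simp add: Wc)
      have "isometric_part V \<subseteq> isometric_part (W l)"
      proof
        fix z assume "z \<in> isometric_part V"
        then have *: "(norm (W (of_real s) z))\<^sup>2 = (norm z)\<^sup>2" by (simp add: Ws isometric_part_def)
        have "(1 - s\<^sup>2) * (norm (cinner z x))\<^sup>2 \<le> 0"
        proof -
          have "(norm (W (of_real s) z))\<^sup>2 = s\<^sup>2 * (norm (cinner z x))\<^sup>2 + (norm (V (y z)))\<^sup>2"
            unfolding Wz by (simp add: norm_mult power_mult_distrib)
          then show ?thesis
            using * z[of z] Vy[of z] by (simp only: left_diff_distrib mult_1_left)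
        qed
        moreover have "1 - s\<^sup>2 > 0" using s by (simp add: power_less_one_iff abs_square_less_1)
        ultimately have "cinner z x = 0" by (simp add: mult_le_0_iff)
        then show "z \<in> isometric_part (W l)"
          using \<open>z \<in> isometric_part V\<close> by (simp add: isometric_part_def W_def)
      qed
      moreover have "x \<notin> isometric_part V"
        using Vx s x e by (simp add: isometric_part_def norm_smult)
      moreover have "x \<in> isometric_part (W l)"
      proof -
        have "W l x = l *s e"
          using x by (simp add: W_def Vx cinner_self vec_eq_iff algebra_simps)
        then show ?thesis using l x e by (simp add: isometric_part_def norm_smult)
      qed
      ultimately have "span (isometric_part V) \<subset> span (isometric_part (W l))"
        using subspace_isometric_part[OF V] subspace_isometric_part[OF W]
        by (metis psubsetI span_eq_iff)
      then have "dim (isometric_part V) < dim (isometric_part (W l))" by (rule dim_psubset)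
      moreover have "dim (isometric_part (W l)) \<le> DIM(complex ^ 'n)" by (rule dim_subset_UNIV)
      ultimately show "DIM(complex ^ 'n) - dim (isometric_part (W l)) < DIM(complex ^ 'n)
        - dim (isometric_part V)"
        by linarith
    qed
    define m :: "complex \<Rightarrow> complex" where "m = (\<lambda>l. (l + of_real s) / (1 + of_real s * l))"
    have m: "1 + of_real s * l \<noteq> 0" "norm (m l) \<le> 1" "norm l = 1 \<Longrightarrow> norm (m l) = 1" if "norm l \<le> 1"
      for l
      using moebius_disc[OF s that] by (auto simp: m_def)
    have Wball: "W l \<zeta> \<in> ball 0 \<rho>" if "norm \<zeta> = 1" "norm l \<le> 1" for l \<zeta>
      using contraction_norm_le[OF Wc[OF that(2)], of \<zeta>] that(1) \<rho> by simp
    have m_hol: "m holomorphic_on cball 0 1"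
      unfolding m_def using m(1) by (intro holomorphic_intros) auto
    have unit: "norm (m (unit_circle t)) = 1" for t by (rule m(3)) simp_all
    show ?thesis
    proof (rule sphere_norm_average[OF p hV[OF V], where G="\<lambda>t \<zeta>. h (W (m (unit_circle t)) \<zeta>)"])
      have "continuous_on ({0..1} \<times> sphere 0 1) (\<lambda>x. h (W (m (unit_circle (fst x))) (snd x)))"
        unfolding W_def
      proof (rule continuous_on_compose2[OF holo_continuous_on[OF h]])
        show "continuous_on ({0..1::real} \<times> sphere (0::complex ^ 'n) 1)
          (\<lambda>a. V (snd a) + ((m (unit_circle (fst a)) - complex_of_real s) * cinner (snd a) x) *s e)"
          by (intro continuous_intros contraction_continuous_on[OF V] continuous_on_compose2[OF
            holomorphic_on_imp_continuous_on[OF m_hol]]) auto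
        show "(\<lambda>a. V (snd a) + ((m (unit_circle (fst a)) - complex_of_real s) * cinner (snd a) x) *s
          e) `
            ({0..1::real} \<times> sphere 0 1) \<subseteq> ball 0 \<rho>"
          using Wball unit unfolding W_def by fastforce
      qed
      then show "continuous_on ({0..1} \<times> sphere 0 1) (\<lambda>(t, \<zeta>). h (W (m (unit_circle t)) \<zeta>))"
        by (simp add: split_beta)
      show "sphere_norm p (\<lambda>\<zeta>. h (W (m (unit_circle t)) \<zeta>)) \<le> sphere_norm p h" for t
        by (rule IH) (rule unit)
      fix \<zeta> :: "complex ^ 'n" assume \<zeta>: "norm \<zeta> = 1"
      define g where "g = (\<lambda>l. h ((V \<zeta> - (of_real s * cinner \<zeta> x) *s e) + l *s (cinner \<zeta> x *s e)))"
      have g: "g l = h (W l \<zeta>)" for l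
        by (simp add: g_def W_def vec_eq_iff algebra_simps)
      have "(V \<zeta> - (of_real s * cinner \<zeta> x) *s e) + l *s (cinner \<zeta> x *s e) = W l \<zeta>" for l
        by (simp add: W_def vec_eq_iff algebra_simps)
      then have "g holomorphic_on cball 0 1"
        unfolding g_def using Wball[OF \<zeta>] by (intro holo_holomorphic_on_line[OF h]) simp
      then have "(\<lambda>l. g (m l)) holomorphic_on cball 0 1"
        using holomorphic_on_compose_gen[OF m_hol, of g "cball 0 1"] m(2)
        by (auto simp: o_def image_subset_iff)
      then have "((\<lambda>t. g (m (unit_circle t)) / unit_circle t ^ 0) has_integral (deriv ^^ 0)
        (\<lambda>l. g (m l)) 0 / fact 0) {0..1}"
        by (intro has_integral_unit_circle holomorphic_on_imp_continuous_on)
           (auto elim: holomorphic_on_subset)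
      then show "((\<lambda>t. h (W (m (unit_circle t)) \<zeta>)) has_integral h (V \<zeta>)) {0..1}"
        by (simp add: g m_def Ws)
    qed
  qed
qed

section \<open>Derivatives controlled by the radial derivative\<close>

lemma has_vector_derivative_unit_circle:
  "(unit_circle has_vector_derivative (2 * pi * \<i> * unit_circle t)) (at t within A)"
proof -
  have "((\<lambda>z. exp (2 * pi * \<i> * z)) has_field_derivative 2 * pi * \<i> * exp (2 * pi * \<i> * of_real t))
    (at (of_real t))"
    by (auto intro!: derivative_eq_intros)
  from has_vector_derivative_real_field[OF this]
  have "(unit_circle has_vector_derivative (2 * pi * \<i> * unit_circle t)) (at t)"
    by (simp add: unit_circle_def[abs_def] cis_conv_exp mult_ac)
  then show ?thesis by (rule has_vector_derivative_at_within)
qed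

text \<open>Integration by parts on the circle through \<open>\<zeta>\<close>: since \<open>h\<close> has mean value \<open>h 0 = 0\<close> there,
  the integral of \<open>(t - 1/2)\<close> against the derivative of \<open>t \<mapsto> h (e\<^sup>2\<^sup>\<pi>\<^sup>i\<^sup>t \<zeta>)\<close> reduces to the
  boundary term \<open>h \<zeta>\<close>. The derivative is \<open>2 \<pi> i\<close> times a rotation of \<open>euler h\<close>, and
  \<open>2 \<pi> * \<bar>t - 1/2\<bar> \<le> \<pi>\<close>.\<close>

lemma sphere_norm_euler:
  fixes h :: "complex ^ 'n \<Rightarrow> complex"
  assumes p: "1 \<le> p" and h: "holo h (ball 0 \<rho>)" and \<rho>: "\<rho> > 1" and h0: "h 0 = 0"
  shows "sphere_norm p h \<le> pi * sphere_norm p (euler h)"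
proof -
  have S: "unit_circle t *s \<zeta> \<in> ball 0 \<rho>" if "norm \<zeta> = 1" for t \<zeta>
    using that \<rho> by (simp add: norm_smult)
  have ch: "continuous_on (sphere 0 1) h"
    using \<rho> by (intro continuous_on_subset[OF holo_continuous_on[OF h]]) auto
  have e: "holo (euler h) (ball 0 \<rho>)" by (rule holo_euler[OF h open_ball])
  have ce: "continuous_on (sphere 0 1) (euler h)"
    using \<rho> by (intro continuous_on_subset[OF holo_continuous_on[OF e]]) auto
  have cont: "continuous_on ({0..1} \<times> sphere 0 1) (\<lambda>(t, \<zeta>). of_real (t - 1/2) * (2 * pi * \<i>) *
    euler h (unit_circle t *s \<zeta>))"
    unfolding split_beta
    by (intro continuous_intros continuous_on_compose2[OF holo_continuous_on[OF e]]) (use S in auto)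
  show ?thesis
  proof (rule sphere_norm_average[OF p ch cont])
    fix t :: real assume t: "t \<in> {0..1}"
    have rot: "continuous_on (sphere 0 1) (\<lambda>\<zeta>. euler h (unit_circle t *s \<zeta>))"
      by (intro continuous_intros continuous_on_compose2[OF holo_continuous_on[OF e]])
        (use S in auto)
    have "sphere_norm p (\<lambda>\<zeta>. of_real (t - 1/2) * (2 * pi * \<i>) * euler h (unit_circle t *s \<zeta>))
        \<le> pi * sphere_norm p (\<lambda>\<zeta>. euler h (unit_circle t *s \<zeta>))"
    proof (rule sphere_norm_mono[OF p _ rot])
      show "continuous_on (sphere 0 1) (\<lambda>\<zeta>. of_real (t - 1/2) * (2 * pi * \<i>) * euler h (unit_circle
        t *s \<zeta>))"
        by (intro continuous_intros rot)
      have "\<bar>t - 1/2\<bar> * 2 \<le> 1" using t by (auto simp: abs_if)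
      then have "(\<bar>t - 1/2\<bar> * 2) * pi \<le> 1 * pi" by (intro mult_right_mono) auto
      then have "norm (of_real (t - 1/2) * (2 * pi * \<i>)) \<le> pi"
        unfolding norm_mult norm_of_real by (simp add: mult_ac)
      then show "norm (of_real (t - 1/2) * (2 * pi * \<i>) * euler h (unit_circle t *s \<zeta>))
        \<le> pi * norm (euler h (unit_circle t *s \<zeta>))" for \<zeta>
        by (subst norm_mult) (intro mult_right_mono, auto)
    qed simp
    also have "sphere_norm p (\<lambda>\<zeta>. euler h (unit_circle t *s \<zeta>)) \<le> sphere_norm p (euler h)"
      by (rule sphere_norm_isometry[OF p ce])
         (auto simp: norm_smult linear_conv_bounded_linear bounded_linear_smult_right)
    finally show "sphere_norm p (\<lambda>\<zeta>. of_real (t - 1/2) * (2 * pi * \<i>) * euler h (unit_circle t *s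
      \<zeta>)) \<le> pi * sphere_norm p (euler h)"
      by simp
  next
    fix \<zeta> :: "complex ^ 'n" assume \<zeta>: "norm \<zeta> = 1"
    have "(\<lambda>l. h (0 + l *s \<zeta>)) holomorphic_on cball 0 1"
      using \<zeta> \<rho> by (intro holo_holomorphic_on_line[OF h]) (auto simp: norm_smult)
    then have "((\<lambda>t. h (0 + unit_circle t *s \<zeta>) / unit_circle t ^ 0) has_integral (deriv ^^ 0)
      (\<lambda>l. h (0 + l *s \<zeta>)) 0 / fact 0) {0..1}"
      by (intro has_integral_unit_circle holomorphic_on_imp_continuous_on) (auto elim:
        holomorphic_on_subset)
    then have mean: "((\<lambda>t. h (unit_circle t *s \<zeta>)) has_integral 0) {0..1}"
      by (simp add: h0)
    have D: "((\<lambda>t. of_real (t - 1/2) * h (unit_circle t *s \<zeta>)) has_vector_derivative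
        of_real (t - 1/2) * (2 * pi * \<i> * euler h (unit_circle t *s \<zeta>)) + 1 * h (unit_circle t *s
          \<zeta>)) (at t within {0..1})" for t
    proof (rule has_vector_derivative_mult)
      show "((\<lambda>t. of_real (t - 1/2)) has_vector_derivative (1::complex)) (at t within {0..1})"
      proof -
        have "((\<lambda>z. z - 1/2) has_field_derivative (1::complex)) (at (of_real t))"
          by (auto intro!: derivative_eq_intros)
        from has_vector_derivative_real_field[OF this] show ?thesis
          by (auto intro: has_vector_derivative_at_within)
      qed
      have "((\<lambda>l. h (0 + l *s \<zeta>)) has_field_derivative cderiv h (0 + unit_circle t *s \<zeta>) \<zeta>)
        (at (unit_circle t))"
        by (rule holo_DERIV_line[OF h]) (use S[OF \<zeta>] in simp)
      then have "((\<lambda>l. h (l *s \<zeta>)) has_field_derivative cderiv h (unit_circle t *s \<zeta>) \<zeta>)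
        (at (unit_circle t))"
        by simp
      from field_vector_diff_chain_within[OF has_vector_derivative_unit_circle
        has_field_derivative_at_within[OF this]]
      show "((\<lambda>t. h (unit_circle t *s \<zeta>)) has_vector_derivative 2 * pi * \<i> * euler h (unit_circle
        t *s \<zeta>)) (at t within {0..1})"
        using S[OF \<zeta>] by (simp add: o_def euler_def cderiv_smult[OF h] mult_ac)
    qed
    have "((\<lambda>t. of_real (t - 1/2) * (2 * pi * \<i> * euler h (unit_circle t *s \<zeta>)) + 1 * h (unit_circle
      t *s \<zeta>)) has_integral
       (of_real (1 - 1/2) * h (unit_circle 1 *s \<zeta>) - of_real (0 - 1/2) * h (unit_circle 0 *s \<zeta>)))
         {0..1}"
      by (rule fundamental_theorem_of_calculus) (use D in auto)
    then have "((\<lambda>t. of_real (t - 1/2) * (2 * pi * \<i> * euler h (unit_circle t *s \<zeta>))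
      + h (unit_circle t *s \<zeta>)) has_integral h \<zeta>) {0..1}"
      by (simp add: unit_circle_def)
    from has_integral_diff[OF this mean]
    show "((\<lambda>t. of_real (t - 1/2) * (2 * pi * \<i>) * euler h (unit_circle t *s \<zeta>)) has_integral h \<zeta>)
      {0..1}"
      by (simp add: algebra_simps)
  qed
qed

lemma norm_squared_vec: "(norm (z :: complex ^ 'n))\<^sup>2 = (\<Sum>k\<in>UNIV. (norm (z $ k))\<^sup>2)"
  by (simp add: norm_vec_def L2_set_def sum_nonneg)

text \<open>A conjugate linear vector field with an antisymmetric matrix. Antisymmetry makes it
  orthogonal to \<open>z\<close> for the Hermitian inner product, which no nonzero complex linear field can be
  for all \<open>z\<close>.\<close>

definition tangent :: "'n \<Rightarrow> 'n \<Rightarrow> complex ^ 'n \<Rightarrow> complex ^ 'n" where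
  "tangent i j z = cnj (z $ j) *s axis i 1 - cnj (z $ i) *s axis j 1"

text \<open>In the coordinates \<open>i\<close>, \<open>j\<close> this is multiplication by a quaternion with squared norm
  \<open>s\<^sup>2 + (norm w)\<^sup>2\<close>; the other coordinates are fixed.\<close>

definition quaternion :: "'n \<Rightarrow> 'n \<Rightarrow> real \<Rightarrow> complex \<Rightarrow> complex ^ 'n \<Rightarrow> complex ^ 'n" where
  "quaternion i j s w z = (\<chi> k. if k = i then s * z $ i + w * cnj (z $ j)
     else if k = j then s * z $ j - w * cnj (z $ i) else z $ k)"

text \<open>The factor \<open>s\<close> on the coordinates that \<open>quaternion\<close> leaves alone.\<close>

definition shrink :: "'n \<Rightarrow> 'n \<Rightarrow> real \<Rightarrow> complex ^ 'n \<Rightarrow> complex ^ 'n" where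
  "shrink i j s z = (\<chi> k. if k = i \<or> k = j then z $ k else s * z $ k)"

text \<open>This factorization is the reason for the two definitions above: the diagonal factor is
  complex linear, the other one is a real isometry when \<open>s\<^sup>2 + (norm w)\<^sup>2 = 1\<close>.\<close>

lemma shrink_quaternion:
  "i \<noteq> j \<Longrightarrow> shrink i j s (quaternion i j s w z) = of_real s *s z + w *s tangent i j z"
  by (auto simp: vec_eq_iff shrink_def quaternion_def tangent_def axis_def)

lemma norm_quaternion:
  assumes "i \<noteq> j"
  shows "(norm (quaternion i j s w z))\<^sup>2 =
    (norm z)\<^sup>2 + (s\<^sup>2 + (norm w)\<^sup>2 - 1) * ((norm (z $ i))\<^sup>2 + (norm (z $ j))\<^sup>2)"
proof -
  let ?Q = "quaternion i j s w z"
  have *: "(norm (s * a + w * cnj b))\<^sup>2 + (norm (s * b - w * cnj a))\<^sup>2 = (s\<^sup>2 + (norm w)\<^sup>2) *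
    ((norm a)\<^sup>2 + (norm b)\<^sup>2)" for a b :: complex
    unfolding cmod_power2 by (simp add: power2_eq_square algebra_simps)
  have "(norm ?Q)\<^sup>2 - (norm z)\<^sup>2 = (\<Sum>k\<in>UNIV. (norm (?Q $ k))\<^sup>2 - (norm (z $ k))\<^sup>2)"
    by (simp add: norm_squared_vec sum_subtractf)
  also have "\<dots> = (\<Sum>k\<in>{i, j}. (norm (?Q $ k))\<^sup>2 - (norm (z $ k))\<^sup>2)"
    by (rule sum.mono_neutral_right) (auto simp: quaternion_def)
  also have "\<dots> = (s\<^sup>2 + (norm w)\<^sup>2 - 1) * ((norm (z $ i))\<^sup>2 + (norm (z $ j))\<^sup>2)"
    using assms *[of "z $ i" "z $ j"] by (simp add: quaternion_def left_diff_distrib)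
  finally show ?thesis by linarith
qed

lemma contraction_shrink:
  assumes "0 \<le> s" "s \<le> 1"
  shows "contraction (shrink i j s)"
proof (rule contractionI)
  show "shrink i j s (x + y) = shrink i j s x + shrink i j s y" for x y
    by (simp add: shrink_def vec_eq_iff algebra_simps)
  show "shrink i j s (c *s x) = c *s shrink i j s x" for c x
    by (simp add: shrink_def vec_eq_iff algebra_simps)
  show "norm (shrink i j s x) \<le> norm x" for x
    using assms by (intro norm_le_componentwise_cart) (auto simp: shrink_def norm_mult intro:
      mult_left_le_one_le)
qed

lemma norm_tangent_disc:
  assumes "i \<noteq> j" "0 \<le> s" "s\<^sup>2 + (norm w)\<^sup>2 \<le> 1"
  shows "norm (of_real s *s z + w *s tangent i j z) \<le> norm z"
proof -
  have "s\<^sup>2 \<le> 1" using assms by (smt (verit) zero_le_power2)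
  then have "s \<le> 1" using assms by (simp add: power2_le_iff_abs_le abs_square_le_1)
  have "(s\<^sup>2 + (norm w)\<^sup>2 - 1) * ((norm (z $ i))\<^sup>2 + (norm (z $ j))\<^sup>2) \<le> 0"
    using assms by (intro mult_nonpos_nonneg) auto
  then have "(norm (quaternion i j s w z))\<^sup>2 \<le> (norm z)\<^sup>2"
    using norm_quaternion[OF assms(1), of s w z] by linarith
  then have "norm (quaternion i j s w z) \<le> norm z" by (simp add: power2_le_iff_abs_le)
  then show ?thesis
    using contraction_norm_le[OF contraction_shrink[OF assms(2) \<open>s \<le> 1\<close>], of i j "quaternion
      i j s w z"]
    by (simp add: shrink_quaternion[OF assms(1)])
qed

lemma linear_quaternion: "linear (quaternion i j s w)"
  by (rule linearI) (simp_all add: quaternion_def vec_eq_iff algebra_simps scaleR_conv_of_real[where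
    'a=complex])

text \<open>The map \<open>\<zeta> \<mapsto> s \<zeta> + w A \<zeta>\<close> is not complex linear, so \<open>sphere_norm_contraction\<close> does not apply
  to it directly. It applies to the diagonal factor, and the isometry in front does not change the
  norm.\<close>

lemma sphere_norm_tangent_rotation:
  fixes h :: "complex ^ 'n \<Rightarrow> complex"
  assumes p: "1 \<le> p" and h: "holo h (ball 0 \<rho>)" and \<rho>: "\<rho> > 1"
    and ij: "i \<noteq> j" and s: "0 \<le> s" "s\<^sup>2 + (norm w)\<^sup>2 = 1"
  shows "sphere_norm p (\<lambda>\<zeta>. h (of_real s *s \<zeta> + w *s tangent i j \<zeta>)) \<le> sphere_norm p h"
proof -
  have "s\<^sup>2 \<le> 1" using s by (smt (verit) zero_le_power2)
  then have "s \<le> 1" using s by (simp add: abs_square_le_1)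
  have D: "contraction (shrink i j s)" by (rule contraction_shrink) fact+
  have c: "continuous_on (sphere 0 1) (\<lambda>\<zeta>. h (shrink i j s \<zeta>))"
    using \<rho> by (intro continuous_on_compose2[OF holo_continuous_on[OF h]]
      contraction_continuous_on[OF D] continuous_on_id)
      (auto intro!: order_le_less_trans[OF contraction_norm_le[OF D]])
  have "sphere_norm p (\<lambda>\<zeta>. h (shrink i j s (quaternion i j s w \<zeta>))) \<le> sphere_norm p (\<lambda>\<zeta>. h (shrink
    i j s \<zeta>))"
  proof (rule sphere_norm_isometry[OF p c linear_quaternion])
    show "norm (quaternion i j s w x) = norm x" for x
      using norm_quaternion[OF ij, of s w x] s by simp
  qed
  also have "\<dots> \<le> sphere_norm p h"
    by (rule sphere_norm_contraction[OF p h \<rho> D])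
  finally show ?thesis by (simp add: shrink_quaternion[OF ij])
qed

lemma continuous_on_tangent: "continuous_on A f \<Longrightarrow> continuous_on A (\<lambda>x. tangent i j (f x))"
  unfolding tangent_def by (intro continuous_intros)

lemma has_vector_derivative_sin_arc:
  "((\<lambda>u. complex_of_real (sin (pi / 2 * u))) has_vector_derivative complex_of_real (pi / 2 * cos (pi
    / 2 * u))) (at u within A)"
proof -
  have "((\<lambda>z. sin (pi / 2 * z)) has_field_derivative of_real (pi / 2) * cos (of_real (pi / 2) *
    of_real u)) (at (complex_of_real u))"
    by (auto intro!: derivative_eq_intros)
  from has_vector_derivative_real_field[OF this]
  have "((\<lambda>u. complex_of_real (sin (pi / 2 * u))) has_vector_derivative complex_of_real (pi / 2 *
    cos (pi / 2 * u))) (at u)"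
    by (simp add: sin_of_real cos_of_real flip: of_real_mult of_real_divide)
  then show ?thesis by (rule has_vector_derivative_at_within)
qed

text \<open>With \<open>h = euler g\<close> and \<open>v = tangent i j \<zeta>\<close>, the function \<open>l \<mapsto> l * cderiv g (l \<zeta>) v\<close> has
  derivative \<open>cderiv h (l \<zeta>) v\<close> by \<open>cderiv_euler\<close>. Integrating from \<open>0\<close> to \<open>1\<close> along
  \<open>l = sin (\<pi> / 2 * u)\<close> expresses \<open>cderiv g \<zeta> v\<close> by derivatives of \<open>h\<close>, and the substitution
  supplies the factor \<open>cos (\<pi> / 2 * u)\<close> that is needed for Cauchy's estimate on the disc of radius
  \<open>cos (\<pi> / 2 * u)\<close> in direction \<open>v\<close>.\<close>

lemma sphere_norm_tangential_derivative:
  fixes g :: "complex ^ 'n \<Rightarrow> complex"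
  assumes p: "1 \<le> p" and g: "holo g (ball 0 \<rho>)" and \<rho>: "\<rho> > 1" and ij: "i \<noteq> j"
  shows "sphere_norm p (\<lambda>\<zeta>. cderiv g \<zeta> (tangent i j \<zeta>)) \<le> pi / 2 * sphere_norm p (euler g)"
proof -
  define h where "h = euler g"
  have h: "holo h (ball 0 \<rho>)" unfolding h_def by (rule holo_euler[OF g open_ball])
  define s where "s = (\<lambda>u. sin (pi / 2 * u))"
  define c where "c = (\<lambda>u. cos (pi / 2 * u))"
  have s: "0 \<le> s u" "s u \<le> 1" if "u \<in> {0..1}" for u
    using that by (auto simp: s_def intro!: sin_ge_zero mult_left_le)
  have sc: "(s u)\<^sup>2 + (c u)\<^sup>2 = 1" for u by (simp add: s_def c_def)
  have sS: "of_real (s u) *s \<zeta> \<in> ball 0 \<rho>" if "u \<in> {0..1}" "norm \<zeta> = 1" for u and \<zeta> :: "complex ^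
    'n"
    using s[OF that(1)] that(2) \<rho> by (simp add: norm_smult)
  have disc: "of_real (s u) *s \<zeta> + (l * of_real (c u)) *s tangent i j \<zeta> \<in> ball 0 \<rho>"
    if "u \<in> {0..1}" "norm \<zeta> = 1" "norm l \<le> 1" for u l and \<zeta> :: "complex ^ 'n"
  proof -
    have "(norm (l * of_real (c u)))\<^sup>2 \<le> (c u)\<^sup>2"
      using that(3) by (simp add: norm_mult power_mult_distrib mult_left_le_one_le power_le_one)
    then have "norm (of_real (s u) *s \<zeta> + (l * of_real (c u)) *s tangent i j \<zeta>) \<le> norm \<zeta>"
      using sc[of u] s(1)[OF that(1)] by (intro norm_tangent_disc ij) auto
    then show ?thesis using that \<rho> by simp
  qed
  have cs: "continuous_on A s" "continuous_on A c" for A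
    unfolding s_def c_def by (intro continuous_intros)+
  define G where "G = (\<lambda>u \<zeta>. of_real (pi / 2 * c u) * cderiv h (of_real (s u) *s \<zeta>) (tangent
    i j \<zeta>))"
  have Gu: "continuous_on (sphere 0 1) (G u)" if "u \<in> {0..1}" for u
    unfolding G_def using sS[OF that]
    by (intro continuous_intros continuous_on_cderiv[OF h open_ball] continuous_on_tangent) auto
  show ?thesis
  proof (rule sphere_norm_average[OF p, where G=G])
    show "continuous_on (sphere 0 1) (\<lambda>\<zeta>. cderiv g \<zeta> (tangent i j \<zeta>))"
      by (intro continuous_intros continuous_on_cderiv[OF g open_ball] continuous_on_tangent) (use \<rho>
        in auto)
    show "continuous_on ({0..1} \<times> sphere 0 1) (\<lambda>(u, \<zeta>). G u \<zeta>)"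
      unfolding G_def split_beta
      by (intro continuous_intros continuous_on_cderiv[OF h open_ball] continuous_on_tangent
          continuous_on_compose2[OF cs(1)] continuous_on_compose2[OF cs(2)])
         (use sS in auto)
  next
    fix u :: real assume u: "u \<in> {0..1}"
    show "sphere_norm p (G u) \<le> pi / 2 * sphere_norm p (euler g)"
    proof (rule sphere_norm_average[OF p Gu[OF u]])
      let ?H = "\<lambda>t \<zeta>. h (of_real (s u) *s \<zeta> + (unit_circle t * of_real (c u)) *s tangent i j \<zeta>)"
      have cH: "continuous_on ({0..1} \<times> sphere 0 1) (\<lambda>x. ?H (fst x) (snd x))"
        by (intro continuous_intros continuous_on_tangent continuous_on_compose2[OF
          holo_continuous_on[OF h]])
           (use disc[OF u] in auto)
      show "continuous_on ({0..1} \<times> sphere 0 1) (\<lambda>(t, \<zeta>). of_real (pi / 2) * (?H t \<zeta> /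
        unit_circle t ^ 1))"
        unfolding split_beta by (intro continuous_intros cH) auto
      have Ht: "continuous_on (sphere 0 1) (?H t)" for t
        by (intro continuous_intros continuous_on_tangent continuous_on_compose2[OF
          holo_continuous_on[OF h]])
           (use disc[OF u] in auto)
      fix t :: real
      have "sphere_norm p (\<lambda>\<zeta>. of_real (pi / 2) * (?H t \<zeta> / unit_circle t ^ 1))
        \<le> pi / 2 * sphere_norm p (?H t)"
        by (intro sphere_norm_mono p Ht continuous_intros) (auto simp: norm_mult norm_divide)
      also have "sphere_norm p (?H t) \<le> sphere_norm p h"
        by (rule sphere_norm_tangent_rotation[OF p h \<rho> ij]) (use s[OF u] sc[of u] in \<open>auto simp:
          norm_mult\<close>)
      finally show "sphere_norm p (\<lambda>\<zeta>. of_real (pi / 2) * (?H t \<zeta> / unit_circle t ^ 1))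
        \<le> pi / 2 * sphere_norm p (euler g)"
        by (simp add: h_def)
    next
      fix \<zeta> :: "complex ^ 'n" assume \<zeta>: "norm \<zeta> = 1"
      define \<phi> where "\<phi> = (\<lambda>l. h (of_real (s u) *s \<zeta> + l *s (of_real (c u) *s tangent i j \<zeta>)))"
      have "\<phi> holomorphic_on cball 0 1"
        unfolding \<phi>_def using disc[OF u \<zeta>]
        by (intro holo_holomorphic_on_line[OF h]) (auto simp: vector_smult_assoc)
      then have "((\<lambda>t. \<phi> (unit_circle t) / unit_circle t ^ 1) has_integral (deriv ^^ 1) \<phi> 0 /
        fact 1) {0..1}"
        by (intro has_integral_unit_circle holomorphic_on_imp_continuous_on) (auto elim:
          holomorphic_on_subset)
      moreover have "(deriv ^^ 1) \<phi> 0 = of_real (c u) * cderiv h (of_real (s u) *s \<zeta>) (tangent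
        i j \<zeta>)"
        using cderiv_smult[OF h sS[OF u \<zeta>]] by (simp add: \<phi>_def cderiv_def)
      ultimately have "((\<lambda>t. of_real (pi / 2) * (\<phi> (unit_circle t) / unit_circle t ^ 1))
        has_integral
          of_real (pi / 2) * (of_real (c u) * cderiv h (of_real (s u) *s \<zeta>) (tangent i j \<zeta>)))
            {0..1}"
        by (intro has_integral_mult_right) simp
      then show "((\<lambda>t. of_real (pi / 2) * (h (of_real (s u) *s \<zeta> + (unit_circle t * of_real (c u))
        *s tangent i j \<zeta>) / unit_circle t ^ 1)) has_integral G u \<zeta>) {0..1}"
        by (simp add: \<phi>_def G_def vector_smult_assoc mult.assoc)
    qed
  next
    fix \<zeta> :: "complex ^ 'n" assume \<zeta>: "norm \<zeta> = 1"
    define v where "v = tangent i j \<zeta>"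
    define k where "k = (\<lambda>l. l * cderiv g (0 + l *s \<zeta>) v)"
    have gv: "holo (\<lambda>z. cderiv g z v) (ball 0 \<rho>)" by (rule holo_cderiv[OF g open_ball])
    have D: "((\<lambda>u. k (of_real (s u))) has_vector_derivative G u \<zeta>) (at u within {0..1})" if u: "u
      \<in> {0..1}" for u
    proof -
      let ?z = "of_real (s u) *s \<zeta>"
      have "((\<lambda>l. cderiv g (0 + l *s \<zeta>) v) has_field_derivative cderiv (\<lambda>z. cderiv g z v) (0
        + of_real (s u) *s \<zeta>) \<zeta>) (at (of_real (s u)))"
        by (rule holo_DERIV_line[OF gv]) (use sS[OF u \<zeta>] in simp)
      then have "(k has_field_derivative cderiv g ?z v + of_real (s u) * cderiv (\<lambda>z. cderiv g z v)
        ?z \<zeta>) (at (of_real (s u)))"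
        unfolding k_def by (auto intro!: derivative_eq_intros)
      moreover have "of_real (s u) * cderiv (\<lambda>z. cderiv g z v) ?z \<zeta> = euler (\<lambda>z. cderiv g z v) ?z"
        by (simp add: euler_def cderiv_smult[OF gv sS[OF u \<zeta>]])
      ultimately have "(k has_field_derivative cderiv h ?z v) (at (of_real (s u)))"
        using cderiv_euler[OF g open_ball sS[OF u \<zeta>], of v] by (simp add: h_def)
      from field_vector_diff_chain_within[OF has_vector_derivative_sin_arc[of u "{0..1}",
        folded s_def c_def]
          has_field_derivative_at_within, of k, OF this[unfolded s_def]]
      show ?thesis by (simp add: o_def G_def v_def s_def c_def)
    qed
    have "((\<lambda>u. G u \<zeta>) has_integral (k (of_real (s 1)) - k (of_real (s 0)))) {0..1}"
      by (rule fundamental_theorem_of_calculus) (use D in auto)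
    then show "((\<lambda>u. G u \<zeta>) has_integral cderiv g \<zeta> (tangent i j \<zeta>)) {0..1}"
      by (simp add: k_def s_def v_def)
  qed
qed

text \<open>Splitting a coordinate vector at a point of the sphere into its radial and its tangential
  part, with the latter expanded in the fields \<open>tangent i j\<close>.\<close>

lemma axis_tangent_decomposition:
  fixes \<zeta> :: "complex ^ 'n"
  assumes "norm \<zeta> = 1"
  shows "axis i 1 = cnj (\<zeta> $ i) *s \<zeta> + (\<Sum>j\<in>UNIV. \<zeta> $ j *s tangent i j \<zeta>)"
proof -
  have "(\<Sum>j\<in>UNIV. \<zeta> $ j *s tangent i j \<zeta>) = (\<Sum>j\<in>UNIV. (\<zeta> $ j * cnj (\<zeta> $ j)) *s axis i 1)
    - (\<Sum>j\<in>UNIV. cnj (\<zeta> $ i) *s (\<zeta> $ j *s axis j 1))"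
    by (simp add: tangent_def vector_ssub_ldistrib vector_smult_assoc sum_subtractf mult.commute)
  also have "(\<Sum>j\<in>UNIV. (\<zeta> $ j * cnj (\<zeta> $ j)) *s axis i (1::complex)) = cinner \<zeta> \<zeta> *s axis i 1"
    by (simp add: cinner_def vec_eq_iff sum_distrib_right)
  also have "cinner \<zeta> \<zeta> = 1" using assms by (simp add: cinner_self)
  also have "(\<Sum>j\<in>UNIV. cnj (\<zeta> $ i) *s (\<zeta> $ j *s axis j 1)) = cnj (\<zeta> $ i) *s \<zeta>"
    by (subst vec.scale_sum_right[symmetric]) (simp only: basis_expansion)
  finally show ?thesis by simp
qed

lemma sphere_norm_partial_derivative:
  fixes g :: "complex ^ 'n \<Rightarrow> complex"
  assumes p: "1 \<le> p" and g: "holo g (ball 0 \<rho>)" and \<rho>: "\<rho> > 1"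
  shows "sphere_norm p (\<lambda>\<zeta>. cderiv g \<zeta> (axis i 1)) \<le> (1 + CARD('n) * (pi / 2)) *
    sphere_norm p (euler g)"
proof -
  have e: "continuous_on (sphere 0 1) (euler g)"
    by (rule continuous_on_sphere_holo[OF holo_euler[OF g open_ball] \<rho>])
  have T: "continuous_on (sphere 0 1) (\<lambda>\<zeta>. cderiv g \<zeta> (tangent i j \<zeta>))" for j
    by (intro continuous_intros continuous_on_cderiv[OF g open_ball] continuous_on_tangent) (use \<rho>
      in auto)
  have comp: "norm (\<zeta> $ j) \<le> 1" if "norm \<zeta> = 1" for \<zeta> :: "complex ^ 'n" and j
    using Finite_Cartesian_Product.norm_nth_le[of \<zeta> j] that by simp
  have "sphere_norm p (\<lambda>\<zeta>. cderiv g \<zeta> (axis i 1))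
    = sphere_norm p (\<lambda>\<zeta>. cnj (\<zeta> $ i) * euler g \<zeta> + (\<Sum>j\<in>UNIV. \<zeta> $ j * cderiv g \<zeta> (tangent i j \<zeta>)))"
  proof (rule sphere_norm_cong)
    fix \<zeta> :: "complex ^ 'n" assume \<zeta>: "norm \<zeta> = 1"
    then have S: "\<zeta> \<in> ball 0 \<rho>" using \<rho> by simp
    note lin = cderiv_linear[OF g S]
    have "cderiv g \<zeta> (axis i 1) = cderiv g \<zeta> (cnj (\<zeta> $ i) *s \<zeta> + (\<Sum>j\<in>UNIV. \<zeta> $ j *s tangent i j \<zeta>))"
      using axis_tangent_decomposition[OF \<zeta>, of i] by simp
    then show "cderiv g \<zeta> (axis i 1) = cnj (\<zeta> $ i) * euler g \<zeta> + (\<Sum>j\<in>UNIV. \<zeta> $ j * cderiv g \<zeta>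
      (tangent i j \<zeta>))"
      by (simp add: linear_add[OF lin] linear_sum[OF lin] cderiv_smult[OF g S] euler_def)
  qed
  also have "\<dots> \<le> sphere_norm p (\<lambda>\<zeta>. cnj (\<zeta> $ i) * euler g \<zeta>) + sphere_norm p (\<lambda>\<zeta>. \<Sum>j\<in>UNIV. \<zeta> $ j *
    cderiv g \<zeta> (tangent i j \<zeta>))"
    by (intro sphere_norm_triangle p continuous_intros e T)
  also have "sphere_norm p (\<lambda>\<zeta>. cnj (\<zeta> $ i) * euler g \<zeta>) \<le> 1 * sphere_norm p (euler g)"
    by (intro sphere_norm_mono p continuous_intros e) (auto simp: norm_mult intro!:
      mult_left_le_one_le comp)
  also have "sphere_norm p (\<lambda>\<zeta>. \<Sum>j\<in>UNIV. \<zeta> $ j * cderiv g \<zeta> (tangent i j \<zeta>))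
      \<le> (\<Sum>j\<in>UNIV. sphere_norm p (\<lambda>\<zeta>. \<zeta> $ j * cderiv g \<zeta> (tangent i j \<zeta>)))"
    by (intro sphere_norm_sum p continuous_intros T) simp
  also have "\<dots> \<le> (\<Sum>j\<in>(UNIV :: 'n set). pi / 2 * sphere_norm p (euler g))"
  proof (rule sum_mono)
    fix j :: 'n
    have "sphere_norm p (\<lambda>\<zeta>. \<zeta> $ j * cderiv g \<zeta> (tangent i j \<zeta>)) \<le> 1 * sphere_norm p (\<lambda>\<zeta>. cderiv g \<zeta>
      (tangent i j \<zeta>))"
      by (intro sphere_norm_mono p continuous_intros T) (auto simp: norm_mult intro!:
        mult_left_le_one_le comp)
    also have "\<dots> \<le> pi / 2 * sphere_norm p (euler g)"
    proof (cases "i = j")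
      case True
      have "sphere_norm p (\<lambda>\<zeta>. cderiv g \<zeta> (tangent i j \<zeta>)) \<le> 0 * sphere_norm p (euler g)"
        by (intro sphere_norm_mono p T e) (auto simp: True tangent_def cderiv_def)
      also have "0 * sphere_norm p (euler g) \<le> pi / 2 * sphere_norm p (euler g)"
        by (intro mult_right_mono) auto
      finally show ?thesis by simp
    next
      case False
      then show ?thesis using sphere_norm_tangential_derivative[OF p g \<rho>] by simp
    qed
    finally show "sphere_norm p (\<lambda>\<zeta>. \<zeta> $ j * cderiv g \<zeta> (tangent i j \<zeta>))
      \<le> pi / 2 * sphere_norm p (euler g)" .
  qed
  finally show ?thesis by (simp add: algebra_simps)
qed

text \<open>Raising the power of the Euler field is possible from the first power on, because \<open>euler f\<close>
  vanishes at the origin; for \<open>g\<close> itself constants are an obstruction.\<close>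

lemma sphere_norm_euler_power:
  fixes g :: "complex ^ 'n \<Rightarrow> complex"
  assumes p: "1 \<le> p" and g: "holo g (ball 0 \<rho>)" and \<rho>: "\<rho> > 1"
  shows "sphere_norm p ((euler ^^ Suc k) g) \<le> pi ^ m * sphere_norm p ((euler ^^ (Suc k + m)) g)"
proof (induction m)
  case (Suc m)
  have "sphere_norm p ((euler ^^ (Suc k + m)) g) \<le> pi * sphere_norm p (euler ((euler ^^ (Suc k + m))
    g))"
    by (rule sphere_norm_euler[OF p holo_euler_power[OF g open_ball] \<rho>]) simp
  then have "pi ^ m * sphere_norm p ((euler ^^ (Suc k + m)) g)
    \<le> pi ^ m * (pi * sphere_norm p ((euler ^^ (Suc k + Suc m)) g))"
    by (intro mult_left_mono) auto
  from order_trans[OF Suc this] show ?case by (simp add: mult_ac del: funpow.simps)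
qed simp

text \<open>The commutation rule turns \<open>euler\<close> of a partial derivative of \<open>g\<close> into the same partial
  derivative of \<open>euler g - g\<close>, so the induction is over all \<open>g\<close> at once.\<close>

lemma sphere_norm_euler_power_partial:
  assumes p: "1 \<le> p"
  shows "\<exists>D\<ge>0. \<forall>(g :: complex ^ 'n \<Rightarrow> complex) \<rho> j. holo g (ball 0 \<rho>) \<longrightarrow> \<rho> > 1 \<longrightarrow>
    sphere_norm p ((euler ^^ k) (\<lambda>z. cderiv g z (axis j 1))) \<le> D * sphere_norm p ((euler ^^ Suc k)
      g)"
proof (induction k)
  case 0
  show ?case
    using sphere_norm_partial_derivative[OF p, where 'n='n]
    by (intro exI[of _ "1 + CARD('n) * (pi / 2)"]) auto
next
  case (Suc k)
  then obtain D where D: "D \<ge> 0" "\<And>(g :: complex ^ 'n \<Rightarrow> complex) \<rho> j. holo g (ball 0 \<rho>) \<Longrightarrow> \<rho> > 1 \<Longrightarrow>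
    sphere_norm p ((euler ^^ k) (\<lambda>z. cderiv g z (axis j 1))) \<le> D * sphere_norm p ((euler ^^ Suc k)
      g)" by blast
  show ?case
  proof (intro exI[of _ "D * (1 + pi)"] conjI allI impI)
    fix g :: "complex ^ 'n \<Rightarrow> complex" and \<rho> :: real and j
    assume g: "holo g (ball 0 \<rho>)" and \<rho>: "\<rho> > 1"
    let ?B = "ball (0 :: complex ^ 'n) \<rho>" and ?u = "\<lambda>z. euler g z - g z"
    have eg: "holo (euler g) ?B" by (rule holo_euler[OF g open_ball])
    have u: "holo ?u ?B" by (intro holo_diff eg g)
    have eq: "euler (\<lambda>z. cderiv g z (axis j 1)) z = cderiv ?u z (axis j 1)" if "z \<in> ?B" for z
      using cderiv_euler[OF g open_ball that, of "axis j 1"] by (simp add: cderiv_diff[OF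
        eg g that])
    have "sphere_norm p ((euler ^^ Suc k) (\<lambda>z. cderiv g z (axis j 1)))
      = sphere_norm p ((euler ^^ k) (euler (\<lambda>z. cderiv g z (axis j 1))))"
      by (simp only: funpow_Suc_right o_apply)
    also have "\<dots> = sphere_norm p ((euler ^^ k) (\<lambda>z. cderiv ?u z (axis j 1)))"
      by (rule sphere_norm_cong, rule euler_power_cong[OF holo_cderiv[OF u open_ball] open_ball eq])
         (use \<rho> in auto)
    also have "\<dots> \<le> D * sphere_norm p ((euler ^^ Suc k) ?u)"
      by (rule D(2)[OF u \<rho>])
    also have "\<dots> \<le> D * ((1 + pi) * sphere_norm p ((euler ^^ Suc (Suc k)) g))"
    proof (rule mult_left_mono[OF _ D(1)])
      have "sphere_norm p ((euler ^^ Suc k) ?u)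
        = sphere_norm p (\<lambda>z. (euler ^^ Suc k) (euler g) z + - (euler ^^ Suc k) g z)"
        using \<rho> euler_power_diff[OF eg g open_ball] by (intro sphere_norm_cong) (simp del:
          funpow.simps)
      also have "\<dots> \<le> sphere_norm p ((euler ^^ Suc k) (euler g)) + sphere_norm p (\<lambda>z.
        - (euler ^^ Suc k) g z)"
        by (intro sphere_norm_triangle p continuous_intros continuous_on_sphere_holo[OF _ \<rho>]
          holo_euler_power eg g open_ball)
      also have "sphere_norm p (\<lambda>z. - (euler ^^ Suc k) g z) \<le> 1 * sphere_norm p ((euler ^^ Suc k)
        g)"
        by (intro sphere_norm_mono p continuous_intros continuous_on_sphere_holo[OF _ \<rho>]
          holo_euler_power g open_ball) auto
      also have "1 * sphere_norm p ((euler ^^ Suc k) g) \<le> pi * sphere_norm p ((euler ^^ Suc (Suc k))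
        g)"
        using sphere_norm_euler_power[OF p g \<rho>, of k 1] by simp
      also have "(euler ^^ Suc k) (euler g) = (euler ^^ Suc (Suc k)) g"
        by (simp only: funpow_Suc_right o_apply)
      finally show "sphere_norm p ((euler ^^ Suc k) ?u) \<le> (1 + pi) * sphere_norm p ((euler ^^
        Suc (Suc k)) g)"
        by (simp add: algebra_simps del: funpow.simps)
    qed
    finally show "sphere_norm p ((euler ^^ Suc k) (\<lambda>z. cderiv g z (axis j 1)))
        \<le> D * (1 + pi) * sphere_norm p ((euler ^^ Suc (Suc k)) g)"
      by (simp only: mult.assoc)
  qed (use D in auto)
qed

section \<open>Iterated differences\<close>

lemma difference_pow_Suc: "(difference U ^^ Suc k) f = (difference U ^^ k) (difference U f)"
  by (simp only: funpow_Suc_right o_apply)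

lemma difference_pow_Suc_apply:
  "(difference U ^^ Suc k) f z = (difference U ^^ k) f (U z) - (difference U ^^ k) f z"
  by (simp only: funpow.simps o_apply) (rule difference_def)

text \<open>Differences are finite combinations of values at points of the closed ball, so they pass
  under an integral over a parameter.\<close>

lemma difference_pow_has_integral:
  assumes U: "contraction U"
    and "\<And>z. norm z \<le> 1 \<Longrightarrow> ((\<lambda>t. \<Psi> t z) has_integral \<Phi> z) A" "norm z \<le> 1"
  shows "((\<lambda>t. (difference U ^^ k) (\<Psi> t) z) has_integral (difference U ^^ k) \<Phi> z) A"
  using \<open>norm z \<le> 1\<close>
proof (induction k arbitrary: z)
  case (Suc k)
  have "norm (U z) \<le> 1" using contraction_norm_le[OF U, of z] Suc.prems by simp
  then show ?case
    using Suc by (auto simp: difference_def intro!: has_integral_diff)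
qed (use assms in auto)

lemma difference_pow_add:
  "(difference U ^^ k) (\<lambda>z. f z + g z) = (\<lambda>z. (difference U ^^ k) f z + (difference U ^^ k) g z)"
  by (induction k) (auto simp: difference_def)

lemma difference_pow_sum:
  "(difference U ^^ k) (\<lambda>z. \<Sum>i\<in>I. f i z) = (\<lambda>z. \<Sum>i\<in>I. (difference U ^^ k) (f i) z)"
  by (induction k) (auto simp: difference_def sum_subtractf)

lemma difference_pow_compose:
  assumes "\<And>z. W (U z) = U (W z)"
  shows "(difference U ^^ k) (\<lambda>z. f (W z)) = (\<lambda>z. (difference U ^^ k) f (W z))"
  by (induction k) (auto simp: difference_def assms)

lemma continuous_on_difference_pow_param:
  fixes \<Psi> :: "'t::topological_space \<Rightarrow> complex ^ 'n \<Rightarrow> complex"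
  assumes U: "contraction U" and "continuous_on (A \<times> cball 0 1) (\<lambda>x. \<Psi> (fst x) (snd x))"
  shows "continuous_on (A \<times> cball 0 1) (\<lambda>x. (difference U ^^ k) (\<Psi> (fst x)) (snd x))"
proof (induction k)
  case (Suc k)
  have "continuous_on (A \<times> cball 0 1) (\<lambda>x. (\<lambda>x. (difference U ^^ k) (\<Psi> (fst x)) (snd x)) (fst x,
    U (snd x)))"
    by (rule continuous_on_compose2[OF Suc])
       (auto intro!: continuous_intros contraction_continuous_on[OF U] order_trans[OF
         contraction_norm_le[OF U]])
  then have "continuous_on (A \<times> cball 0 1) (\<lambda>x. (difference U ^^ k) (\<Psi> (fst x)) (U (snd x)))"
    by simp
  with Suc show ?case unfolding difference_pow_Suc_apply by (intro continuous_on_diff)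
qed (use assms in auto)

lemma continuous_on_difference_pow:
  fixes f :: "complex ^ 'n \<Rightarrow> complex"
  assumes U: "contraction U" and f: "continuous_on (cball 0 1) f"
  shows "continuous_on (cball 0 1) ((difference U ^^ k) f)"
proof (induction k)
  case (Suc k)
  have "continuous_on (cball 0 1) (\<lambda>z. (difference U ^^ k) f (U z))"
    by (rule continuous_on_compose2[OF Suc contraction_continuous_on[OF U continuous_on_id]])
       (auto intro!: order_trans[OF contraction_norm_le[OF U]])
  with Suc show ?case unfolding difference_pow_Suc_apply[abs_def] by (intro continuous_on_diff)
qed (use f in simp)

lemma continuous_on_sphere_contraction:
  assumes V: "contraction V" and f: "continuous_on (cball 0 1) f"
  shows "continuous_on (sphere 0 1) (\<lambda>\<zeta>. f (V \<zeta>))"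
  by (rule continuous_on_compose2[OF f contraction_continuous_on[OF V continuous_on_id]])
     (auto intro!: order_trans[OF contraction_norm_le[OF V]])

text \<open>Leibniz rule for differences of \<open>h\<close> times a linear functional, in the form of an estimate.
  From \<open>\<Delta> (h * l) = \<Delta> h * (l \<circ> U) + h * \<Delta> l\<close> one difference is either spent on \<open>h\<close>, which costs
  one order in the hypothesis and gains a factor \<open>\<delta>\<close>, or on \<open>l\<close>, where it replaces \<open>X\<close> by
  \<open>U X - X\<close> and gains \<open>\<delta>\<close> as well. Stating the functional as a coordinate of a map \<open>X\<close> commuting
  with \<open>U\<close> keeps it of the same form.\<close>

lemma sphere_norm_difference_pow_mult:
  fixes h :: "complex ^ 'n \<Rightarrow> complex" and X :: "complex ^ 'n \<Rightarrow> complex ^ 'n"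
  assumes p: "1 \<le> p" and U: "contraction U" and \<delta>: "\<delta> \<ge> 0" "\<And>z. norm (U z - z) \<le> \<delta> * norm z"
    and h: "continuous_on (cball 0 1) h" "M \<ge> 0"
      "\<And>i V. i \<le> k \<Longrightarrow> contraction V \<Longrightarrow> (\<And>z. V (U z) = U (V z)) \<Longrightarrow>
        sphere_norm p (\<lambda>\<zeta>. (difference U ^^ i) h (V \<zeta>)) \<le> M * \<delta> ^ i"
    and X: "\<And>A (f :: complex ^ 'n \<Rightarrow> complex ^ 'n). continuous_on A f \<Longrightarrow>
      continuous_on A (\<lambda>x. X (f x))" "\<And>z. X (U z) = U (X z)"
      "\<epsilon> \<ge> 0" "\<And>z. norm (X z) \<le> \<epsilon> * norm z"
    and V: "contraction V" "\<And>z. V (U z) = U (V z)"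
  shows "sphere_norm p (\<lambda>\<zeta>. (difference U ^^ k) (\<lambda>z. h z * X z $ j) (V \<zeta>)) \<le> 2 ^ k * M * \<epsilon> * \<delta> ^ k"
  using h X
proof (induction k arbitrary: h M X \<epsilon>)
  case 0
  have "sphere_norm p (\<lambda>\<zeta>. h (V \<zeta>) * X (V \<zeta>) $ j) \<le> \<epsilon> * sphere_norm p (\<lambda>\<zeta>. h (V \<zeta>))"
  proof (rule sphere_norm_mono[OF p])
    show hc: "continuous_on (sphere 0 1) (\<lambda>\<zeta>. h (V \<zeta>))"
      by (rule continuous_on_sphere_contraction[OF V(1) 0(1)])
    show "continuous_on (sphere 0 1) (\<lambda>\<zeta>. h (V \<zeta>) * X (V \<zeta>) $ j)"
      by (intro continuous_intros hc 0(4) contraction_continuous_on[OF V(1)])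
    fix \<zeta> :: "complex ^ 'n" assume \<zeta>: "norm \<zeta> = 1"
    have "norm (X (V \<zeta>) $ j) \<le> norm (X (V \<zeta>))" by (rule Finite_Cartesian_Product.norm_nth_le)
    also have "\<dots> \<le> \<epsilon> * norm (V \<zeta>)" by (rule 0(7))
    also have "\<dots> \<le> \<epsilon> * 1"
      using contraction_norm_le[OF V(1), of \<zeta>] \<zeta> 0(6) by (intro mult_left_mono) auto
    finally show "norm (h (V \<zeta>) * X (V \<zeta>) $ j) \<le> \<epsilon> * norm (h (V \<zeta>))"
      unfolding norm_mult by (subst mult.commute) (intro mult_right_mono, auto)
  qed (fact 0(6))
  also have "\<dots> \<le> \<epsilon> * M"
    using 0(3)[of 0, OF _ V] 0(6) by (intro mult_left_mono) auto
  finally show ?case by (simp add: mult.commute)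
next
  case (Suc k)
  \<comment> \<open>The linear factors of the two terms of the product rule.\<close>
  define X1 X2 where "X1 = (\<lambda>z. X (U z))" and "X2 = (\<lambda>z. U (X z) - X z)"
  have U1: "norm (U z) \<le> norm z" for z by (rule contraction_norm_le[OF U])
  have dh: "continuous_on (cball 0 1) (difference U h)"
    using continuous_on_difference_pow[OF U Suc.prems(1), of 1] by simp
  have X1: "continuous_on A (\<lambda>x. X1 (f x))" if "continuous_on A f" for A and f :: "complex ^ 'n \<Rightarrow> _"
    unfolding X1_def by (intro Suc.prems(4) contraction_continuous_on[OF U] that)
  have X2: "continuous_on A (\<lambda>x. X2 (f x))" if "continuous_on A f" for A and f :: "complex ^ 'n \<Rightarrow> _"
    unfolding X2_def by (intro continuous_on_diff Suc.prems(4) contraction_continuous_on[OF U] that)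
  have X1b: "norm (X1 z) \<le> \<epsilon> * norm z" for z
    unfolding X1_def by (rule order_trans[OF Suc.prems(7) mult_left_mono[OF U1 Suc.prems(6)]])
  have X2b: "norm (X2 z) \<le> \<epsilon> * \<delta> * norm z" for z
    using \<delta>(2)[of "X z"] mult_left_mono[OF Suc.prems(7)[of z] \<delta>(1)] unfolding X2_def
      by (simp add: mult_ac)
  have "difference U (\<lambda>z. h z * X z $ j) = (\<lambda>z. difference U h z * X1 z $ j + h z * X2 z $ j)"
    by (simp add: fun_eq_iff difference_def X1_def X2_def Suc.prems(5) algebra_simps)
  then have "sphere_norm p (\<lambda>\<zeta>. (difference U ^^ Suc k) (\<lambda>z. h z * X z $ j) (V \<zeta>)) =
    sphere_norm p (\<lambda>\<zeta>. (difference U ^^ k) (\<lambda>z. difference U h z * X1 z $ j) (V \<zeta>)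
      + (difference U ^^ k) (\<lambda>z. h z * X2 z $ j) (V \<zeta>))"
    by (simp only: difference_pow_Suc difference_pow_add)
  also have "\<dots> \<le> sphere_norm p (\<lambda>\<zeta>. (difference U ^^ k) (\<lambda>z. difference U h z * X1 z $ j) (V \<zeta>))
      + sphere_norm p (\<lambda>\<zeta>. (difference U ^^ k) (\<lambda>z. h z * X2 z $ j) (V \<zeta>))"
    by (intro sphere_norm_triangle p continuous_on_sphere_contraction[OF V(1)]
      continuous_on_difference_pow[OF U]
        continuous_on_mult continuous_on_component dh Suc.prems(1) X1 X2 continuous_on_id)
  also have "sphere_norm p (\<lambda>\<zeta>. (difference U ^^ k) (\<lambda>z. difference U h z * X1 z $ j) (V \<zeta>))
      \<le> 2 ^ k * (M * \<delta>) * \<epsilon> * \<delta> ^ k"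
  proof (rule Suc.IH[OF dh _ _ X1 _ Suc.prems(6) X1b])
    show "0 \<le> M * \<delta>" using Suc.prems(2) \<delta>(1) by simp
    show "X1 (U z) = U (X1 z)" for z by (simp add: X1_def Suc.prems(5))
    fix i and V' :: "complex ^ 'n \<Rightarrow> complex ^ 'n" 
    assume "i \<le> k" and V': "contraction V'" "\<And>z. V' (U z) = U (V' z)"
    then show "sphere_norm p (\<lambda>\<zeta>. (difference U ^^ i) (difference U h) (V' \<zeta>)) \<le> M * \<delta> * \<delta> ^ i"
      using Suc.prems(3)[of "Suc i" V'] by (simp add: funpow_swap1 mult.assoc)
  qed
  also have "sphere_norm p (\<lambda>\<zeta>. (difference U ^^ k) (\<lambda>z. h z * X2 z $ j) (V \<zeta>))
      \<le> 2 ^ k * M * (\<epsilon> * \<delta>) * \<delta> ^ k"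
  proof (rule Suc.IH[OF Suc.prems(1,2) _ X2 _ _ X2b])
    show "0 \<le> \<epsilon> * \<delta>" using Suc.prems(6) \<delta>(1) by simp
    show "X2 (U z) = U (X2 z)" for z by (simp add: X2_def Suc.prems(5) contraction_diff[OF U])
    fix i and V' :: "complex ^ 'n \<Rightarrow> complex ^ 'n" 
    assume "i \<le> k" and V': "contraction V'" "\<And>z. V' (U z) = U (V' z)"
    then show "sphere_norm p (\<lambda>\<zeta>. (difference U ^^ i) h (V' \<zeta>)) \<le> M * \<delta> ^ i"
      using Suc.prems(3)[of i V'] by simp
  qed
  finally show ?case by (simp add: mult_ac)
qed

text \<open>The fundamental theorem of calculus on the segment from \<open>z\<close> to \<open>U z\<close>.\<close>

lemma difference_has_integral:
  fixes g :: "complex ^ 'n \<Rightarrow> complex"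
  assumes g: "holo g (ball 0 \<rho>)" and W: "\<And>t. t \<in> {0..1} \<Longrightarrow> z + of_real t *s (U z - z) \<in> ball 0 \<rho>"
  shows "((\<lambda>t. \<Sum>j\<in>UNIV. cderiv g (z + of_real t *s (U z - z)) (axis j 1) * (U z - z) $ j)
    has_integral difference U g z) {0..1}"
proof -
  have "((\<lambda>t. g (z + of_real t *s (U z - z))) has_vector_derivative
      (\<Sum>j\<in>UNIV. cderiv g (z + of_real t *s (U z - z)) (axis j 1) * (U z - z) $ j)) (at
        t within {0..1})" if "t \<in> {0..1}" for t
  proof -
    have "((\<lambda>t. g (z + t *s (U z - z))) has_field_derivative cderiv g (z + of_real t *s (U z - z))
      (U z - z)) (at (of_real t))"
      by (rule holo_DERIV_line[OF g W[OF that]])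
    from has_vector_derivative_at_within[OF has_vector_derivative_real_field[OF this]]
    show ?thesis by (subst (asm) cderiv_expand[OF g W[OF that]]) (simp add: mult.commute)
  qed
  then have "((\<lambda>t. \<Sum>j\<in>UNIV. cderiv g (z + of_real t *s (U z - z)) (axis j 1) * (U z - z) $ j)
    has_integral
      g (z + of_real 1 *s (U z - z)) - g (z + of_real 0 *s (U z - z))) {0..1}"
    by (intro fundamental_theorem_of_calculus) auto
  then show ?thesis by (simp add: difference_def)
qed

text \<open>Induction on the order. The first difference is written as an integral over \<open>t\<close> of sums of
  terms \<open>\<partial>\<^sub>j g (W\<^sub>t z) (U z - z)\<^sub>j\<close>. The remaining \<open>m\<close> differences of such a term are estimated by
  \<open>sphere_norm_difference_pow_mult\<close>; its hypothesis is the induction hypothesis for \<open>\<partial>\<^sub>j g\<close> at the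
  contraction \<open>W\<^sub>t \<circ> V'\<close>. This is why contractions \<open>V\<close> commuting with \<open>U\<close> appear in the statement.\<close>

lemma sphere_norm_difference_pow:
  assumes p: "1 \<le> p"
  shows "\<exists>C\<ge>0. \<forall>(g :: complex ^ 'n \<Rightarrow> complex) \<rho> (U :: complex ^ 'n \<Rightarrow> complex ^ 'n) V \<delta>. holo g (ball
    0 \<rho>) \<longrightarrow> \<rho> > 1 \<longrightarrow> contraction U \<longrightarrow>
    \<delta> \<ge> 0 \<longrightarrow> (\<forall>z. norm (U z - z) \<le> \<delta> * norm z) \<longrightarrow> contraction V \<longrightarrow> (\<forall>z. V (U z) = U (V z)) \<longrightarrow>
    sphere_norm p (\<lambda>\<zeta>. (difference U ^^ k) g (V \<zeta>)) \<le> C * \<delta> ^ k * sphere_norm p ((euler ^^ k) g)"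
proof (induction k rule: less_induct)
  case (less k)
  show ?case
  proof (cases k)
    case 0
    then show ?thesis using sphere_norm_contraction[OF p] by (intro exI[of _ 1]) auto
  next
    case (Suc m)
    define P where "P = (\<lambda>i C. \<forall>(g :: complex ^ 'n \<Rightarrow> complex) \<rho> (U :: complex ^ 'n \<Rightarrow> complex ^ 'n)
      V \<delta>. holo g (ball 0 \<rho>) \<longrightarrow> \<rho> > 1 \<longrightarrow> contraction U \<longrightarrow>
      \<delta> \<ge> 0 \<longrightarrow> (\<forall>z. norm (U z - z) \<le> \<delta> * norm z) \<longrightarrow> contraction V \<longrightarrow> (\<forall>z. V (U z) = U (V z)) \<longrightarrow>
      sphere_norm p (\<lambda>\<zeta>. (difference U ^^ i) g (V \<zeta>)) \<le> C * \<delta> ^ i * sphere_norm p ((euler ^^ i) g))"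
    have "\<exists>C. 0 \<le> C \<and> (i \<le> m \<longrightarrow> P i C)" for i
    proof (cases "i \<le> m")
      case True
      then have "i < k" using Suc by simp
      from less[OF this] show ?thesis unfolding P_def by blast
    qed auto
    then obtain C where C0: "\<And>i. C i \<ge> 0" and CP: "\<And>i. i \<le> m \<Longrightarrow> P i (C i)"
      by metis
    note C = C0 CP[unfolded P_def, rule_format]
    have "\<forall>i. \<exists>D\<ge>0. \<forall>(g :: complex ^ 'n \<Rightarrow> complex) \<rho> j. holo g (ball 0 \<rho>) \<longrightarrow> \<rho> > 1 \<longrightarrow>
      sphere_norm p ((euler ^^ i) (\<lambda>z. cderiv g z (axis j 1))) \<le> D * sphere_norm p ((euler ^^ Suc i)
        g)"
      using sphere_norm_euler_power_partial[OF p] by blast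
    from choice[OF this] obtain D where "\<forall>i. D i \<ge> 0 \<and> (\<forall>(g :: complex ^ 'n \<Rightarrow> complex) \<rho> j.
      holo g (ball 0 \<rho>) \<longrightarrow> \<rho> > 1 \<longrightarrow>
      sphere_norm p ((euler ^^ i) (\<lambda>z. cderiv g z (axis j 1))) \<le> D i * sphere_norm p ((euler ^^
        Suc i) g))" ..
    then have D: "\<And>i. D i \<ge> 0" "\<And>i (g :: complex ^ 'n \<Rightarrow> complex) \<rho> j. holo g (ball 0 \<rho>) \<Longrightarrow> \<rho> > 1 \<Longrightarrow>
      sphere_norm p ((euler ^^ i) (\<lambda>z. cderiv g z (axis j 1))) \<le> D i * sphere_norm p ((euler ^^
        Suc i) g)"
      by blast+
    \<comment> \<open>A common constant for the orders up to \<open>m\<close>; the powers of \<open>\<pi>\<close> come from raising the power of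
      the
      Euler field to \<open>m + 1\<close>.\<close>
    define K where "K = (\<Sum>i\<le>m. C i * (D i * pi ^ (m - i)))"
    have K: "C i * (D i * pi ^ (m - i)) \<le> K" if "i \<le> m" for i
      unfolding K_def using that C(1) D(1) by (intro member_le_sum) auto
    have "K \<ge> 0" unfolding K_def using C(1) D(1) by (intro sum_nonneg) auto
    show ?thesis
    proof (intro exI[of _ "CARD('n) * (2 ^ m * K)"] conjI allI impI)
      show "0 \<le> real CARD('n) * (2 ^ m * K)" using \<open>K \<ge> 0\<close> by simp
      fix g :: "complex ^ 'n \<Rightarrow> complex" and \<rho> \<delta> :: real and U V :: "complex ^ 'n \<Rightarrow> complex ^ 'n"
      assume g: "holo g (ball 0 \<rho>)" and \<rho>: "\<rho> > 1" and U: "contraction U" and \<delta>: "\<delta> \<ge> 0" "\<forall>z.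
        norm (U z - z) \<le> \<delta> * norm z"
        and V: "contraction V" "\<forall>z. V (U z) = U (V z)"
      define W where "W = (\<lambda>t z. z + of_real t *s (U z - z))"
      have WU: "W t (U z) = U (W t z)" for t z
        by (simp add: W_def contraction_add[OF U] contraction_smult[OF U] contraction_diff[OF U])
      have W: "contraction (W t)" if t: "t \<in> {0..1}" for t
      proof (rule contractionI)
        show "W t (x + y) = W t x + W t y" for x y
          by (simp add: W_def contraction_add[OF U] vec_eq_iff algebra_simps)
        show "W t (c *s x) = c *s W t x" for c x
          by (simp add: W_def contraction_smult[OF U] vec_eq_iff algebra_simps)
        fix x
        have "W t x = (1 - t) *\<^sub>R x + t *\<^sub>R U x"
          by (simp add: W_def scaleR_eq_smult vec_eq_iff algebra_simps)
        also have "norm \<dots> \<le> (1 - t) * norm x + t * norm (U x)"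
          using t by (intro norm_triangle_le) auto
        also have "\<dots> \<le> (1 - t) * norm x + t * norm x"
          using t contraction_norm_le[OF U] by (intro add_left_mono mult_left_mono) auto
        finally show "norm (W t x) \<le> norm x" by (simp add: algebra_simps)
      qed
      have Wball: "W t z \<in> ball 0 \<rho>" if "t \<in> {0..1}" "norm z \<le> 1" for t z
        using contraction_norm_le[OF W[OF that(1)], of z] that(2) \<rho> by simp
      define Dg where "Dg = (\<lambda>j z. cderiv g z (axis j 1))"
      have Dg: "holo (Dg j) (ball 0 \<rho>)" for j unfolding Dg_def by (rule holo_cderiv[OF g open_ball])
      define \<Psi> where "\<Psi> = (\<lambda>t z. \<Sum>j\<in>UNIV. Dg j (W t z) * (U z - z) $ j)"
      have UW: "continuous_on A (\<lambda>x. U (f x) - f x)" if "continuous_on A f" for A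
        and f :: "'z::topological_space \<Rightarrow> complex ^ 'n"
        by (intro continuous_intros contraction_continuous_on[OF U] that)
      have \<Psi>cont: "continuous_on ({0..1} \<times> cball 0 1) (\<lambda>x. \<Psi> (fst x) (snd x))"
        unfolding \<Psi>_def
      proof (intro continuous_on_sum continuous_on_mult continuous_on_component UW continuous_on_snd
        continuous_on_id
          continuous_on_compose2[OF holo_continuous_on[OF Dg]])
        show "continuous_on ({0..1::real} \<times> cball 0 1) (\<lambda>x. W (fst x) (snd x))"
          unfolding W_def by (intro continuous_intros UW)
        show "(\<lambda>x. W (fst x) (snd x)) ` ({0..1} \<times> cball 0 1) \<subseteq> ball 0 \<rho>" using Wball by auto
      qed
      define B where "B = sphere_norm p ((euler ^^ Suc m) g)"
      have summand: "sphere_norm p (\<lambda>\<zeta>. (difference U ^^ m) (\<lambda>z. Dg j (W t z) * (U z - z) $ j)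
        (V \<zeta>)) \<le> 2 ^ m * (K * B) * \<delta> * \<delta> ^ m"
        if t: "t \<in> {0..1}" for t j
      proof (rule sphere_norm_difference_pow_mult[OF p U \<delta>(1)])
        show "continuous_on (cball 0 1) (\<lambda>z. Dg j (W t z))"
          using Wball[OF t] by (intro continuous_on_compose2[OF holo_continuous_on[OF Dg]]
            contraction_continuous_on[OF W[OF t]] continuous_on_id) auto
        show "0 \<le> K * B" using \<open>K \<ge> 0\<close> by (simp add: B_def)
        show "U (U z) - U z = U (U z - z)" for z by (simp add: contraction_diff[OF U])
        fix i and V' :: "complex ^ 'n \<Rightarrow> complex ^ 'n"
        assume i: "i \<le> m" and V': "contraction V'" "\<And>z. V' (U z) = U (V' z)"
        have "sphere_norm p (\<lambda>\<zeta>. (difference U ^^ i) (\<lambda>z. Dg j (W t z)) (V' \<zeta>))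
          = sphere_norm p (\<lambda>\<zeta>. (difference U ^^ i) (Dg j) (W t (V' \<zeta>)))"
          by (simp only: difference_pow_compose[of "W t" U, OF WU])
        also have "\<dots> \<le> C i * \<delta> ^ i * sphere_norm p ((euler ^^ i) (Dg j))"
          by (rule C(2)[OF i Dg \<rho> U \<delta>(1)]) (use \<delta>(2) contraction_comp[OF W[OF t] V'(1)] in \<open>auto
            simp: V'(2) WU\<close>)
        also have "\<dots> \<le> C i * \<delta> ^ i * (D i * (pi ^ (m - i) * B))"
        proof (intro mult_left_mono)
          have "sphere_norm p ((euler ^^ i) (Dg j)) \<le> D i * sphere_norm p ((euler ^^ Suc i) g)"
            unfolding Dg_def by (rule D(2)[OF g \<rho>])
          also have "\<dots> \<le> D i * (pi ^ (m - i) * sphere_norm p ((euler ^^ (Suc i + (m - i))) g))"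
            by (intro mult_left_mono sphere_norm_euler_power[OF p g \<rho>] D(1))
          finally show "sphere_norm p ((euler ^^ i) (Dg j)) \<le> D i * (pi ^ (m - i) * B)"
            using i by (simp add: B_def)
        qed (use C(1) \<delta>(1) in auto)
        also have "\<dots> = (C i * (D i * pi ^ (m - i))) * (B * \<delta> ^ i)" by (simp add: mult_ac)
        also have "\<dots> \<le> K * (B * \<delta> ^ i)"
          using K[OF i] \<delta>(1) by (intro mult_right_mono) (auto simp: B_def)
        finally show "sphere_norm p (\<lambda>\<zeta>. (difference U ^^ i) (\<lambda>z. Dg j (W t z)) (V' \<zeta>)) \<le> K * B * \<delta>
          ^ i"
          by (simp add: mult_ac)
      qed (use \<delta> V UW in auto)
      have "sphere_norm p (\<lambda>\<zeta>. (difference U ^^ m) (difference U g) (V \<zeta>)) \<le> CARD('n) * (2 ^ m *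
        (K * B) * \<delta> * \<delta> ^ m)"
      proof (rule sphere_norm_average[OF p, where G="\<lambda>t \<zeta>. (difference U ^^ m) (\<Psi> t) (V \<zeta>)"])
        have gc: "continuous_on (cball 0 1) g"
          using \<rho> by (intro continuous_on_subset[OF holo_continuous_on[OF g]]) auto
        show "continuous_on (sphere 0 1) (\<lambda>\<zeta>. (difference U ^^ m) (difference U g) (V \<zeta>))"
          using continuous_on_difference_pow[OF U gc, of "Suc m"]
          by (intro continuous_on_sphere_contraction[OF V(1)]) (simp only: difference_pow_Suc)
        have "continuous_on ({0..1} \<times> sphere 0 1) (\<lambda>x. (\<lambda>x. (difference U ^^ m) (\<Psi> (fst x)) (snd x))
          (fst x, V (snd x)))"
          by (rule continuous_on_compose2[OF continuous_on_difference_pow_param[OF U \<Psi>cont]])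
             (auto intro!: continuous_intros contraction_continuous_on[OF V(1)] order_trans[OF
               contraction_norm_le[OF V(1)]])
        then show "continuous_on ({0..1} \<times> sphere 0 1) (\<lambda>(t, \<zeta>). (difference U ^^ m) (\<Psi> t) (V \<zeta>))"
          by (simp add: split_beta)
        fix \<zeta> :: "complex ^ 'n" assume "norm \<zeta> = 1"
        then have V\<zeta>: "norm (V \<zeta>) \<le> 1" using contraction_norm_le[OF V(1), of \<zeta>] by simp
        show "((\<lambda>t. (difference U ^^ m) (\<Psi> t) (V \<zeta>)) has_integral (difference U ^^ m) (difference
          U g) (V \<zeta>)) {0..1}"
        proof (rule difference_pow_has_integral[OF U _ V\<zeta>])
          fix z :: "complex ^ 'n" assume "norm z \<le> 1"
          then show "((\<lambda>t. \<Psi> t z) has_integral difference U g z) {0..1}"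
            unfolding \<Psi>_def Dg_def W_def
            by (intro difference_has_integral[OF g] Wball[unfolded W_def])
        qed
      next
        fix t :: real assume t: "t \<in> {0..1}"
        have "sphere_norm p (\<lambda>\<zeta>. (difference U ^^ m) (\<Psi> t) (V \<zeta>))
          = sphere_norm p (\<lambda>\<zeta>. \<Sum>j\<in>UNIV. (difference U ^^ m) (\<lambda>z. Dg j (W t z) * (U z - z) $ j)
            (V \<zeta>))"
          unfolding \<Psi>_def difference_pow_sum ..
        also have "\<dots> \<le> (\<Sum>j\<in>UNIV. sphere_norm p (\<lambda>\<zeta>. (difference U ^^ m) (\<lambda>z. Dg j (W t z) * (U z
          - z) $ j) (V \<zeta>)))"
        proof (rule sphere_norm_sum[OF p])
          fix j
          have "continuous_on (cball 0 1) (\<lambda>z. Dg j (W t z) * (U z - z) $ j)"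
            using Wball[OF t] by (intro continuous_on_mult continuous_on_component UW
              continuous_on_id
                continuous_on_compose2[OF holo_continuous_on[OF Dg]] contraction_continuous_on[OF
                  W[OF t]]) auto
          then show "continuous_on (sphere 0 1) (\<lambda>\<zeta>. (difference U ^^ m) (\<lambda>z. Dg j (W t z) * (U z
            - z) $ j) (V \<zeta>))"
            by (intro continuous_on_sphere_contraction[OF V(1)] continuous_on_difference_pow[OF U])
        qed simp
        also have "\<dots> \<le> (\<Sum>j\<in>(UNIV :: 'n set). 2 ^ m * (K * B) * \<delta> * \<delta> ^ m)"
          by (intro sum_mono summand t)
        finally show "sphere_norm p (\<lambda>\<zeta>. (difference U ^^ m) (\<Psi> t) (V \<zeta>)) \<le> CARD('n) * (2 ^ m *
          (K * B) * \<delta> * \<delta> ^ m)"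
          by simp
      qed
      then show "sphere_norm p (\<lambda>\<zeta>. (difference U ^^ k) g (V \<zeta>)) \<le> CARD('n) * (2 ^ m * K) * \<delta> ^ k *
        sphere_norm p ((euler ^^ k) g)"
        by (simp only: Suc difference_pow_Suc B_def power_Suc mult_ac)
    qed
  qed
qed

section \<open>Homogeneous expansions and the radial derivative\<close>

lemma finite_multi_indices: "finite {\<alpha> :: 'n::finite \<Rightarrow> nat. (\<Sum>i\<in>UNIV. \<alpha> i) = k}"
proof (rule finite_subset)
  show "{\<alpha> :: 'n \<Rightarrow> nat. (\<Sum>i\<in>UNIV. \<alpha> i) = k} \<subseteq> PiE UNIV (\<lambda>_. {..k})"
    by (auto simp: PiE_UNIV_domain intro: member_le_sum)
qed (intro finite_PiE; simp)

lemma homogeneous_polynomial_const: "homogeneous_polynomial 0 (\<lambda>z :: complex ^ 'n. a)"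
proof -
  have "{\<alpha> :: 'n \<Rightarrow> nat. (\<Sum>i\<in>UNIV. \<alpha> i) = 0} = {\<lambda>_. 0}" by (auto simp: fun_eq_iff)
  then show ?thesis unfolding homogeneous_polynomial_def by (intro exI[of _ "\<lambda>_. a"]) simp
qed

lemma homogeneous_polynomial_cmult:
  assumes "homogeneous_polynomial k q"
  shows "homogeneous_polynomial k (\<lambda>z. a * q z)"
proof -
  obtain c where "\<And>z. q z = (\<Sum>\<alpha> | (\<Sum>i\<in>UNIV. \<alpha> i) = k. c \<alpha> * (\<Prod>i\<in>UNIV. z $ i ^ \<alpha> i))"
    using assms unfolding homogeneous_polynomial_def by blast
  then show ?thesis
    unfolding homogeneous_polynomial_def by (intro exI[of _ "\<lambda>\<alpha>. a * c \<alpha>"]) (simp add: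
      sum_distrib_left mult.assoc)
qed

lemma homogeneous_polynomial_zero: "homogeneous_polynomial k (\<lambda>z. 0)"
  unfolding homogeneous_polynomial_def by (intro exI[of _ "\<lambda>_. 0"]) simp

lemma homogeneous_polynomial_add:
  assumes "homogeneous_polynomial k q" "homogeneous_polynomial k r"
  shows "homogeneous_polynomial k (\<lambda>z. q z + r z)"
proof -
  obtain c d where "\<And>z. q z = (\<Sum>\<alpha> | (\<Sum>i\<in>UNIV. \<alpha> i) = k. c \<alpha> * (\<Prod>i\<in>UNIV. z $ i ^ \<alpha> i))"
    "\<And>z. r z = (\<Sum>\<alpha> | (\<Sum>i\<in>UNIV. \<alpha> i) = k. d \<alpha> * (\<Prod>i\<in>UNIV. z $ i ^ \<alpha> i))"
    using assms unfolding homogeneous_polynomial_def by blast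
  then show ?thesis
    unfolding homogeneous_polynomial_def
    by (intro exI[of _ "\<lambda>\<alpha>. c \<alpha> + d \<alpha>"]) (simp add: sum.distrib distrib_right)
qed

lemma homogeneous_polynomial_sum:
  "(\<And>i. i \<in> I \<Longrightarrow> homogeneous_polynomial k (q i)) \<Longrightarrow> homogeneous_polynomial k (\<lambda>z. \<Sum>i\<in>I. q i z)"
  by (induction I rule: infinite_finite_induct)
     (auto intro: homogeneous_polynomial_zero homogeneous_polynomial_add)

text \<open>Multiplication by a coordinate shifts the multi-indices by one in place \<open>j\<close>; monomials of
  the higher degree without that coordinate get the coefficient \<open>0\<close>.\<close>

lemma homogeneous_polynomial_component_mult:
  assumes "homogeneous_polynomial k q"
  shows "homogeneous_polynomial (Suc k) (\<lambda>z :: complex ^ 'n. z $ j * q z)"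
proof -
  define up down where "up = (\<lambda>\<alpha> :: 'n \<Rightarrow> nat. \<alpha>(j := Suc (\<alpha> j)))" and "down = (\<lambda>\<beta> :: 'n \<Rightarrow> nat.
    \<beta>(j := \<beta> j - 1))"
  obtain c where c: "\<And>z. q z = (\<Sum>\<alpha> | (\<Sum>i\<in>UNIV. \<alpha> i) = k. c \<alpha> * (\<Prod>i\<in>UNIV. z $ i ^ \<alpha> i))"
    using assms unfolding homogeneous_polynomial_def by blast
  have deg: "(\<Sum>i\<in>UNIV. up \<alpha> i) = Suc (\<Sum>i\<in>UNIV. \<alpha> i)" for \<alpha>
    by (simp add: up_def sum.remove[of UNIV j])
  have mono: "(\<Prod>i\<in>UNIV. z $ i ^ up \<alpha> i) = z $ j * (\<Prod>i\<in>UNIV. z $ i ^ \<alpha> i)" for z :: "complex ^ 'n"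
    and \<alpha>
    by (simp add: up_def prod.remove[of UNIV j] mult.assoc)
  have ud: "up (down \<beta>) = \<beta>" if "0 < \<beta> j" for \<beta> using that by (simp add: up_def down_def)
  have du: "down (up \<alpha>) = \<alpha>" for \<alpha> by (simp add: up_def down_def)
  define d where "d = (\<lambda>\<beta>. if 0 < \<beta> j then c (down \<beta>) else 0)"
  show ?thesis
    unfolding homogeneous_polynomial_def
  proof (intro exI allI)
    fix z :: "complex ^ 'n"
    have "z $ j * q z = (\<Sum>\<alpha> | (\<Sum>i\<in>UNIV. \<alpha> i) = k. c \<alpha> * (\<Prod>i\<in>UNIV. z $ i ^ up \<alpha> i))"
      by (simp add: c mono sum_distrib_left mult.left_commute)
    also have "\<dots> = (\<Sum>\<beta> | (\<Sum>i\<in>UNIV. \<beta> i) = Suc k \<and> 0 < \<beta> j. d \<beta> * (\<Prod>i\<in>UNIV. z $ i ^ \<beta> i))"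
    proof (rule sum.reindex_bij_witness[of _ down up])
      fix \<beta> :: "'n \<Rightarrow> nat" assume "\<beta> \<in> {\<beta>. (\<Sum>i\<in>UNIV. \<beta> i) = Suc k \<and> 0 < \<beta> j}"
      then have \<beta>: "(\<Sum>i\<in>UNIV. \<beta> i) = Suc k" "0 < \<beta> j" by auto
      show "up (down \<beta>) = \<beta>" using \<beta> by (simp add: ud)
      show "down \<beta> \<in> {\<alpha>. (\<Sum>i\<in>UNIV. \<alpha> i) = k}"
        using \<beta> deg[of "down \<beta>"] by (simp add: ud)
    qed (auto simp: deg du d_def, auto simp: up_def)
    also have "\<dots> = (\<Sum>\<beta> | (\<Sum>i\<in>UNIV. \<beta> i) = Suc k. d \<beta> * (\<Prod>i\<in>UNIV. z $ i ^ \<beta> i))"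
      by (rule sum.mono_neutral_left) (auto simp: d_def finite_multi_indices)
    finally show "z $ j * q z = (\<Sum>\<beta> | (\<Sum>i\<in>UNIV. \<beta> i) = Suc k. d \<beta> * (\<Prod>i\<in>UNIV. z $ i ^ \<beta> i))" .
  qed
qed

lemma homogeneous_polynomial_smult:
  assumes "homogeneous_polynomial k q"
  shows "q (l *s z) = l ^ k * q z"
proof -
  obtain c where c: "\<And>z. q z = (\<Sum>\<alpha> | (\<Sum>i\<in>UNIV. \<alpha> i) = k. c \<alpha> * (\<Prod>i\<in>UNIV. z $ i ^ \<alpha> i))"
    using assms unfolding homogeneous_polynomial_def by blast
  show ?thesis
    unfolding c sum_distrib_left
    by (intro sum.cong) (auto simp: power_mult_distrib prod.distrib power_sum mult.left_commute)
qed

lemma higher_deriv_weighted_sum: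
  assumes "finite I" "\<And>i. i \<in> I \<Longrightarrow> f i holomorphic_on S" "open S" "z \<in> S"
  shows "(deriv ^^ k) (\<lambda>w. \<Sum>i\<in>I. c i * f i w) z = (\<Sum>i\<in>I. c i * (deriv ^^ k) (f i) z)"
  using assms(1,2)
proof (induction I rule: finite_induct)
  case (insert i I)
  then show ?case
    using higher_deriv_add[of "\<lambda>w. c i * f i w" S "\<lambda>w. \<Sum>i\<in>I. c i * f i w" z k] assms(3,4)
    by (simp add: higher_deriv_cmult[OF _ assms(4,3)] holomorphic_intros)
qed (simp add: higher_deriv_const)

text \<open>Differentiating \<open>l \<mapsto> f (l z)\<close> once yields the sum of \<open>z\<^sub>j * \<partial>\<^sub>j f (l z)\<close>, so the coefficient
  of degree \<open>k + 1\<close> is a combination of products of coordinates with coefficients of degree \<open>k\<close> of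
  the partial derivatives. This replaces a power series in several variables.\<close>

lemma taylor_coefficient_homogeneous_polynomial:
  fixes f :: "complex ^ 'n \<Rightarrow> complex"
  assumes "holo f (ball 0 \<rho>)" "\<rho> > 0"
  shows "\<exists>q. homogeneous_polynomial k q \<and>
    (\<forall>z\<in>ball 0 \<rho>. (deriv ^^ k) (\<lambda>l. f (l *s z)) 0 / fact k = q z)"
  using assms(1)
proof (induction k arbitrary: f)
  case 0
  show ?case by (intro exI[of _ "\<lambda>_. f 0"]) (simp add: homogeneous_polynomial_const)
next
  case (Suc k)
  note f = \<open>holo f (ball 0 \<rho>)\<close>
  have "\<forall>j. \<exists>q. homogeneous_polynomial k q \<and>
    (\<forall>z\<in>ball 0 \<rho>. (deriv ^^ k) (\<lambda>l. cderiv f (l *s z) (axis j 1)) 0 / fact k = q z)"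
    using Suc.IH[OF holo_cderiv[OF f open_ball]] by blast
  from choice[OF this] obtain q where q: "\<And>j. homogeneous_polynomial k (q j)"
    "\<And>j z. z \<in> ball 0 \<rho> \<Longrightarrow> (deriv ^^ k) (\<lambda>l. cderiv f (l *s z) (axis j 1)) 0 / fact k = q j z"
    by blast
  show ?case
  proof (intro exI conjI ballI)
    show "homogeneous_polynomial (Suc k) (\<lambda>z. 1 / of_nat (Suc k) * (\<Sum>j\<in>UNIV. z $ j * q j z))"
      by (intro homogeneous_polynomial_cmult homogeneous_polynomial_sum
        homogeneous_polynomial_component_mult q)
    fix z :: "complex ^ 'n" assume z: "z \<in> ball 0 \<rho>"
    define A where "A = (\<lambda>l. l *s z) -` ball 0 \<rho>"
    have A: "open A" "0 \<in> A"
      unfolding A_def using assms(2) by (auto intro!: open_vimage continuous_intros)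
    have D: "deriv (\<lambda>l. f (l *s z)) l = (\<Sum>j\<in>UNIV. z $ j * cderiv f (l *s z) (axis j 1))" if "l \<in> A"
      for l
      using that holo_DERIV_line[OF f, of 0 l z] cderiv_expand[OF f, of "l *s z" z]
      by (auto simp: A_def intro: DERIV_imp_deriv)
    have "(deriv ^^ Suc k) (\<lambda>l. f (l *s z)) 0 = (deriv ^^ k) (deriv (\<lambda>l. f (l *s z))) 0"
      by (simp only: funpow_Suc_right o_apply)
    also have "\<dots> = (deriv ^^ k) (\<lambda>l. \<Sum>j\<in>UNIV. z $ j * cderiv f (l *s z) (axis j 1)) 0"
      using D eventually_nhds_in_open[OF A] by (intro higher_deriv_cong_ev refl) (auto elim:
        eventually_mono)
    also have "\<dots> = (\<Sum>j\<in>UNIV. z $ j * (deriv ^^ k) (\<lambda>l. cderiv f (l *s z) (axis j 1)) 0)"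
    proof (rule higher_deriv_weighted_sum[OF _ _ A])
      fix j
      show "(\<lambda>l. cderiv f (l *s z) (axis j 1)) holomorphic_on A"
        using holo_holomorphic_on_line[OF holo_cderiv[OF f open_ball], of A 0 z "axis j 1"]
        by (simp add: A_def)
    qed simp
    also have "\<dots> = (\<Sum>j\<in>UNIV. z $ j * (fact k * q j z))"
      by (intro sum.cong refl arg_cong2[where f="(*)"]) (simp flip: q(2)[OF z])
    also have "\<dots> = fact k * (\<Sum>j\<in>UNIV. z $ j * q j z)"
      by (simp add: sum_distrib_left mult.left_commute)
    finally show "(deriv ^^ Suc k) (\<lambda>l. f (l *s z)) 0 / fact (Suc k) = 1 / of_nat (Suc k) *
      (\<Sum>j\<in>UNIV. z $ j * q j z)"
      unfolding fact_Suc by (simp del: of_nat_Suc funpow.simps)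
  qed
qed

text \<open>The series on the line through \<open>z\<close> is evaluated at the point \<open>1\<close>, which therefore has to be
  interior to the disc of convergence.\<close>

lemma larger_disc:
  fixes z :: "complex ^ 'n"
  assumes "z \<in> ball 0 1"
  obtains r where "r > 1" "\<And>l. norm l < r \<Longrightarrow> l *s z \<in> ball 0 1"
proof
  have z: "norm z < 1" using assms by simp
  show "2 / (1 + norm z) > 1" using z by (simp add: field_simps add_pos_nonneg)
  fix l :: complex assume "norm l < 2 / (1 + norm z)"
  then have "norm l * norm z \<le> 2 / (1 + norm z) * norm z" by (intro mult_right_mono) auto
  also have "\<dots> < 1" using z by (simp add: field_simps add_pos_nonneg)
  finally show "l *s z \<in> ball 0 1" by (simp add: norm_smult)
qed

lemma homogeneous_expansion_exists:
  fixes f :: "complex ^ 'n \<Rightarrow> complex"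
  assumes f: "holo f (ball 0 1)"
  shows "\<exists>F. is_homogeneous_expansion f F"
proof -
  have "\<forall>k. \<exists>q. homogeneous_polynomial k q \<and>
    (\<forall>z\<in>ball 0 1. (deriv ^^ k) (\<lambda>l. f (l *s z)) 0 / fact k = q z)"
    using taylor_coefficient_homogeneous_polynomial[OF f] by simp
  from choice[OF this] obtain F where F: "\<And>k. homogeneous_polynomial k (F k)"
    "\<And>k z. z \<in> ball 0 1 \<Longrightarrow> (deriv ^^ k) (\<lambda>l. f (l *s z)) 0 / fact k = F k z" by blast
  have "(\<lambda>k. F k z) sums f z" if z: "z \<in> ball 0 1" for z
  proof -
    obtain r where r: "r > 1" "\<And>l. norm l < r \<Longrightarrow> l *s z \<in> ball 0 1"
      using larger_disc[OF z] by blast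
    have "(\<lambda>l. f (0 + l *s z)) holomorphic_on ball 0 r"
      by (rule holo_holomorphic_on_line[OF f]) (use r in simp)
    then have "(\<lambda>k. (deriv ^^ k) (\<lambda>l. f (0 + l *s z)) 0 / fact k * (1 - 0) ^ k) sums f (0 + 1 *s z)"
      by (rule holomorphic_power_series) (use r in simp)
    then show ?thesis by (simp add: F(2)[OF z])
  qed
  with F(1) show ?thesis unfolding is_homogeneous_expansion_def by blast
qed

text \<open>On the line through \<open>z\<close>, the Euler field is \<open>l * d/dl\<close>; termwise differentiation multiplies
  the coefficient of degree \<open>k\<close> by \<open>k\<close>.\<close>

lemma euler_power_sums:
  fixes f :: "complex ^ 'n \<Rightarrow> complex"
  assumes f: "holo f (ball 0 1)" and F: "is_homogeneous_expansion f F"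
    and r: "\<And>l. norm l < r \<Longrightarrow> l *s z \<in> ball 0 1" and "norm l < r"
  shows "(\<lambda>k. of_nat k ^ m * F k z * l ^ k) sums (euler ^^ m) f (l *s z)"
  using \<open>norm l < r\<close>
proof (induction m arbitrary: l)
  case 0
  have "(\<lambda>k. F k (l *s z)) sums f (l *s z)"
    using F r[OF 0] unfolding is_homogeneous_expansion_def by blast
  moreover have "F k (l *s z) = l ^ k * F k z" for k
    using F homogeneous_polynomial_smult unfolding is_homogeneous_expansion_def by blast
  ultimately show ?case by (simp add: mult.commute)
next
  case (Suc m)
  let ?h = "(euler ^^ m) f"
  have h: "holo ?h (ball 0 1)" by (rule holo_euler_power[OF f open_ball])
  have "((\<lambda>l. ?h (0 + l *s z)) has_field_derivative cderiv ?h (0 + l *s z) z) (at l)"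
    by (rule holo_DERIV_line[OF h]) (use r[OF Suc.prems] in simp)
  then have "((\<lambda>l. ?h (l *s z)) has_field_derivative cderiv ?h (l *s z) z) (at l)"
    by simp
  from termdiffs_sums_strong[OF Suc.IH this Suc.prems]
  have "(\<lambda>k. l * (diffs (\<lambda>k. of_nat k ^ m * F k z) k * l ^ k)) sums (l * cderiv ?h (l *s z) z)"
    by (rule sums_mult)
  then have "(\<lambda>k. of_nat (Suc k) ^ Suc m * F (Suc k) z * l ^ Suc k) sums (l * cderiv ?h (l *s z) z)"
    by (simp add: diffs_def mult_ac)
  \<comment> \<open>The index shift is harmless as the term of degree \<open>0\<close> is multiplied by \<open>0\<close>.\<close>
  then have "(\<lambda>k. of_nat k ^ Suc m * F k z * l ^ k) sums (l * cderiv ?h (l *s z) z)"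
    by (subst (asm) sums_Suc_iff) simp
  moreover have "(euler ^^ Suc m) f (l *s z) = l * cderiv ?h (l *s z) z"
    unfolding euler_power_Suc by (rule cderiv_smult[OF h r[OF Suc.prems]])
  ultimately show ?case by (simp only:)
qed

lemma radial_derivative_eq_euler:
  fixes f :: "complex ^ 'n \<Rightarrow> complex"
  assumes f: "holo f (ball 0 1)" and z: "z \<in> ball 0 1" and "n \<ge> 1"
  shows "radial_derivative n f z = (euler ^^ n) f z"
proof -
  have F: "is_homogeneous_expansion f (homogeneous_part f)"
    unfolding homogeneous_part_def by (rule someI_ex[OF homogeneous_expansion_exists[OF f]])
  obtain r where r: "r > 1" "\<And>l. norm l < r \<Longrightarrow> l *s z \<in> ball 0 1"
    using larger_disc[OF z] by blast
  have "(\<lambda>k. of_nat k ^ n * homogeneous_part f k z * 1 ^ k) sums (euler ^^ n) f (1 *s z)"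
    by (rule euler_power_sums[OF f F r(2)]) (use r in auto)
  then have "(\<lambda>k. of_nat k ^ n * homogeneous_part f k z) sums (euler ^^ n) f z" by simp
  then have "(\<lambda>k. of_nat (Suc k) ^ n * homogeneous_part f (Suc k) z) sums (euler ^^ n) f z"
    using \<open>n \<ge> 1\<close> by (subst sums_Suc_iff) (simp add: zero_power)
  then show ?thesis unfolding radial_derivative_def by (rule sums_unique[symmetric])
qed

section \<open>The estimate for the modulus of smoothness\<close>

lemma holo_dilate:
  assumes f: "holo f (ball 0 1)" and c: "c > 0"
  shows "holo (dilate c f) (ball 0 (1 / c))"
    and cderiv_dilate: "z \<in> ball 0 (1 / c) \<Longrightarrow> cderiv (dilate c f) z v = c * cderiv f (c *\<^sub>R z) v"
proof -
  have D: "(dilate c f has_derivative (\<lambda>v. cderiv f (c *\<^sub>R z) (c *\<^sub>R v))) (at z)" 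
    and lin: "cderiv f (c *\<^sub>R z) (c *\<^sub>R (a *s v)) = a * cderiv f (c *\<^sub>R z) (c *\<^sub>R v)"
      "cderiv f (c *\<^sub>R z) (c *\<^sub>R v) = c * cderiv f (c *\<^sub>R z) v" if "z \<in> ball 0 (1 / c)" for z v a
  proof -
    have cz: "c *\<^sub>R z \<in> ball 0 1" using that c by (simp add: field_simps)
    have "((\<lambda>z. c *\<^sub>R z) has_derivative (\<lambda>v. c *\<^sub>R v)) (at z)"
      by (auto intro!: derivative_eq_intros)
    from has_derivative_compose[OF this holo_has_derivative[OF f cz]]
    show "(dilate c f has_derivative (\<lambda>v. cderiv f (c *\<^sub>R z) (c *\<^sub>R v))) (at z)"
      by (simp add: dilate_def[abs_def])
    show "cderiv f (c *\<^sub>R z) (c *\<^sub>R (a *s v)) = a * cderiv f (c *\<^sub>R z) (c *\<^sub>R v)"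
      "cderiv f (c *\<^sub>R z) (c *\<^sub>R v) = c * cderiv f (c *\<^sub>R z) v"
      by (simp_all add: scaleR_eq_smult[of c v] scaleR_eq_smult[of c "a *s v"] cderiv_smult[OF
        f cz])
  qed
  show "holo (dilate c f) (ball 0 (1 / c))"
    by (rule holoI[OF D lin(1)])
  show "cderiv (dilate c f) z v = c * cderiv f (c *\<^sub>R z) v" if "z \<in> ball 0 (1 / c)"
    using cderiv_eqI[OF D[OF that] lin(1)[OF that]] lin(2)[OF that] by simp
qed

lemma euler_power_dilate:
  assumes f: "holo f (ball 0 1)" and c: "c > 0" and "z \<in> ball 0 (1 / c)"
  shows "(euler ^^ m) (dilate c f) z = (euler ^^ m) f (c *\<^sub>R z)"
  using \<open>z \<in> ball 0 (1 / c)\<close>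
proof (induction m arbitrary: z)
  case (Suc m)
  have h: "holo ((euler ^^ m) f) (ball 0 1)" by (rule holo_euler_power[OF f open_ball])
  have cz: "c *\<^sub>R z \<in> ball 0 1" using Suc.prems c by (simp add: field_simps)
  have "cderiv ((euler ^^ m) (dilate c f)) z = cderiv (dilate c ((euler ^^ m) f)) z"
    by (rule cderiv_cong[OF open_ball Suc.prems holo_dilate(1)[OF h c]]) (simp add: Suc.IH
      dilate_def)
  then have "(euler ^^ Suc m) (dilate c f) z = c * cderiv ((euler ^^ m) f) (c *\<^sub>R z) z"
    unfolding euler_power_Suc using cderiv_dilate[OF h c Suc.prems] by simp
  also have "\<dots> = (euler ^^ Suc m) f (c *\<^sub>R z)"
    unfolding euler_power_Suc using cderiv_smult[OF h cz, of "of_real c" z]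
      by (simp add: scaleR_eq_smult)
  finally show ?case .
qed (simp add: dilate_def)

text \<open>Scaling \<open>x\<close> into the open ball by any factor below \<open>1 / norm x\<close> and letting the factor
  increase.\<close>

lemma contraction_ball_operator:
  assumes "U \<in> ball_operators"
  shows "contraction U"
proof -
  have U: "Vector_Spaces.linear (*s) (*s) U" and ball: "\<And>x. norm x < 1 \<Longrightarrow> norm (U x) < 1"
    using assms by (auto simp: ball_operators_def image_subset_iff)
  have "norm (U x) \<le> norm x" for x
  proof (rule field_le_epsilon)
    fix e :: real assume "e > 0"
    define a where "a = norm x + e"
    have a: "a > 0" "norm x < a" using \<open>e > 0\<close> by (auto simp: a_def add_nonneg_pos)
    then have "norm (of_real (1 / a) *s x) < 1" by (simp add: norm_smult norm_divide)
    from ball[OF this] have "norm (of_real (1 / a) *s U x) < 1"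
      using U by (simp add: clinear_iff)
    then have "norm (U x) < a" using a by (simp add: norm_smult norm_divide)
    then show "norm (U x) \<le> norm x + e" by (simp add: a_def)
  qed
  with U show ?thesis by (simp add: contraction_def)
qed

theorem corollary1p7:
  fixes n :: nat and p :: ennreal
  assumes "n \<ge> 1" and "1 \<le> p"
  shows "\<exists>C::real. C > 0 \<and>
    (\<forall>(f :: complex ^ 'n \<Rightarrow> complex) \<delta>. holomorphic_ball f \<longrightarrow> 0 < \<delta> \<longrightarrow> \<delta> < 1 \<longrightarrow>
       modulus_plus n \<delta> (dilate (1 - \<delta>) f) p
         \<le> ennreal (C * \<delta> ^ n) * integral_mean p (1 - \<delta>) (radial_derivative n f))"
proof -
  note p = \<open>1 \<le> p\<close>
  obtain C where C0: "C \<ge> 0" and "\<forall>(g :: complex ^ 'n \<Rightarrow> complex) \<rho> (U :: complex ^ 'n \<Rightarrow> complex ^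
    'n) V \<delta>.
      holo g (ball 0 \<rho>) \<longrightarrow> \<rho> > 1 \<longrightarrow> contraction U \<longrightarrow>
      \<delta> \<ge> 0 \<longrightarrow> (\<forall>z. norm (U z - z) \<le> \<delta> * norm z) \<longrightarrow> contraction V \<longrightarrow> (\<forall>z. V (U z) = U (V z)) \<longrightarrow>
      sphere_norm p (\<lambda>\<zeta>. (difference U ^^ n) g (V \<zeta>)) \<le> C * \<delta> ^ n * sphere_norm p ((euler ^^ n) g)"
    using sphere_norm_difference_pow[OF p, of n] by blast
  note C = this(2)[rule_format]
  show ?thesis
  \<comment> \<open>The constant of the estimate may be \<open>0\<close>, the required one is positive.\<close>
  proof (intro exI[of _ "C + 1"] conjI allI impI)
    show "C + 1 > 0" using C0 by simp
    fix f :: "complex ^ 'n \<Rightarrow> complex" and \<delta> :: real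
    assume "holomorphic_ball f" and \<delta>: "0 < \<delta>" "\<delta> < 1"
    then have f: "holo f (ball 0 1)" by (simp add: holomorphic_ball_def holo_def)
    define g \<rho> where "g = dilate (1 - \<delta>) f" and "\<rho> = 1 / (1 - \<delta>)"
    have \<rho>: "\<rho> > 1" using \<delta> by (simp add: \<rho>_def field_simps)
    have g: "holo g (ball 0 \<rho>)" unfolding g_def \<rho>_def using \<delta> by (intro holo_dilate(1) f) simp
    have rhs: "integral_mean p (1 - \<delta>) (radial_derivative n f) = ennreal (sphere_norm p ((euler ^^
      n) g))"
    proof -
      have "integral_mean p (1 - \<delta>) (radial_derivative n f) = integral_mean p 1 ((euler ^^ n) g)"
      proof (rule integral_mean_cong)
        fix \<zeta> :: "complex ^ 'n" assume \<zeta>: "norm \<zeta> = 1"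
        have "radial_derivative n f ((1 - \<delta>) *\<^sub>R \<zeta>) = (euler ^^ n) f ((1 - \<delta>) *\<^sub>R \<zeta>)"
          using \<zeta> \<delta> assms(1) by (intro radial_derivative_eq_euler f) auto
        also have "\<dots> = (euler ^^ n) g \<zeta>"
          unfolding g_def using \<zeta> \<delta> \<rho> by (intro euler_power_dilate[symmetric] f) (auto simp: \<rho>_def)
        finally show "radial_derivative n f ((1 - \<delta>) *\<^sub>R \<zeta>) = (euler ^^ n) g (1 *\<^sub>R \<zeta>)" by simp
      qed
      also have "\<dots> = ennreal (sphere_norm p ((euler ^^ n) g))"
        by (intro integral_mean_eq_sphere_norm p continuous_on_sphere_holo[OF _ \<rho>]
          holo_euler_power g open_ball)
      finally show ?thesis .
    qed
    have gc: "continuous_on (cball 0 1) g"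
      using \<rho> by (intro continuous_on_subset[OF holo_continuous_on[OF g]]) auto
    have "integral_mean p r ((difference U ^^ n) g) \<le> ennreal (C * \<delta> ^ n * sphere_norm p ((euler ^^
      n) g))"
      if U: "U \<in> ball_operators" "onorm (\<lambda>z. U z - z) < \<delta>" and r: "r \<in> {0<..<1}" for U and r :: real
    proof -
      have Uc: "contraction U" by (rule contraction_ball_operator) fact
      have lin: "bounded_linear (\<lambda>z. U z - z)"
        using contraction_linear[OF Uc] by (intro bounded_linear_sub bounded_linear_ident) (simp
          add: linear_conv_bounded_linear)
      have near: "norm (U z - z) \<le> \<delta> * norm z" for z
        using onorm[OF lin, of z] U(2) by (meson less_imp_le mult_right_mono norm_ge_zero
          order_trans)
      \<comment> \<open>The mean over the sphere of radius \<open>r\<close> is the mean of the composition with this homothety.\<close>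
      define V :: "complex ^ 'n \<Rightarrow> complex ^ 'n" where "V = (\<lambda>z. of_real r *s z)"
      have V: "contraction V"
        using r by (intro contractionI)
          (auto simp: V_def vector_add_ldistrib vector_smult_assoc mult.commute norm_smult intro:
            mult_left_le_one_le)
      have VU: "V (U z) = U (V z)" for z by (simp add: V_def contraction_smult[OF Uc])
      have "integral_mean p r ((difference U ^^ n) g) = integral_mean p 1 (\<lambda>\<zeta>. (difference U ^^ n)
        g (V \<zeta>))"
        by (rule integral_mean_cong) (simp add: V_def scaleR_eq_smult)
      also have "\<dots> = ennreal (sphere_norm p (\<lambda>\<zeta>. (difference U ^^ n) g (V \<zeta>)))"
        by (intro integral_mean_eq_sphere_norm p continuous_on_sphere_contraction[OF V]
          continuous_on_difference_pow[OF Uc] gc)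
      also have "\<dots> \<le> ennreal (C * \<delta> ^ n * sphere_norm p ((euler ^^ n) g))"
        using \<delta> by (intro ennreal_leI C[OF g \<rho> Uc _ near V VU]) simp
      finally show ?thesis .
    qed
    then have "modulus_plus n \<delta> g p \<le> ennreal (C * \<delta> ^ n * sphere_norm p ((euler ^^ n) g))"
      unfolding modulus_plus_def hardy_norm_def by (intro SUP_least) auto
    also have "\<dots> \<le> ennreal ((C + 1) * \<delta> ^ n * sphere_norm p ((euler ^^ n) g))"
      using \<delta> by (intro ennreal_leI mult_right_mono) auto
    also have "\<dots> = ennreal ((C + 1) * \<delta> ^ n) * integral_mean p (1 - \<delta>) (radial_derivative n f)"
      unfolding rhs using C0 \<delta> by (intro ennreal_mult) auto
    finally show "modulus_plus n \<delta> (dilate (1 - \<delta>) f) p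
         \<le> ennreal ((C + 1) * \<delta> ^ n) * integral_mean p (1 - \<delta>) (radial_derivative n f)"
      by (simp only: g_def)
  qed
qed

end
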